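(* For $m\in\{0,1,2\}$ we have $$\frac{Z^{(m)}(Q_B,Q_F;q)}{K^2_{(0)(0)}(Q_F)}=\sum_{\mu^1,\mu^2}\left((-1)^mQ_B2^{-4}Q_F^{-1}\right)^{|\mu^1|+|\mu^2|}Q_F^{m|\mu^2|}q^{-\frac m2(\kappa_{\mu^1}+\kappa_{\mu^2})}\prod_{l,n=1}^2\prod_{i,j\ge1}\frac{\sinh\frac\beta2(a_{ln}+\hbar(\mu^l_i-\mu^n_j+j-i))}{\sinh\frac\beta2(a_{ln}+\hbar(j-i))},$$ where the sum is over all pairs of partitions, $a_{11}=a_{22}=0$, $a_{12}=-a_{21}=2a$, $Q_F=e^{-2a\beta}$ and $q=e^{-\beta\hbar}$. In particular, $$\frac{Z^{(0)}(Q_B,Q_F;q)}{K^2_{(0)(0)}(Q_F)}=\sum_{\mu^1,\mu^2}\left(\frac{Q_B}{2^4Q_F}\right)^{|\mu^1|+|\mu^2|}\prod_{l,n=1}^2\prod_{i,j\ge1}\frac{\sinh\frac\beta2(a_{ln}+\hbar(\mu^l_i-\mu^n_j+j-i))}{\sinh\frac\beta2(a_{ln}+\hbar(j-i))}.$$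
   Context: A partition $\mu$ is a nonincreasing sequence $\mu_1\ge\mu_2\ge\cdots$ of nonnegative integers with finitely many nonzero terms; $l(\mu)$ is the number of nonzero terms, $|\mu|=\sum_i\mu_i$, $\mu^t$ the transposed partition, $(0)$ the empty partition, $\kappa_\mu=\sum_{i=1}^{l(\mu)}\mu_i(\mu_i-2i+1)$. Let $[m]=q^{m/2}-q^{-m/2}$. For a symmetric function $F$, $F(q^{\mu+\rho})$ denotes its evaluation at $x_i=q^{\mu_i-i+1/2}$, $i\ge1$, regarded as a rational function of $q^{1/2}$ (series converge for $|q|>1$; the power sums become $p_n=\sum_{i=1}^{l(\mu)}(q^{n(\mu_i-i+1/2)}-q^{n(-i+1/2)})+\frac{1}{q^{n/2}-q^{-n/2}}$). $s_\nu$ is the Schur function. Define $$\mathcal{W}_\mu=q^{\kappa_\mu/4}\prod_{1\le i<j\le l(\mu)}\frac{[\mu_i-\mu_j+j-i]}{[j-i]}\prod_{i=1}^{l(\mu)}\prod_{v=1}^{\mu_i}\frac{1}{[v-i+l(\mu)]},\quad \mathcal{W}_{\mu\nu}=\mathcal{W}_\mu\, s_\nu(q^{\mu+\rho}),\quad K_{\mu^1\mu^2}(Q)=\sum_{\nu}Q^{|\nu|}\mathcal{W}_{\mu^1\nu}\mathcal{W}_{\nu\mu^2}.$$ The partition function (of the canonical line bundle of the Hirzebruch surface $\mathbb{F}_m$, $m=0,1,2$) is the formal series $$Z^{(m)}(Q_B,Q_F;q)=\sum_{\mu^1,\mu^2}Q_B^{|\mu^1|+|\mu^2|}\left[(-1)^{|\mu^1|+|\mu^2|}Q_F^{|\mu^2|}q^{-\frac12(\kappa_{\mu^1}+\kappa_{\mu^2})}\right]^mK_{\mu^1(\mu^2)^t}(Q_F)^2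 .$$ Here $a,\beta,\hbar$ are generic parameters; hyperbolic sines are expressed through exponentials, so $\sinh\frac\beta2(2a+\hbar m)=\frac12(Q_F^{-1/2}q^{-m/2}-Q_F^{1/2}q^{m/2})$ and $\sinh\frac{\beta\hbar m}{2}=\frac12(q^{-m/2}-q^{m/2})$. The identities are between formal power series in $Q_B$, whose coefficients are expanded as power series in $Q_F$ over rational functions of fractional powers of $q$. Meaning of the formal infinite products (taken after cancellation of equal factors). For partitions $\lambda,\mu$ and $m\in\mathbb{Z}$ let $e_m(\lambda,\mu)$ be the coefficient of $t^m$ in $\sum_{i,j\ge1}(t^{\lambda_i-\mu_j+j-i}-t^{j-i})$, computed coefficientwise (for each $m$ only finitely many $(i,j)$ contribute); let $e'_m(\mu)$ be the coefficient of $t^m$ in $\sum_{1\le i<j<\infty}(t^{\mu_i-\mu_j+j-i}-t^{j-i})$; both vanish for almost all $m$. The product over $i,j\ge1$ for $(l,n)=(1,2)$ means $\prod_m(\sinh\frac\beta2(a_{12}+\hbar m))^{e_m(\mu^1,\mu^2)}$. Since $\sinh$ is odd, the $(i,j)$ ratio for $(2,1)$ equals the $(j,i)$ ratio for $(1,2)$, and the product for $(2,1)$ is by convention equal to that for $(1,2)$. For $l=n$ the factors with $i=j$ are $1$ and the $(i,j)$ and $(j,i)$ ratios are equal, so the product means $\left(\prod_{m\ge1}(\sinh\frac{\beta\hbar m}{2})^{e'_m(\mu^l)}\right)^2$. *)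

theory Defs
  imports
    "HOL-Computational_Algebra.Computational_Algebra"
    "Jordan_Normal_Form.Determinant"
begin

section \<open>Partitions\<close>

text \<open>
  Partitions are functions \<open>\<mu> :: nat \<Rightarrow> nat\<close> indexed from 1, as in \<open>\<mu>\<^sub>1 \<ge> \<mu>\<^sub>2 \<ge> \<dots>\<close>.
  The unused value at 0 is pinned to 0, so that every partition is represented exactly once.
\<close>

definition partitions :: "(nat \<Rightarrow> nat) set" where
  "partitions = {\<mu>. \<mu> 0 = 0 \<and> (\<forall>i\<ge>1. \<mu> (Suc i) \<le> \<mu> i) \<and> finite {i. \<mu> i \<noteq> 0}}"

definition empty_part :: "nat \<Rightarrow> nat" where
  "empty_part = (\<lambda>_. 0)"

definition plen :: "(nat \<Rightarrow> nat) \<Rightarrow> nat" where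
  "plen \<mu> = card {i. \<mu> i \<noteq> 0}"

definition part_size :: "(nat \<Rightarrow> nat) \<Rightarrow> nat" where
  "part_size \<mu> = (\<Sum>i=1..plen \<mu>. \<mu> i)"

definition ptrans :: "(nat \<Rightarrow> nat) \<Rightarrow> (nat \<Rightarrow> nat)" where
  "ptrans \<mu> = (\<lambda>i. if i = 0 then 0 else card {j. j \<ge> 1 \<and> \<mu> j \<ge> i})"

definition kappa :: "(nat \<Rightarrow> nat) \<Rightarrow> int" where
  "kappa \<mu> = (\<Sum>i=1..plen \<mu>. int (\<mu> i) * (int (\<mu> i) - 2 * int i + 1))"

lemma even_kappa: "even (kappa \<mu>)"
  unfolding kappa_def by (intro dvd_sum) auto


section \<open>Sums of formal power series\<close>

text \<open>
  The coefficientwise sum of a locally finite family of formal power series: for each \<open>n\<close>, only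
  finitely many members of the family have a nonzero \<open>n\<close>-th coefficient.  All families below
  are locally finite, because their members are multiples of \<open>X ^ |\<mu>|\<close>.
\<close>

definition fps_family_sum :: "('i \<Rightarrow> 'a::comm_monoid_add fps) \<Rightarrow> 'i set \<Rightarrow> 'a fps" where
  "fps_family_sum f A = Abs_fps (\<lambda>n. \<Sum>i | i \<in> A \<and> fps_nth (f i) n \<noteq> 0. fps_nth (f i) n)"


section \<open>Schur functions\<close>

text \<open>
  Symmetric functions (over a field of characteristic 0) are polynomials in the power sums, so a
  specialization is given by the values \<open>p n\<close> of the power sums, \<open>n \<ge> 1\<close>.  The complete homogeneous
  functions are determined by \<open>\<Sum>\<^sub>n h\<^sub>n z\<^sup>n = exp (\<Sum>\<^sub>n p\<^sub>n z\<^sup>n / n)\<close>, and the Schur function is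
  \<open>det (h\<^bsub>\<nu>\<^sub>i - i + j\<^esub>)\<close> with \<open>1 \<le> i, j \<le> l(\<nu>)\<close> (Jacobi-Trudi), where \<open>h\<^sub>k = 0\<close> for \<open>k < 0\<close>.
\<close>

definition complete_fps :: "(nat \<Rightarrow> 'a::field_char_0) \<Rightarrow> 'a fps" where
  "complete_fps p =
     fps_compose (fps_exp 1) (Abs_fps (\<lambda>n. if n = 0 then 0 else p n / of_nat n))"

definition complete_sym :: "(nat \<Rightarrow> 'a::field_char_0) \<Rightarrow> int \<Rightarrow> 'a" where
  "complete_sym p k = (if k < 0 then 0 else fps_nth (complete_fps p) (nat k))"

text \<open>Matrix indices start at 0; the shifts of the two indices cancel in \<open>- i + j\<close>.\<close>

definition schur :: "(nat \<Rightarrow> nat) \<Rightarrow> (nat \<Rightarrow> 'a::field_char_0) \<Rightarrow> 'a" where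
  "schur \<nu> p = det (mat (plen \<nu>) (plen \<nu>)
     (\<lambda>(i, j). complete_sym p (int (\<nu> (Suc i)) - int i + int j)))"


section \<open>Rational functions of $q^{1/2}$\<close>

type_synonym qfun = "rat poly fract"

text \<open>The variable \<open>q\<^bsup>1/2\<^esup>\<close>; thus \<open>qh powi k\<close> is \<open>q\<^bsup>k/2\<^esup>\<close>.\<close>

definition qh :: qfun where
  "qh = Fract [:0, 1:] 1"

definition qbr :: "int \<Rightarrow> qfun" where
  "qbr m = qh powi m - qh powi (- m)"

text \<open>The power sums at \<open>x\<^sub>i = q\<^bsup>\<mu>\<^sub>i - i + 1/2\<^esup>\<close>, \<open>i \<ge> 1\<close>, as rational functions.\<close>

definition psum_rho :: "(nat \<Rightarrow> nat) \<Rightarrow> nat \<Rightarrow> qfun" where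
  "psum_rho \<mu> n =
     (\<Sum>i=1..plen \<mu>. qh powi (int n * (2 * int (\<mu> i) - 2 * int i + 1))
                    - qh powi (int n * (- 2 * int i + 1)))
     + 1 / (qh powi int n - qh powi (- int n))"

text \<open>As \<open>\<kappa>\<close> is even (lemma \<open>even_kappa\<close>), \<open>q\<^bsup>\<kappa>/4\<^esup>\<close> is \<open>qh powi (\<kappa> div 2)\<close>.\<close>

definition W1 :: "(nat \<Rightarrow> nat) \<Rightarrow> qfun" where
  "W1 \<mu> = qh powi (kappa \<mu> div 2)
     * (\<Prod>(i, j) | 1 \<le> i \<and> i < j \<and> j \<le> plen \<mu>.
          qbr (int (\<mu> i) - int (\<mu> j) + int j - int i) / qbr (int j - int i))
     * (\<Prod>i=1..plen \<mu>. \<Prod>v=1..\<mu> i. 1 / qbr (int v - int i + int (plen \<mu>)))"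

definition W2 :: "(nat \<Rightarrow> nat) \<Rightarrow> (nat \<Rightarrow> nat) \<Rightarrow> qfun" where
  "W2 \<mu> \<nu> = W1 \<mu> * schur \<nu> (psum_rho \<mu>)"

text \<open>The series \<open>K\<^bsub>\<mu>\<^sup>1\<mu>\<^sup>2\<^esub>(Q)\<close> in the formal variable \<open>Q = fps_X\<close>.\<close>

definition Kser :: "(nat \<Rightarrow> nat) \<Rightarrow> (nat \<Rightarrow> nat) \<Rightarrow> qfun fps" where
  "Kser \<mu>1 \<mu>2 =
     fps_family_sum (\<lambda>\<nu>. fps_X ^ part_size \<nu> * fps_const (W2 \<mu>1 \<nu> * W2 \<nu> \<mu>2)) partitions"


section \<open>The partition function\<close>

text \<open>
  The coefficients of powers of \<open>Q\<^sub>B\<close> are taken in the field of formal Laurent series in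
  \<open>Q\<^sub>F\<^bsup>1/2\<^esup>\<close> over the rational functions of \<open>q\<^bsup>1/2\<^esup>\<close>; it contains the formal power series in \<open>Q\<^sub>F\<close>
  and the hyperbolic sines.
\<close>

type_synonym cfun = "qfun fls"

definition QFh :: cfun where
  "QFh = fls_X"

definition QF :: cfun where
  "QF = QFh ^ 2"

text \<open>\<open>q\<^bsup>k/2\<^esup>\<close> as a coefficient.\<close>

definition cq :: "int \<Rightarrow> cfun" where
  "cq k = fls_const (qh powi k)"

definition QB :: "cfun fps" where
  "QB = fps_X"

text \<open>\<open>K\<^bsub>\<mu>\<^sup>1\<mu>\<^sup>2\<^esub>(Q\<^sub>F)\<close>: substitution of \<open>Q\<^sub>F = (Q\<^sub>F\<^bsup>1/2\<^esup>)\<^sup>2\<close> for \<open>Q\<close>.\<close>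

definition KQF :: "(nat \<Rightarrow> nat) \<Rightarrow> (nat \<Rightarrow> nat) \<Rightarrow> cfun" where
  "KQF \<mu>1 \<mu>2 = fps_to_fls (fps_compose (Kser \<mu>1 \<mu>2) (fps_X ^ 2))"

definition Z :: "nat \<Rightarrow> cfun fps" where
  "Z m = fps_family_sum (\<lambda>(\<mu>1, \<mu>2).
     QB ^ (part_size \<mu>1 + part_size \<mu>2)
     * fps_const (((- 1) ^ (part_size \<mu>1 + part_size \<mu>2) * QF ^ part_size \<mu>2 * cq (- (kappa \<mu>1 + kappa \<mu>2))) ^ m
                  * KQF \<mu>1 (ptrans \<mu>2) ^ 2))
     (partitions \<times> partitions)"


section \<open>The products of hyperbolic sines\<close>

text \<open>
  \<open>sinh_half c m\<close> is \<open>sinh (\<beta>/2 (2ac + \<hbar>m))\<close> with \<open>Q\<^sub>F = exp (- 2a\<beta>)\<close> and \<open>q = exp (- \<beta>\<hbar>)\<close>.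
  The arguments with \<open>a\<^bsub>12\<^esub> = 2a\<close> and \<open>a\<^bsub>11\<^esub> = a\<^bsub>22\<^esub> = 0\<close> are given by \<open>c = 1\<close> and \<open>c = 0\<close>.
\<close>

definition sinh_half :: "int \<Rightarrow> int \<Rightarrow> cfun" where
  "sinh_half c m = (QFh powi (- c) * cq (- m) - QFh powi c * cq m) / 2"

text \<open>
  The coefficients of \<open>t\<^sup>m\<close> in the sums of \<open>t\<^bsup>\<nu>\<^sub>i - \<mu>\<^sub>j + j - i\<^esup> - t\<^bsup>j - i\<^esup>\<close> over \<open>i, j \<ge> 1\<close> and
  \<open>t\<^bsup>\<mu>\<^sub>i - \<mu>\<^sub>j + j - i\<^esup> - t\<^bsup>j - i\<^esup>\<close> over \<open>1 \<le> i < j\<close>.  For given \<open>m\<close> only finitely many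
  pairs \<open>(i, j)\<close> contribute a nonzero summand, and the sums are taken over those.
\<close>

definition ecoef_term :: "(nat \<Rightarrow> nat) \<Rightarrow> (nat \<Rightarrow> nat) \<Rightarrow> int \<Rightarrow> nat \<Rightarrow> nat \<Rightarrow> int" where
  "ecoef_term \<nu> \<mu> m i j =
     of_bool (int (\<nu> i) - int (\<mu> j) + int j - int i = m) - of_bool (int j - int i = m)"

definition ecoef :: "(nat \<Rightarrow> nat) \<Rightarrow> (nat \<Rightarrow> nat) \<Rightarrow> int \<Rightarrow> int" where
  "ecoef \<nu> \<mu> m =
     (\<Sum>(i, j) | 1 \<le> i \<and> 1 \<le> j \<and> ecoef_term \<nu> \<mu> m i j \<noteq> 0. ecoef_term \<nu> \<mu> m i j)"

definition ecoef' :: "(nat \<Rightarrow> nat) \<Rightarrow> int \<Rightarrow> int" where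
  "ecoef' \<mu> m =
     (\<Sum>(i, j) | 1 \<le> i \<and> i < j \<and> ecoef_term \<mu> \<mu> m i j \<noteq> 0. ecoef_term \<mu> \<mu> m i j)"

definition sinh_prod_cross :: "(nat \<Rightarrow> nat) \<Rightarrow> (nat \<Rightarrow> nat) \<Rightarrow> cfun" where
  "sinh_prod_cross \<nu> \<mu> = (\<Prod>m | ecoef \<nu> \<mu> m \<noteq> 0. sinh_half 1 m powi ecoef \<nu> \<mu> m)"

definition sinh_prod_self :: "(nat \<Rightarrow> nat) \<Rightarrow> cfun" where
  "sinh_prod_self \<mu> = (\<Prod>m | m \<ge> 1 \<and> ecoef' \<mu> m \<noteq> 0. sinh_half 0 m powi ecoef' \<mu> m) ^ 2"

text \<open>
  The product over \<open>i, j \<ge> 1\<close> for \<open>(l, n)\<close>.  Since \<open>sinh\<close> is odd, the \<open>(i, j)\<close> ratio for \<open>(2, 1)\<close>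
  equals the \<open>(j, i)\<close> ratio for \<open>(1, 2)\<close>; the product for \<open>(2, 1)\<close> is by convention the one
  for \<open>(1, 2)\<close>.
\<close>

definition sinh_prod :: "nat \<Rightarrow> nat \<Rightarrow> (nat \<Rightarrow> nat) \<Rightarrow> (nat \<Rightarrow> nat) \<Rightarrow> cfun" where
  "sinh_prod l n \<mu>1 \<mu>2 =
     (if l = n then sinh_prod_self (if l = 1 then \<mu>1 else \<mu>2) else sinh_prod_cross \<mu>1 \<mu>2)"

end

theory Submission
  imports Defs
begin

text \<open>
  Write \<open>p\<^sub>n(\<mu>)\<close> for the power sums at \<open>q\<^bsup>\<mu>+\<rho>\<^esup>\<close>, \<open>H(p)\<close> for the generating series of the complete
  symmetric functions with power sums \<open>p\<close>, and \<open>s\<^sub>\<nu>(p)\<close> for Schur functions.  Both sides of the theorem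
  are sums over the same pairs of partitions with the same powers of \<open>Q\<^sub>B\<close>, and the factor depending on
  \<open>m\<close> is visibly the same, so the theorem is an identity for each pair (lemma \<open>KQF_square\<close>):
  \<open>(K\<^bsub>\<mu>,\<alpha>\<^sup>t\<^esub> / K\<^bsub>0,0\<^esub>)\<^sup>2\<close> equals \<open>(2\<^sup>4 Q\<^sub>F)\<^bsup>-|\<mu>|-|\<alpha>|\<^esup>\<close> times the four products of hyperbolic sines.

  The coefficients of \<open>K\<close> become summable because of the symmetry \<open>W\<^bsub>\<nu>\<alpha>\<^esub> = W\<^bsub>\<alpha>\<nu>\<^esub>\<close> (lemma \<open>W2_commute\<close>).
  In \<open>N\<close> variables it holds because \<open>s\<^sub>\<nu>\<close> is a quotient of alternants and the alternant at the powers
  of \<open>q\<close> given by \<open>\<mu>\<close> is the determinant of \<open>q\<^bsup>(\<mu>\<^sub>i+N-i)(\<nu>\<^sub>j+N-j)\<^esup>\<close>, which is symmetric in \<open>\<mu>\<close> and \<open>\<nu>\<close>.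
  After the symmetry, \<open>K\<^bsub>\<mu>\<lambda>\<^esub>(Q) = W\<^sub>\<mu> W\<^sub>\<lambda> \<Sum>\<^sub>\<nu> s\<^sub>\<nu>(p(\<mu>)) s\<^sub>\<nu>(p(\<lambda>)) Q\<^bsup>|\<nu>|\<^esup>\<close> is summed by the Cauchy identity
  (lemma \<open>cauchy_rho\<close>) to \<open>W\<^sub>\<mu> W\<^sub>\<lambda> H(p(\<mu>) p(\<lambda>))\<close>, with \<open>W\<^sub>\<mu> = s\<^sub>\<mu>(p(0))\<close> (lemma \<open>W1_eq_schur\<close>).
  The passage from \<open>N\<close> to infinitely many variables is algebraic: the power sums of \<open>N\<close> variables depend
  polynomially on \<open>t = q\<^bsup>-N\<^esup>\<close>, so an identity valid for all large \<open>N\<close> is an identity of polynomials in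
  \<open>t\<close>, and \<open>t = 0\<close> gives the specialization at \<open>q\<^bsup>\<mu>+\<rho>\<^esup>\<close> (lemma \<open>truncation_principle\<close>).

  With \<open>d = q\<^bsup>n/2\<^esup> - q\<^bsup>-n/2\<^esup>\<close> and the content polynomial \<open>C\<^sub>\<mu>(w) = \<Sum> w\<^bsup>j-i\<^esup>\<close> (over the boxes \<open>(i, j)\<close> of
  \<open>\<mu>\<close>) one has \<open>p\<^sub>n(\<mu>) = d C\<^sub>\<mu>(q\<^sup>n) + 1/d\<close>, and transposition inverts \<open>w\<close>.  Hence
  \<open>p\<^sub>n(\<mu>) p\<^sub>n(\<alpha>\<^sup>t) - p\<^sub>n(0)\<^sup>2\<close> is a Laurent polynomial in \<open>q\<^sup>n\<close>.  Telescoping the defining double sum of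
  the exponents \<open>e\<^sub>m(\<mu>, \<alpha>)\<close> in both indices shows that this Laurent polynomial is \<open>- \<Sum>\<^sub>m e\<^sub>m q\<^bsup>mn\<^esup>\<close> (lemmas
  \<open>ecoef_eq_pair_functional\<close> and \<open>psum_rho_product\<close>).  Since \<open>H\<close> turns sums into products, it follows that
  \<open>K\<^bsub>\<mu>,\<alpha>\<^sup>t\<^esub> / K\<^bsub>0,0\<^esub> = W\<^sub>\<mu> W\<^bsub>\<alpha>\<^sup>t\<^esub> \<Prod>\<^sub>m (1 - q\<^sup>m Q\<^sub>F)\<^bsup>e\<^sub>m\<^esup>\<close> (lemma \<open>KQF_ratio\<close>).  The product gives the hyperbolic
  sines with \<open>a\<^sub>1\<^sub>2\<close>, and the product formula of \<open>W\<close> gives those with \<open>a\<^sub>1\<^sub>1\<close> and \<open>a\<^sub>2\<^sub>2\<close>; that \<open>W\<close> is taken at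
  \<open>\<alpha>\<^sup>t\<close> for the latter is harmless, since transposition only negates contents and leaves the exponents
  unchanged (lemma \<open>sinh_prod_self_ptrans\<close>).  The remaining powers of \<open>q\<close>, \<open>2\<close> and \<open>Q\<^sub>F\<close> cancel.
\<close>

section \<open>Complete symmetric functions of a specialization\<close>

text \<open>
  The equation determines the coefficient of index \<open>n + 1\<close>, times \<open>n + 1\<close>, from the earlier ones.
\<close>

lemma fps_log_ode_unique:
  fixes F G :: "'a::field_char_0 fps"
  assumes "fps_deriv F = L * F" "fps_deriv G = L * G" "fps_nth F 0 = fps_nth G 0"
  shows "F = G"
proof -
  have "fps_nth F n = fps_nth G n" for n
  proof (induction n rule: less_induct)
    case (less n)
    show ?case
    proof (cases n)
      case 0
      then show ?thesis using assms by simp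
    next
      case (Suc m)
      have "of_nat (Suc m) * fps_nth F (Suc m) = fps_nth (L * F) m" 
        using assms(1) by (metis Suc_eq_plus1 fps_deriv_nth)
      also have "\<dots> = fps_nth (L * G) m"
        unfolding fps_mult_nth using less Suc by (intro sum.cong) auto
      also have "\<dots> = of_nat (Suc m) * fps_nth G (Suc m)"
        using assms(2) by (metis Suc_eq_plus1 fps_deriv_nth)
      finally show ?thesis using Suc by (simp del: of_nat_Suc)
    qed
  qed
  then show ?thesis by (simp add: fps_eq_iff)
qed

lemma complete_fps_nth_0 [simp]: "fps_nth (complete_fps p) 0 = 1"
  by (simp add: complete_fps_def)

lemma complete_fps_deriv:
  "fps_deriv (complete_fps p) = Abs_fps (\<lambda>n. p (Suc n)) * complete_fps p"
proof -
  let ?L = "Abs_fps (\<lambda>n. if n = 0 then 0 else p n / of_nat n)"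
  have "fps_deriv (complete_fps p) = (fps_deriv (fps_exp 1) oo ?L) * fps_deriv ?L"
    unfolding complete_fps_def by (rule fps_compose_deriv) simp
  moreover have "fps_deriv ?L = Abs_fps (\<lambda>n. p (Suc n))"
    by (auto simp: fps_eq_iff simp del: of_nat_Suc)
  ultimately show ?thesis
    by (simp add: complete_fps_def mult.commute)
qed

lemma complete_fps_recurrence:
  "of_nat (Suc n) * fps_nth (complete_fps p) (Suc n) = (\<Sum>i=0..n. p (Suc i) * fps_nth (complete_fps p) (n - i))"
  using arg_cong[OF complete_fps_deriv[of p], of "\<lambda>f. fps_nth f n"] by (simp add: fps_mult_nth)

text \<open>
  Identities between generating series of complete functions are verified through this differential
  equation, which avoids composing with the exponential series.
\<close>

lemma complete_fps_unique:
  assumes "fps_deriv F = Abs_fps (\<lambda>n. p (Suc n)) * F" "fps_nth F 0 = 1"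
  shows "complete_fps p = F"
  using fps_log_ode_unique[OF complete_fps_deriv assms(1)] assms(2) by simp

lemma complete_fps_cong:
  assumes "\<And>n. n \<ge> 1 \<Longrightarrow> p n = p' n"
  shows "complete_fps p = complete_fps p'"
  unfolding complete_fps_def using assms by (intro arg_cong2[where f = fps_compose]) (auto simp: fps_eq_iff)

lemma complete_fps_add:
  "complete_fps (\<lambda>n. p n + p' n) = complete_fps p * complete_fps p'"
proof (rule complete_fps_unique)
  have "Abs_fps (\<lambda>n. p (Suc n) + p' (Suc n)) = Abs_fps (\<lambda>n. p (Suc n)) + Abs_fps (\<lambda>n. p' (Suc n))"
    by (simp add: fps_eq_iff)
  then show "fps_deriv (complete_fps p * complete_fps p') =
      Abs_fps (\<lambda>n. p (Suc n) + p' (Suc n)) * (complete_fps p * complete_fps p')"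
    by (simp add: complete_fps_deriv algebra_simps)
qed simp

lemma complete_fps_zero: "complete_fps (\<lambda>n. 0) = 1"
  by (rule complete_fps_unique) (auto simp: fps_eq_iff fps_mult_nth)

lemma complete_fps_sum:
  "finite A \<Longrightarrow> complete_fps (\<lambda>n. \<Sum>i\<in>A. p i n) = (\<Prod>i\<in>A. complete_fps (p i))"
  by (induction A rule: finite_induct) (auto simp: complete_fps_zero complete_fps_add)

lemma complete_fps_scale:
  "complete_fps (\<lambda>n. x ^ n * p n) = Abs_fps (\<lambda>n. x ^ n * fps_nth (complete_fps p) n)"
proof (rule complete_fps_unique)
  have "of_nat (Suc n) * (x ^ Suc n * fps_nth (complete_fps p) (Suc n)) =
      (\<Sum>i=0..n. x ^ Suc i * p (Suc i) * (x ^ (n - i) * fps_nth (complete_fps p) (n - i)))" for n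
  proof -
    have "of_nat (Suc n) * (x ^ Suc n * fps_nth (complete_fps p) (Suc n)) =
        x ^ Suc n * (of_nat (Suc n) * fps_nth (complete_fps p) (Suc n))" by simp
    also have "\<dots> = (\<Sum>i=0..n. x ^ Suc n * (p (Suc i) * fps_nth (complete_fps p) (n - i)))"
      by (simp add: complete_fps_recurrence sum_distrib_left del: of_nat_Suc)
    also have "\<dots> = (\<Sum>i=0..n. x ^ Suc i * p (Suc i) * (x ^ (n - i) * fps_nth (complete_fps p) (n - i)))"
    proof (rule sum.cong)
      fix i assume "i \<in> {0..n}"
      then have "x ^ Suc n = x ^ Suc i * x ^ (n - i)"
        by (simp flip: power_add)
      then show "x ^ Suc n * (p (Suc i) * fps_nth (complete_fps p) (n - i)) = x ^ Suc i * p (Suc i) * (x ^ (n - i) * fps_nth (complete_fps p) (n - i))"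
        by (simp only: mult_ac)
    qed simp
    finally show ?thesis .
  qed
  then show "fps_deriv (Abs_fps (\<lambda>n. x ^ n * fps_nth (complete_fps p) n)) =
      Abs_fps (\<lambda>n. x ^ Suc n * p (Suc n)) * Abs_fps (\<lambda>n. x ^ n * fps_nth (complete_fps p) n)"
    by (auto simp: fps_eq_iff fps_mult_nth simp del: of_nat_Suc power_Suc)
qed simp

lemma complete_fps_one_variable: "complete_fps (\<lambda>n. 1) = Abs_fps (\<lambda>n. 1)"
  by (rule complete_fps_unique) (auto simp: fps_eq_iff fps_mult_nth)

lemma complete_fps_geometric: "(1 - fps_const x * fps_X) * complete_fps (\<lambda>n. x ^ n) = 1"
proof -
  have "complete_fps (\<lambda>n. x ^ n) = Abs_fps (\<lambda>n. x ^ n)"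
    using complete_fps_scale[of x "\<lambda>n. 1"] by (simp add: complete_fps_one_variable)
  moreover have "(1 - fps_const x * fps_X) * Abs_fps (\<lambda>n. x ^ n) = 1"
  proof -
    have "fps_nth ((1 - fps_const x * fps_X) * Abs_fps (\<lambda>n. x ^ n)) k = fps_nth 1 k" for k
      by (cases k) (simp_all add: algebra_simps)
    then show ?thesis by (simp add: fps_eq_iff)
  qed
  ultimately show ?thesis by simp
qed

section \<open>Jacobi--Trudi determinants and alternants\<close>

lemma part_antimono:
  assumes "\<mu> \<in> partitions" "1 \<le> i" "i \<le> j"
  shows "\<mu> j \<le> \<mu> i"
  using assms(3)
proof (induction j rule: dec_induct)
  case (step n)
  then have "\<mu> (Suc n) \<le> \<mu> n" using assms(1,2) by (auto simp: partitions_def)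
  with step show ?case by simp
qed simp

lemma part_support:
  assumes "\<mu> \<in> partitions"
  shows "{i. \<mu> i \<noteq> 0} = {1..plen \<mu>}"
proof (cases "{i. \<mu> i \<noteq> 0} = {}")
  case True
  then show ?thesis unfolding plen_def by simp
next
  case False
  let ?S = "{i. \<mu> i \<noteq> 0}"
  have fin: "finite ?S" and 0: "\<mu> 0 = 0" using assms by (auto simp: partitions_def)
  have "Max ?S \<in> ?S" using Max_in[OF fin False] .
  have "?S = {1..Max ?S}"
  proof (intro equalityI subsetI)
    fix i assume "i \<in> ?S"
    then show "i \<in> {1..Max ?S}" using 0 Max_ge[OF fin] by (cases i) auto
  next
    fix i assume i: "i \<in> {1..Max ?S}"
    then have "\<mu> (Max ?S) \<le> \<mu> i" using part_antimono[OF assms] by simp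
    with \<open>Max ?S \<in> ?S\<close> show "i \<in> ?S" by auto
  qed
  then have "plen \<mu> = Max ?S" unfolding plen_def by (metis card_atLeastAtMost diff_Suc_1)
  with \<open>?S = {1..Max ?S}\<close> show ?thesis by simp
qed

lemma part_eq_0: "\<mu> \<in> partitions \<Longrightarrow> plen \<mu> < i \<Longrightarrow> \<mu> i = 0"
  using part_support[of \<mu>] by (metis (mono_tags) atLeastAtMost_iff leD mem_Collect_eq)

lemma part_0: "\<mu> \<in> partitions \<Longrightarrow> \<mu> 0 = 0"
  by (simp add: partitions_def)

lemma empty_part_in [simp]: "empty_part \<in> partitions"
  by (simp add: partitions_def empty_part_def)

lemma plen_empty [simp]: "plen empty_part = 0"
  by (simp add: plen_def empty_part_def)

lemma empty_part_apply [simp]: "empty_part i = 0"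
  by (simp add: empty_part_def)

lemma mat_times_mat:
  "mat n m (\<lambda>(i, j). f i j) * mat m r (\<lambda>(i, j). g i j) =
    mat n r (\<lambda>(i, j). \<Sum>l = 0..<m. f i l * g l j)"
  by (rule eq_matI) (auto simp: scalar_prod_def intro!: sum.cong)

lemma det_unit_upper_triangular:
  fixes f :: "nat \<Rightarrow> nat \<Rightarrow> 'a::idom"
  assumes "\<And>i j. j < i \<Longrightarrow> i < n \<Longrightarrow> f i j = 0" "\<And>i. i < n \<Longrightarrow> f i i = 1"
  shows "det (mat n n (\<lambda>(i, j). f i j)) = 1"
proof -
  have "det (mat n n (\<lambda>(i, j). f i j)) = prod_list (diag_mat (mat n n (\<lambda>(i, j). f i j)))"
    by (rule det_upper_triangular) (auto intro!: upper_triangularI simp: assms)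
  also have "\<dots> = (\<Prod>i = 0..<n. mat n n (\<lambda>(i, j). f i j) $$ (i, i))"
    by (simp add: prod_list_diag_prod)
  also have "\<dots> = 1"
    by (rule prod.neutral) (simp add: assms)
  finally show ?thesis .
qed

text \<open>
  The exponents \<open>\<nu> + \<delta>\<close> of an alternant in \<open>N\<close> variables.  They are strictly decreasing, and they
  determine \<open>\<nu>\<close> if its length is at most \<open>N\<close>.
\<close>

definition shifted_parts :: "nat \<Rightarrow> (nat \<Rightarrow> nat) \<Rightarrow> nat \<Rightarrow> nat" where
  "shifted_parts N \<nu> j = \<nu> (Suc j) + (N - 1 - j)"

text \<open>
  Below row \<open>l(\<nu>)\<close> the enlarged matrix is unitriangular, because \<open>h\<^sub>0 = 1\<close> and \<open>h\<^sub>k = 0\<close> for \<open>k < 0\<close>.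
\<close>

lemma schur_extend:
  assumes "\<nu> \<in> partitions" "plen \<nu> \<le> N"
  shows "schur \<nu> p = det (mat N N (\<lambda>(i, j). complete_sym p (int (\<nu> (Suc i)) - int i + int j)))"
proof -
  define n m where "n = plen \<nu>" and "m = N - n"
  define f where "f i j = complete_sym p (int (\<nu> (Suc i)) - int i + int j)" for i j
  have N: "N = n + m" using assms by (simp add: n_def m_def)
  have z: "f i j = 0" if "n \<le> i" "j < i" for i j
    using that part_eq_0[OF assms(1), of "Suc i"] by (auto simp: f_def complete_sym_def n_def)
  have d: "f i i = 1" if "n \<le> i" for i
    using that part_eq_0[OF assms(1), of "Suc i"] by (auto simp: f_def complete_sym_def n_def)
  have "mat N N (\<lambda>(i, j). f i j) = four_block_mat (mat n n (\<lambda>(i, j). f i j))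
     (mat n m (\<lambda>(i, j). f i (j + n))) (0\<^sub>m m n) (mat m m (\<lambda>(i, j). f (i + n) (j + n)))"
    by (rule eq_matI) (auto simp: N z)
  also have "det \<dots> = det (mat n n (\<lambda>(i, j). f i j)) * det (mat m m (\<lambda>(i, j). f (i + n) (j + n)))"
    by (rule det_four_block_mat_lower_left_zero) auto
  also have "det (mat m m (\<lambda>(i, j). f (i + n) (j + n))) = 1"
    by (rule det_unit_upper_triangular) (auto simp: z d)
  finally show ?thesis by (simp add: schur_def f_def n_def)
qed

lemma fps_prod_linear_nth_0:
  fixes x :: "nat \<Rightarrow> 'a::comm_ring_1"
  assumes "finite A" "card A < m"
  shows "fps_nth (\<Prod>l\<in>A. 1 - fps_const (x l) * fps_X) m = 0"
  using assms
proof (induction A arbitrary: m rule: finite_induct)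
  case (insert a A)
  then obtain k where "m = Suc k" by (cases m) auto
  with insert show ?case by (simp add: algebra_simps)
qed auto

text \<open>
  Multiplying the generating series of the \<open>h\<close>'s by all factors \<open>1 - x\<^sub>l X\<close> with \<open>l \<noteq> k\<close> leaves
  \<open>1 / (1 - x\<^sub>k X)\<close>; the claim compares the coefficients of \<open>X\<^sup>\<alpha>\<close>.  The factor \<open>c k\<close> does not depend on \<open>\<alpha>\<close>,
  which is what makes alternants factor.
\<close>

lemma alternant_factor:
  fixes x :: "nat \<Rightarrow> 'a::field_char_0" and N :: nat
  defines "p \<equiv> \<lambda>n. \<Sum>i<N. x i ^ n"
  defines "c \<equiv> \<lambda>k. fps_nth (\<Prod>l\<in>{..<N} - {k}. 1 - fps_const (x l) * fps_X)"
  assumes k: "k < N"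
  shows "(\<Sum>j = 0..<N. complete_sym p (int \<alpha> - int (N - 1 - j)) * c k (N - 1 - j)) = x k ^ \<alpha>"
proof -
  let ?F = "\<Prod>l\<in>{..<N} - {k}. 1 - fps_const (x l) * fps_X"
  let ?G = "\<lambda>l. complete_fps (\<lambda>n. x l ^ n)"
  have g: "(1 - fps_const (x l) * fps_X) * ?G l = 1" for l by (rule complete_fps_geometric)
  have one: "?F * (\<Prod>l\<in>{..<N} - {k}. ?G l) = 1"
    by (simp add: g flip: prod.distrib)
  have "complete_fps p = (\<Prod>l<N. ?G l)"
    unfolding p_def by (rule complete_fps_sum[OF finite_lessThan])
  also have "\<dots> = ?G k * (\<Prod>l\<in>{..<N} - {k}. ?G l)"
    using k by (simp add: prod.remove)
  finally have "?F * complete_fps p = ?G k * (?F * (\<Prod>l\<in>{..<N} - {k}. ?G l))" by (simp add: mult_ac)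
  then have FG: "?F * complete_fps p = ?G k" by (simp add: one)
  have "x k ^ \<alpha> = fps_nth (?G k) \<alpha>"
    using complete_fps_scale[of "x k" "\<lambda>n. 1"] by (simp add: complete_fps_one_variable)
  also have "\<dots> = (\<Sum>m = 0..\<alpha>. c k m * fps_nth (complete_fps p) (\<alpha> - m))"
    unfolding FG[symmetric] by (simp add: fps_mult_nth c_def)
  also have "\<dots> = (\<Sum>m = 0..\<alpha>. c k m * complete_sym p (int \<alpha> - int m))"
    by (intro sum.cong) (auto simp: complete_sym_def nat_diff_distrib)
  also have "\<dots> = (\<Sum>m \<in> {0..\<alpha>} \<union> {0..<N}. c k m * complete_sym p (int \<alpha> - int m))"
    by (rule sum.mono_neutral_left) (auto simp: complete_sym_def)
  also have "\<dots> = (\<Sum>m \<in> {0..<N}. c k m * complete_sym p (int \<alpha> - int m))"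
    using k by (intro sum.mono_neutral_right) (auto simp: c_def intro!: fps_prod_linear_nth_0)
  also have "\<dots> = (\<Sum>j = 0..<N. complete_sym p (int \<alpha> - int (N - 1 - j)) * c k (N - 1 - j))"
    by (rule sum.reindex_bij_witness[of _ "\<lambda>j. N - 1 - j" "\<lambda>j. N - 1 - j"]) auto
  finally show ?thesis ..
qed

text \<open>
  By \<open>alternant_factor\<close> the matrix of the alternant is the Jacobi--Trudi matrix of \<open>\<nu>\<close> times a matrix
  \<open>M\<close> that does not involve \<open>\<nu>\<close>.  For the empty partition this identifies \<open>det M\<close> as the Vandermonde
  determinant.
\<close>

lemma bialternant:
  fixes x :: "nat \<Rightarrow> 'a::field_char_0"
  assumes "\<nu> \<in> partitions" "plen \<nu> \<le> N"
  shows "det (mat N N (\<lambda>(i, j). x i ^ shifted_parts N \<nu> j)) =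
    det (mat N N (\<lambda>(i, j). x i ^ (N - 1 - j))) * schur \<nu> (\<lambda>n. \<Sum>i<N. x i ^ n)"
proof -
  define p where "p = (\<lambda>n. \<Sum>i<N. x i ^ n)"
  define c where "c = (\<lambda>k. fps_nth (\<Prod>l\<in>{..<N} - {k}. 1 - fps_const (x l) * fps_X))"
  define M where "M = mat N N (\<lambda>(j, k). c k (N - 1 - j))"
  have *: "det (mat N N (\<lambda>(i, j). x i ^ shifted_parts N \<nu> j)) = schur \<nu> p * det M" 
    if nu: "\<nu> \<in> partitions" "plen \<nu> \<le> N" for \<nu>
  proof -
    let ?H = "mat N N (\<lambda>(i, j). complete_sym p (int (\<nu> (Suc i)) - int i + int j))"
    have "?H * M = mat N N (\<lambda>(j, i). x i ^ shifted_parts N \<nu> j)"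
      unfolding M_def mat_times_mat
    proof (rule cong_mat; clarify?)
      fix i k assume i: "i < N" and k: "k < N"
      have "(\<Sum>j = 0..<N. complete_sym p (int (\<nu> (Suc i)) - int i + int j) * c k (N - 1 - j)) =
        (\<Sum>j = 0..<N. complete_sym p (int (shifted_parts N \<nu> i) - int (N - 1 - j)) * c k (N - 1 - j))"
        using i by (intro sum.cong) (auto simp: shifted_parts_def of_nat_diff intro!: arg_cong2[where f = "(*)"] arg_cong[where f = "complete_sym p"])
      also have "\<dots> = x k ^ shifted_parts N \<nu> i"
        unfolding p_def c_def by (rule alternant_factor[OF k])
      finally show "(\<Sum>j = 0..<N. complete_sym p (int (\<nu> (Suc i)) - int i + int j) * c k (N - 1 - j)) = x k ^ shifted_parts N \<nu> i" .
    qed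
    then have "det (mat N N (\<lambda>(j, i). x i ^ shifted_parts N \<nu> j)) = det (?H * M)" by simp
    also have "\<dots> = det ?H * det M" by (rule det_mult) (auto simp: M_def)
    also have "det ?H = schur \<nu> p" by (rule schur_extend[OF nu, symmetric])
    also have "mat N N (\<lambda>(j, i). x i ^ shifted_parts N \<nu> j) = transpose_mat (mat N N (\<lambda>(i, j). x i ^ shifted_parts N \<nu> j))"
      by (rule eq_matI) auto
    also have "det \<dots> = det (mat N N (\<lambda>(i, j). x i ^ shifted_parts N \<nu> j))"
      by (rule det_transpose[of _ N]) auto
    finally show ?thesis .
  qed
  have "schur empty_part p = 1"
    by (simp add: schur_def)
  with *[of empty_part] have "det M = det (mat N N (\<lambda>(i, j). x i ^ (N - 1 - j)))"
    by (simp add: shifted_parts_def)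
  with *[OF assms] show ?thesis by (simp add: p_def mult.commute)
qed

text \<open>
  A unitriangular change of basis replaces the monomials by polynomials \<open>P j\<close> that vanish at the
  nodes \<open>x\<^sub>k\<close> with \<open>k > j + 1\<close>, so that the matrix of values becomes triangular.
\<close>

lemma vandermonde_det:
  fixes x :: "nat \<Rightarrow> 'a::field_char_0"
  shows "det (mat N N (\<lambda>(i, j). x (Suc i) ^ (N - 1 - j))) = (\<Prod>(i, j) | 1 \<le> i \<and> i < j \<and> j \<le> N. x i - x j)"
proof -
  define P where "P = (\<lambda>j. \<Prod>k\<in>{j<..<N}. [:- x (Suc k), 1:])"
  have deg: "degree (P j) = N - 1 - j" for j
    unfolding P_def by (subst degree_prod_eq_sum_degree) auto
  have lead: "coeff (P j) (N - 1 - j) = 1" for j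
  proof -
    have "lead_coeff (P j) = 1" unfolding P_def by (simp add: lead_coeff_prod)
    then show ?thesis by (simp add: deg)
  qed
  let ?V = "mat N N (\<lambda>(i, j). x (Suc i) ^ (N - 1 - j))"
  let ?U = "mat N N (\<lambda>(i, j). coeff (P j) (N - 1 - i))"
  let ?L = "mat N N (\<lambda>(i, j). poly (P j) (x (Suc i)))"
  have "?V * ?U = ?L"
    unfolding mat_times_mat
  proof (rule cong_mat; clarify?)
    fix i j assume i: "i < N" and j: "j < N"
    have "poly (P j) (x (Suc i)) = (\<Sum>k\<le>N - 1 - j. coeff (P j) k * x (Suc i) ^ k)"
      by (simp add: poly_altdef deg)
    also have "\<dots> = (\<Sum>k=0..<N. coeff (P j) k * x (Suc i) ^ k)"
      using j by (intro sum.mono_neutral_left) (auto intro!: coeff_eq_0 simp: deg)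
    also have "\<dots> = (\<Sum>k=0..<N. x (Suc i) ^ (N - 1 - k) * coeff (P j) (N - 1 - k))"
      by (rule sum.reindex_bij_witness[of _ "\<lambda>k. N - 1 - k" "\<lambda>k. N - 1 - k"]) auto
    finally show "(\<Sum>k=0..<N. x (Suc i) ^ (N - 1 - k) * coeff (P j) (N - 1 - k)) = poly (P j) (x (Suc i))"
      by simp
  qed
  then have "det ?V * det ?U = det ?L"
    by (metis det_mult mat_carrier)
  moreover have "det ?U = prod_list (diag_mat ?U)"
    by (rule det_lower_triangular[of N]) (auto intro!: coeff_eq_0 simp del: diff_diff_left simp: deg)
  moreover have "\<dots> = 1"
    unfolding prod_list_diag_prod using lead by (intro prod.neutral) auto
  moreover have "det ?L = prod_list (diag_mat ?L)"
    by (rule det_upper_triangular[of _ N]) (auto intro!: upper_triangularI bexI simp: P_def poly_prod)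
  moreover have "\<dots> = (\<Prod>j\<in>{0..<N}. \<Prod>k\<in>{j<..<N}. x (Suc j) - x (Suc k))"
    by (simp add: prod_list_diag_prod P_def poly_prod)
  moreover have "\<dots> = (\<Prod>(j, k)\<in>(SIGMA j:{0..<N}. {j<..<N}). x (Suc j) - x (Suc k))"
    by (subst prod.Sigma) auto
  moreover have "\<dots> = (\<Prod>(i, j) | 1 \<le> i \<and> i < j \<and> j \<le> N. x i - x j)"
    by (rule prod.reindex_bij_witness[of _ "\<lambda>(i, j). (i - 1, j - 1)" "\<lambda>(i, j). (Suc i, Suc j)"]) auto
  ultimately show ?thesis by simp
qed

section \<open>The Cauchy identity\<close>

lemma det_rows_scale:
  fixes f :: "nat \<Rightarrow> nat \<Rightarrow> 'a::comm_ring_1"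
  shows "det (mat N N (\<lambda>(i, j). c i * f i j)) = (\<Prod>i = 0..<N. c i) * det (mat N N (\<lambda>(i, j). f i j))"
proof -
  have "signof p * (\<Prod>i = 0..<N. mat N N (\<lambda>(i, j). c i * f i j) $$ (i, p i)) =
     (\<Prod>i = 0..<N. c i) * (signof p * (\<Prod>i = 0..<N. mat N N (\<lambda>(i, j). f i j) $$ (i, p i)))"
    if "p permutes {0..<N}" for p
  proof -
    have "p i < N" if "i < N" for i
      using permutes_in_image[OF \<open>p permutes _\<close>, of i] that by auto
    then show ?thesis by (simp add: prod.distrib mult_ac)
  qed
  then show ?thesis
    by (simp add: det_def'[of _ N] sum_distrib_left)
qed

lemma det_transpose_entries:
  "det (mat N N (\<lambda>(i, j). f j i)) = det (mat N N (\<lambda>(i, j). f i j))"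
proof -
  have "mat N N (\<lambda>(i, j). f j i) = transpose_mat (mat N N (\<lambda>(i, j). f i j))"
    by (rule eq_matI) auto
  then show ?thesis by (simp add: det_transpose[of _ N])
qed

lemma det_cols_scale:
  fixes f :: "nat \<Rightarrow> nat \<Rightarrow> 'a::comm_ring_1"
  shows "det (mat N N (\<lambda>(i, j). c j * f i j)) = (\<Prod>i = 0..<N. c i) * det (mat N N (\<lambda>(i, j). f i j))"
  using det_rows_scale[of N c "\<lambda>i j. f j i"] det_transpose_entries[of N "\<lambda>i j. c j * f i j"] 
   det_transpose_entries[of N f] by simp

lemma det_fps_const:
  "det (mat N N (\<lambda>(i, j). fps_const (f i j))) = fps_const (det (mat N N (\<lambda>(i, j). f i j)))"
proof -
  interpret comm_ring_hom "fps_const :: 'a \<Rightarrow> 'a fps"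
    by unfold_locales auto
  have "mat N N (\<lambda>(i, j). fps_const (f i j)) = map_mat fps_const (mat N N (\<lambda>(i, j). f i j))"
    by (rule eq_matI) auto
  then show ?thesis by (metis hom_det)
qed

text \<open>
  Expanding every row sum gives a sum over functions \<open>f\<close> from rows to \<open>K\<close>.  A function that is not
  injective gives a determinant with two equal rows; the injective ones with image \<open>T\<close> are \<open>e T\<close> composed
  with the permutations, and summing over these restores the determinant of \<open>A\<close>.  The enumerations \<open>e T\<close>
  are arbitrary because the application lists each subset in the order of the shifted parts.
\<close>

lemma cauchy_binet:
  fixes A B :: "nat \<Rightarrow> nat \<Rightarrow> 'a::comm_ring_1"
  assumes "finite K"
  assumes e: "\<And>T. T \<subseteq> K \<Longrightarrow> card T = N \<Longrightarrow> bij_betw (e T) {0..<N} T"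
  shows "det (mat N N (\<lambda>(i, j). \<Sum>k\<in>K. A i k * B k j)) =
    (\<Sum>T | T \<subseteq> K \<and> card T = N. det (mat N N (\<lambda>(i, j). A i (e T j))) * det (mat N N (\<lambda>(i, j). B (e T i) j)))"
proof -
  let ?P = "{p. p permutes {0..<N}}"
  let ?F = "PiE {0..<N} (\<lambda>_. K)"
  let ?d = "\<lambda>f. det (mat N N (\<lambda>(i, j). B (f i) j))"
  let ?g = "\<lambda>f. (\<Prod>i = 0..<N. A i (f i)) * ?d f"
  have fP: "finite ?P" by (simp add: finite_permutations)
  have fF: "finite ?F" using assms(1) by (intro finite_PiE) auto
  have pin: "p i < N" if "p permutes {0..<N}" "i < N" for p i
    using permutes_in_image[OF that(1), of i] that by auto
  have "det (mat N N (\<lambda>(i, j). \<Sum>k\<in>K. A i k * B k j)) =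
      (\<Sum>p\<in>?P. signof p * (\<Prod>i = 0..<N. \<Sum>k\<in>K. A i k * B k (p i)))"
    by (subst det_def'[of _ N]) (auto simp: pin intro!: sum.cong prod.cong)
  also have "\<dots> = (\<Sum>p\<in>?P. \<Sum>f\<in>?F. signof p * (\<Prod>i = 0..<N. A i (f i) * B (f i) (p i)))"
    using assms(1) by (simp add: prod_sum_PiE sum_distrib_left)
  also have "\<dots> = (\<Sum>f\<in>?F. \<Sum>p\<in>?P. signof p * (\<Prod>i = 0..<N. A i (f i) * B (f i) (p i)))"
    by (rule sum.swap)
  also have "\<dots> = (\<Sum>f\<in>?F. ?g f)"
  proof (rule sum.cong)
    fix f
    have "?d f = (\<Sum>p\<in>?P. signof p * (\<Prod>i = 0..<N. B (f i) (p i)))"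
      by (subst det_def'[of _ N]) (auto simp: pin intro!: sum.cong prod.cong)
    then show "(\<Sum>p\<in>?P. signof p * (\<Prod>i = 0..<N. A i (f i) * B (f i) (p i))) = ?g f"
      by (simp add: prod.distrib sum_distrib_left mult_ac)
  qed simp
  also have "\<dots> = (\<Sum>f | f \<in> ?F \<and> inj_on f {0..<N}. ?g f)"
  proof (rule sum.mono_neutral_right[OF fF]; (intro ballI)?)
    fix f assume "f \<in> ?F - {f. f \<in> ?F \<and> inj_on f {0..<N}}"
    then obtain a b where ab: "a < N" "b < N" "a \<noteq> b" "f a = f b"
      unfolding inj_on_def by auto
    have "?d f = 0"
      using ab by (intro det_identical_rows[of _ N a b]) (auto intro!: eq_vecI)
    then show "?g f = 0" by simp
  qed blast
  also have "\<dots> = (\<Sum>T | T \<subseteq> K \<and> card T = N. \<Sum>f | f \<in> {f. f \<in> ?F \<and> inj_on f {0..<N}} \<and> f ` {0..<N} = T. ?g f)"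
    using assms(1) fF by (intro sum.group[symmetric]) (auto simp: card_image)
  also have "\<dots> = (\<Sum>T | T \<subseteq> K \<and> card T = N. det (mat N N (\<lambda>(i, j). A i (e T j))) * ?d (e T))"
  proof (rule sum.cong)
    fix T assume "T \<in> {T. T \<subseteq> K \<and> card T = N}"
    then have T: "T \<subseteq> K" "card T = N" by auto
    then have eT: "bij_betw (e T) {0..<N} T" by (rule e)
    have injT: "inj_on (e T) {0..<N}" and imT: "e T ` {0..<N} = T"
      using eT by (auto simp: bij_betw_def)
    let ?I = "inv_into {0..<N} (e T)"
    have I: "?I (e T i) = i" if "i < N" for i
      using inv_into_f_f[OF injT] that by simp
    have I': "e T (?I k) = k" "?I k < N" if "k \<in> T" for k
      using f_inv_into_f[of k "e T" "{0..<N}"] inv_into_into[of k "e T" "{0..<N}"] imT that by auto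
    have "(\<Sum>f | f \<in> {f. f \<in> ?F \<and> inj_on f {0..<N}} \<and> f ` {0..<N} = T. ?g f) =
        (\<Sum>p\<in>?P. ?g (\<lambda>i. if i < N then e T (p i) else undefined))"
    proof (rule sum.reindex_bij_witness[of _ "\<lambda>p i. if i < N then e T (p i) else undefined"
          "\<lambda>f i. if i < N then ?I (f i) else i"])
      fix f assume f: "f \<in> {f. f \<in> {f. f \<in> ?F \<and> inj_on f {0..<N}} \<and> f ` {0..<N} = T}"
      then have fT: "f i \<in> T" if "i < N" for i using that by auto
      have fu: "f i = undefined" if "\<not> i < N" for i
        using f that by (auto simp: PiE_def extensional_def)
      show "(\<lambda>i. if i < N then e T (if i < N then ?I (f i) else i) else undefined) = f"
        by (rule ext) (simp add: I' fT fu)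
      show "(\<lambda>i. if i < N then ?I (f i) else i) \<in> ?P"
      proof -
        have "inj_on ?I T" using imT by (metis inj_on_inv_into order_refl)
        moreover have "?I ` T = {0..<N}" 
          using I I'(2) imT by (metis bij_betw_def bij_betw_inv_into eT)
        moreover have "bij_betw f {0..<N} T" using f by (auto simp: bij_betw_def)
        ultimately have "bij_betw (?I \<circ> f) {0..<N} {0..<N}"
          by (metis bij_betw_def bij_betw_trans)
        then have "bij_betw (\<lambda>i. if i < N then ?I (f i) else i) {0..<N} {0..<N}"
          by (rule bij_betw_cong[THEN iffD1, rotated]) auto
        then show ?thesis by (auto intro!: bij_imp_permutes)
      qed
      show "?g (\<lambda>i. if i < N then e T (if i < N then ?I (f i) else i) else undefined) = ?g f"
        by (auto simp: I'(1)[OF fT] intro!: arg_cong2[where f = "(*)"] prod.cong arg_cong[where f = det])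
    next
      fix p assume p: "p \<in> ?P"
      then have pN: "p i < N" if "i < N" for i using pin that by auto
      show "(\<lambda>i. if i < N then ?I (if i < N then e T (p i) else undefined) else i) = p"
        using p by (auto simp: I pN permutes_def)
      have "bij_betw (e T \<circ> p) {0..<N} T"
        using p eT by (auto intro: bij_betw_trans permutes_imp_bij)
      then have "bij_betw (\<lambda>i. if i < N then e T (p i) else undefined) {0..<N} T"
        by (rule bij_betw_cong[THEN iffD1, rotated]) auto
      then show "(\<lambda>i. if i < N then e T (p i) else undefined) \<in> {f. f \<in> {f. f \<in> ?F \<and> inj_on f {0..<N}} \<and> f ` {0..<N} = T}"
        using T by (auto simp: bij_betw_def PiE_def extensional_def)
    qed
    also have "\<dots> = (\<Sum>p\<in>?P. (signof p * (\<Prod>i = 0..<N. A i (e T (p i)))) * ?d (e T))"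
    proof (rule sum.cong)
      fix p assume p: "p \<in> ?P"
      have "?d (\<lambda>i. if i < N then e T (p i) else undefined) = 
          det (mat N N (\<lambda>(i, j). mat N N (\<lambda>(i, j). B (e T i) j) $$ (p i, j)))"
        using p by (intro arg_cong[where f = det] cong_mat) (auto simp: pin)
      also have "\<dots> = signof p * ?d (e T)"
        using p by (intro det_permute_rows) auto
      finally show "?g (\<lambda>i. if i < N then e T (p i) else undefined) = (signof p * (\<Prod>i = 0..<N. A i (e T (p i)))) * ?d (e T)"
        by (simp add: mult_ac)
    qed simp
    also have "\<dots> = det (mat N N (\<lambda>(i, j). A i (e T j))) * ?d (e T)"
      unfolding sum_distrib_right[symmetric]
      by (subst (2) det_def'[of _ N]) (auto simp: pin intro!: sum.cong prod.cong)
    finally show "(\<Sum>f | f \<in> {f. f \<in> ?F \<and> inj_on f {0..<N}} \<and> f ` {0..<N} = T. ?g f) = det (mat N N (\<lambda>(i, j). A i (e T j))) * ?d (e T)" .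
  qed simp
  finally show ?thesis .
qed

lemma part_size_eq_sum:
  assumes "\<nu> \<in> partitions" "plen \<nu> \<le> N"
  shows "part_size \<nu> = (\<Sum>j = 0..<N. \<nu> (Suc j))"
proof -
  have "part_size \<nu> = (\<Sum>i = 1..N. \<nu> i)"
    unfolding part_size_def using assms part_eq_0[OF assms(1)] by (intro sum.mono_neutral_left) auto
  then show ?thesis
    by (simp add: sum.atLeast1_atMost_eq lessThan_atLeast0)
qed

lemma plen_le_part_size: "\<nu> \<in> partitions \<Longrightarrow> plen \<nu> \<le> part_size \<nu>"
proof -
  assume nu: "\<nu> \<in> partitions"
  have "plen \<nu> = (\<Sum>i = 1..plen \<nu>. 1)" by simp
  also have "\<dots> \<le> part_size \<nu>"
    unfolding part_size_def
  proof (rule sum_mono)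
    fix i assume "i \<in> {1..plen \<nu>}"
    then have "\<nu> i \<noteq> 0" using part_support[OF nu] by auto
    then show "1 \<le> \<nu> i" by simp
  qed
  finally show ?thesis .
qed

lemma part_le_part_size:
  assumes "\<nu> \<in> partitions" shows "\<nu> i \<le> part_size \<nu>"
proof (cases "i \<in> {1..plen \<nu>}")
  case True
  then show ?thesis unfolding part_size_def by (intro member_le_sum) auto
next
  case False
  then have "\<nu> i = 0" using part_support[OF assms] by auto
  then show ?thesis by simp
qed

lemma shifted_parts_strict_antimono:
  assumes "\<nu> \<in> partitions" "i < j" "j < N"
  shows "shifted_parts N \<nu> j < shifted_parts N \<nu> i"
  using part_antimono[OF assms(1), of "Suc i" "Suc j"] assms(2,3) by (simp add: shifted_parts_def)

lemma shifted_parts_inj_on: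
  assumes "\<nu> \<in> partitions"
  shows "inj_on (shifted_parts N \<nu>) {0..<N}"
  by (rule linorder_inj_onI') (metis assms atLeastLessThan_iff less_irrefl shifted_parts_strict_antimono)

text \<open>
  Shifted parts are recovered from their mere set by sorting.
\<close>

lemma sorted_list_of_shifted_parts:
  assumes "\<nu> \<in> partitions"
  shows "sorted_list_of_set (shifted_parts N \<nu> ` {0..<N}) = rev (map (shifted_parts N \<nu>) [0..<N])"
proof (rule sorted_list_of_set_unique[THEN iffD1])
  have "sorted_wrt (>) (map (shifted_parts N \<nu>) [0..<N])"
    using shifted_parts_strict_antimono[OF assms] by (auto simp: sorted_wrt_iff_nth_less)
  then show "sorted_wrt (<) (rev (map (shifted_parts N \<nu>) [0..<N])) \<and>
      set (rev (map (shifted_parts N \<nu>) [0..<N])) = shifted_parts N \<nu> ` {0..<N} \<and>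
      length (rev (map (shifted_parts N \<nu>) [0..<N])) = card (shifted_parts N \<nu> ` {0..<N})"
    using shifted_parts_inj_on[OF assms, of N] by (simp add: sorted_wrt_rev card_image)
qed simp

lemma strict_sorted_nth_ge:
  assumes "sorted_wrt (<) (xs :: nat list)" "i < length xs"
  shows "i \<le> xs ! i"
  using assms(2)
proof (induction i)
  case (Suc i)
  then have "xs ! i < xs ! Suc i" using assms(1) by (auto simp: sorted_wrt_iff_nth_less)
  with Suc show ?case by simp
qed simp

text \<open>
  This turns the sum over subsets in the Cauchy--Binet formula into a sum over partitions.
\<close>

lemma bij_betw_shifted_parts:
  "bij_betw (\<lambda>\<nu>. shifted_parts N \<nu> ` {0..<N}) {\<nu> \<in> partitions. plen \<nu> \<le> N} {T. finite T \<and> card T = N}"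
proof (rule bij_betw_imageI)
  show "inj_on (\<lambda>\<nu>. shifted_parts N \<nu> ` {0..<N}) {\<nu> \<in> partitions. plen \<nu> \<le> N}"
  proof (rule inj_onI, clarify)
    fix \<nu> \<nu>' assume nu: "\<nu> \<in> partitions" "plen \<nu> \<le> N" and nu': "\<nu>' \<in> partitions" "plen \<nu>' \<le> N"
      and eq: "shifted_parts N \<nu> ` {0..<N} = shifted_parts N \<nu>' ` {0..<N}"
    have "map (shifted_parts N \<nu>) [0..<N] = map (shifted_parts N \<nu>') [0..<N]"
      using sorted_list_of_shifted_parts[OF nu(1), of N] sorted_list_of_shifted_parts[OF nu'(1), of N] eq
      by (metis rev_swap)
    then have "shifted_parts N \<nu> j = shifted_parts N \<nu>' j" if "j < N" for j
      using that by simp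
    then have *: "\<nu> (Suc j) = \<nu>' (Suc j)" if "j < N" for j
      unfolding shifted_parts_def using that by (metis add_right_cancel)
    show "\<nu> = \<nu>'"
    proof
      fix i show "\<nu> i = \<nu>' i"
        using *[of "i - 1"] part_eq_0[OF nu(1), of i] part_eq_0[OF nu'(1), of i] nu nu' part_0[OF nu(1)] part_0[OF nu'(1)]
        by (cases i; cases "i \<le> N") auto
    qed
  qed
next
  show "(\<lambda>\<nu>. shifted_parts N \<nu> ` {0..<N}) ` {\<nu> \<in> partitions. plen \<nu> \<le> N} = {T. finite T \<and> card T = N}"
  proof (intro equalityI subsetI)
    fix T assume "T \<in> (\<lambda>\<nu>. shifted_parts N \<nu> ` {0..<N}) ` {\<nu> \<in> partitions. plen \<nu> \<le> N}"
    then show "T \<in> {T. finite T \<and> card T = N}"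
      using shifted_parts_inj_on by (auto simp: card_image)
  next
    fix T :: "nat set" assume "T \<in> {T. finite T \<and> card T = N}"
    then have T: "finite T" "card T = N" by auto
    define xs where "xs = sorted_list_of_set T"
    have len: "length xs = N" and srt: "sorted_wrt (<) xs" and st: "set xs = T"
      using T by (auto simp: xs_def)
    define \<nu> where "\<nu> = (\<lambda>i. if i \<in> {1..N} then xs ! (N - i) - (N - i) else 0)"
    have ge: "i \<le> xs ! i" if "i < N" for i
      using strict_sorted_nth_ge[OF srt] that len by simp
    have "\<nu> (Suc i) \<le> \<nu> i" if "i \<ge> 1" for i
    proof (cases "Suc i \<le> N")
      case True
      have "xs ! (N - Suc i) < xs ! (N - i)"
        using srt True that len by (auto simp: sorted_wrt_iff_nth_less)
      then show ?thesis using True that by (simp add: \<nu>_def)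
    qed (simp add: \<nu>_def)
    moreover have sub: "{i. \<nu> i \<noteq> 0} \<subseteq> {1..N}" by (auto simp: \<nu>_def split: if_splits)
    ultimately have nu: "\<nu> \<in> partitions"
      by (auto simp: partitions_def \<nu>_def intro: finite_subset)
    have "plen \<nu> \<le> N" using card_mono[OF _ sub] by (simp add: plen_def)
    moreover have "shifted_parts N \<nu> ` {0..<N} = T"
    proof -
      have "shifted_parts N \<nu> j = xs ! (N - 1 - j)" if "j < N" for j
        using that ge[of "N - 1 - j"] by (simp add: shifted_parts_def \<nu>_def)
      then have "shifted_parts N \<nu> ` {0..<N} = (\<lambda>j. xs ! (N - 1 - j)) ` {0..<N}" by auto
      also have "\<dots> = (!) xs ` ((\<lambda>j. N - 1 - j) ` {0..<N})" by (simp add: image_image)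
      also have "(\<lambda>j. N - 1 - j) ` {0..<N} = {0..<N}"
        by (rule bij_betw_imp_surj_on[of _ _ "{0..<N}"], rule bij_betwI[of _ _ _ "\<lambda>j. N - 1 - j"]) auto
      also have "(!) xs ` {0..<N} = set xs" using len by (auto simp: set_conv_nth)
      finally show ?thesis by (simp add: st)
    qed
    ultimately show "T \<in> (\<lambda>\<nu>. shifted_parts N \<nu> ` {0..<N}) ` {\<nu> \<in> partitions. plen \<nu> \<le> N}"
      using nu by blast
  qed
qed

lemma finite_partitions_of_size: "finite {\<nu> \<in> partitions. part_size \<nu> = n}"
proof (rule finite_subset)
  show "finite {f. \<forall>i. (i \<in> {1..n} \<longrightarrow> f i \<in> {0..n}) \<and> (i \<notin> {1..n} \<longrightarrow> f i = (0::nat))}"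
    by (rule finite_set_of_finite_funs) auto
  show "{\<nu> \<in> partitions. part_size \<nu> = n} \<subseteq> {f. \<forall>i. (i \<in> {1..n} \<longrightarrow> f i \<in> {0..n}) \<and> (i \<notin> {1..n} \<longrightarrow> f i = 0)}"
  proof clarify
    fix \<nu> i assume nu: "\<nu> \<in> partitions" and n: "n = part_size \<nu>"
    show "(i \<in> {1..part_size \<nu>} \<longrightarrow> \<nu> i \<in> {0..part_size \<nu>}) \<and> (i \<notin> {1..part_size \<nu>} \<longrightarrow> \<nu> i = 0)"
      using part_le_part_size[OF nu, of i] plen_le_part_size[OF nu] part_eq_0[OF nu, of i] part_0[OF nu]
      by (cases "i = 0") auto
  qed
qed

lemma fps_nth_prod_cong:
  fixes F G :: "nat \<Rightarrow> 'a::comm_ring_1 fps"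
  assumes "finite A" "\<And>i k. i \<in> A \<Longrightarrow> k \<le> n \<Longrightarrow> fps_nth (F i) k = fps_nth (G i) k" "k \<le> n"
  shows "fps_nth (\<Prod>i\<in>A. F i) k = fps_nth (\<Prod>i\<in>A. G i) k"
  using assms
proof (induction A arbitrary: k rule: finite_induct)
  case (insert a A)
  have "(\<Sum>i=0..k. fps_nth (F a) i * fps_nth (\<Prod>i\<in>A. F i) (k - i)) =
      (\<Sum>i=0..k. fps_nth (G a) i * fps_nth (\<Prod>i\<in>A. G i) (k - i))"
    using insert by (intro sum.cong arg_cong2[where f = "(*)"]) auto
  then show ?case using insert.hyps by (simp add: fps_mult_nth)
qed simp

text \<open>
  The product of two alphabets is the union of copies of the first one, rescaled by the variables of the second.
\<close>

lemma complete_fps_product_alphabet: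
  fixes y :: "nat \<Rightarrow> 'a::field_char_0"
  shows "complete_fps (\<lambda>m. p m * (\<Sum>i<N. y i ^ m)) = (\<Prod>i<N. Abs_fps (\<lambda>k. y i ^ k * fps_nth (complete_fps p) k))"
proof -
  have "complete_fps (\<lambda>m. p m * (\<Sum>i<N. y i ^ m)) = complete_fps (\<lambda>m. \<Sum>i<N. y i ^ m * p m)"
    by (simp add: sum_distrib_left mult.commute)
  then show ?thesis by (simp add: complete_fps_sum complete_fps_scale)
qed

text \<open>
  The Cauchy identity in degree \<open>n\<close>, multiplied by the Vandermonde determinant of \<open>y\<close>.  Let \<open>H\<close> be the
  generating series of the complete functions of \<open>p\<close>, and evaluate the determinant of the matrix with entries
  \<open>(y\<^sub>i X)\<^bsup>N-1-j\<^esup> H(y\<^sub>i X)\<close> in two ways: the row factors \<open>H(y\<^sub>i X)\<close> can be taken out, and expanding the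
  entries in powers of \<open>y\<^sub>i X\<close> gives by Cauchy--Binet a sum of products of an alternant and a Jacobi--Trudi
  determinant.
\<close>

lemma cauchy_alternants:
  fixes y :: "nat \<Rightarrow> 'a::field_char_0"
  shows "(\<Sum>\<nu> | \<nu> \<in> partitions \<and> plen \<nu> \<le> N \<and> part_size \<nu> = n.
           det (mat N N (\<lambda>(i, j). y i ^ shifted_parts N \<nu> j)) * schur \<nu> p) =
    det (mat N N (\<lambda>(i, j). y i ^ (N - 1 - j))) * fps_nth (complete_fps (\<lambda>m. p m * (\<Sum>i<N. y i ^ m))) n"
proof -
  \<comment> \<open>A cut-off that makes the row sums finite.  It affects neither the coefficients up to \<open>X\<^sup>n\<close> nor the entries \<open>h\<close> of index \<open>\<nu>\<^sub>i - i + j \<le> n + N\<close>.\<close>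
  define L where "L = n + N"
  define h where "h = (\<lambda>k::int. if k \<le> int L then complete_sym p k else 0)"
  define H where "H = (\<lambda>i. \<Sum>k\<le>L. fps_const (h (int k) * y i ^ k) * fps_X ^ k)"
  \<comment> \<open>The degree of the Vandermonde determinant; the alternant of \<open>\<nu>\<close> has degree \<open>|\<nu>| + D\<close>.\<close>
  define D where "D = (\<Sum>j = 0..<N. N - 1 - j)"
  define \<phi> where "\<phi> = (\<lambda>\<nu>. shifted_parts N \<nu> ` {0..<N})"
  let ?Q = "{\<nu> \<in> partitions. plen \<nu> \<le> N}"
  define e where "e = (\<lambda>T. shifted_parts N (the_inv_into ?Q \<phi> T))"
  define K where "K = {..<L + N}"
  define A where "A = (\<lambda>i k. fps_const (y i ^ k) * fps_X ^ k)"
  define B where "B = (\<lambda>k j. fps_const (h (int k - int (N - 1 - j))))"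
  have bij: "bij_betw \<phi> ?Q {T. finite T \<and> card T = N}"
    using bij_betw_shifted_parts unfolding \<phi>_def .
  have e_\<phi>: "e (\<phi> \<nu>) = shifted_parts N \<nu>" if "\<nu> \<in> ?Q" for \<nu>
    using the_inv_into_f_f[OF bij_betw_imp_inj_on[OF bij] that] by (simp add: e_def)
  have bij_e: "bij_betw (e T) {0..<N} T" if T: "T \<subseteq> K" "card T = N" for T
  proof -
    have "finite T" using T by (auto simp: K_def intro: finite_subset)
    then have "T \<in> \<phi> ` ?Q" using bij T by (auto simp: bij_betw_def)
    then obtain \<nu> where "\<nu> \<in> ?Q" "T = \<phi> \<nu>" by blast
    then show ?thesis using shifted_parts_inj_on[of \<nu> N] e_\<phi>[of \<nu>] by (simp add: bij_betw_def \<phi>_def)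
  qed
  have entry: "(\<Sum>k\<in>K. A i k * B k j) = H i * (fps_const (y i ^ (N - 1 - j)) * fps_X ^ (N - 1 - j))" 
    if "j < N" for i j
  proof -
    let ?d = "N - 1 - j"
    have "(\<Sum>k\<in>K. A i k * B k j) = (\<Sum>k = ?d..L + ?d. A i k * B k j)"
      using that by (intro sum.mono_neutral_right) (auto simp: K_def B_def h_def complete_sym_def)
    also have "\<dots> = (\<Sum>k = 0..L. A i (k + ?d) * B (k + ?d) j)"
      using sum.shift_bounds_cl_nat_ivl[of "\<lambda>k. A i k * B k j" 0 ?d L] by simp
    also have "\<dots> = H i * (fps_const (y i ^ ?d) * fps_X ^ ?d)"
      unfolding H_def sum_distrib_right atMost_atLeast0
      by (rule sum.cong) (auto simp: A_def B_def power_add mult_ac simp flip: fps_const_mult)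
    finally show ?thesis .
  qed
  have detA: "det (mat N N (\<lambda>(i, j). A i (f j))) = 
      fps_X ^ (\<Sum>j = 0..<N. f j) * fps_const (det (mat N N (\<lambda>(i, j). y i ^ f j)))" for f
    unfolding det_fps_const[symmetric] power_sum
    by (subst det_cols_scale[symmetric]) (simp add: A_def mult.commute)
  have "(\<Prod>i = 0..<N. H i) * (fps_X ^ D * fps_const (det (mat N N (\<lambda>(i, j). y i ^ (N - 1 - j))))) =
      (\<Prod>i = 0..<N. H i) * det (mat N N (\<lambda>(i, j). A i (N - 1 - j)))"
    by (simp add: detA D_def)
  also have "\<dots> = det (mat N N (\<lambda>(i, j). H i * A i (N - 1 - j)))"
    by (rule det_rows_scale[symmetric])
  also have "\<dots> = det (mat N N (\<lambda>(i, j). \<Sum>k\<in>K. A i k * B k j))"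
    by (intro arg_cong[where f = det] cong_mat) (auto simp: entry, simp add: A_def)
  also have "\<dots> = (\<Sum>T | T \<subseteq> K \<and> card T = N. det (mat N N (\<lambda>(i, j). A i (e T j))) * det (mat N N (\<lambda>(i, j). B (e T i) j)))"
    by (rule cauchy_binet) (auto simp: K_def bij_e[unfolded K_def])
  finally have main: "(\<Prod>i = 0..<N. H i) * (fps_X ^ D * fps_const (det (mat N N (\<lambda>(i, j). y i ^ (N - 1 - j))))) = 
      (\<Sum>T | T \<subseteq> K \<and> card T = N. fps_X ^ (\<Sum>j = 0..<N. e T j) * fps_const (det (mat N N (\<lambda>(i, j). y i ^ e T j)) *
          det (mat N N (\<lambda>(i, j). h (int (e T i) - int (N - 1 - j))))))"
    by (simp add: detA B_def det_fps_const mult.assoc)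
  let ?S = "{\<nu>. \<nu> \<in> partitions \<and> plen \<nu> \<le> N \<and> part_size \<nu> = n}"
  have sum_e: "(\<Sum>j = 0..<N. shifted_parts N \<nu> j) = part_size \<nu> + D" if "\<nu> \<in> ?Q" for \<nu>
    using that part_size_eq_sum[of \<nu> N] by (simp only: shifted_parts_def D_def sum.distrib mem_Collect_eq)
  have "det (mat N N (\<lambda>(i, j). y i ^ (N - 1 - j))) * fps_nth (\<Prod>i = 0..<N. H i) n =
     fps_nth ((\<Prod>i = 0..<N. H i) * (fps_X ^ D * fps_const (det (mat N N (\<lambda>(i, j). y i ^ (N - 1 - j)))))) (n + D)"
    by (simp add: fps_X_power_mult_nth fps_X_power_mult_right_nth mult_ac flip: mult.assoc[of _ "fps_X ^ D"])
  also have "\<dots> = (\<Sum>T | T \<subseteq> K \<and> card T = N. if (\<Sum>j = 0..<N. e T j) = n + D then (det (mat N N (\<lambda>(i, j). y i ^ e T j)) *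
          det (mat N N (\<lambda>(i, j). h (int (e T i) - int (N - 1 - j))))) else 0)"
    unfolding main fps_sum_nth
    by (rule sum.cong) (auto simp: fps_X_power_mult_nth)
  also have "\<dots> = (\<Sum>T \<in> \<phi> ` ?S. det (mat N N (\<lambda>(i, j). y i ^ e T j)) *
          det (mat N N (\<lambda>(i, j). h (int (e T i) - int (N - 1 - j)))))"
  proof (rule sum.mono_neutral_cong_right)
    show "finite {T. T \<subseteq> K \<and> card T = N}" by (simp add: K_def)
    show "\<phi> ` ?S \<subseteq> {T. T \<subseteq> K \<and> card T = N}"
    proof clarify
      fix \<nu> assume nu: "\<nu> \<in> partitions" "plen \<nu> \<le> N" "n = part_size \<nu>"
      have "card (\<phi> \<nu>) = N" using bij nu by (auto simp: bij_betw_def)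
      moreover have "shifted_parts N \<nu> j < L + N" if "j < N" for j
        using part_le_part_size[OF nu(1), of "Suc j"] nu that by (simp add: shifted_parts_def L_def)
      ultimately show "\<phi> \<nu> \<subseteq> K \<and> card (\<phi> \<nu>) = N" by (auto simp: \<phi>_def K_def)
    qed
    show "\<forall>T\<in>{T. T \<subseteq> K \<and> card T = N} - \<phi> ` ?S. (if (\<Sum>j = 0..<N. e T j) = n + D then (det (mat N N (\<lambda>(i, j). y i ^ e T j)) *
          det (mat N N (\<lambda>(i, j). h (int (e T i) - int (N - 1 - j))))) else 0) = 0"
    proof
      fix T assume T: "T \<in> {T. T \<subseteq> K \<and> card T = N} - \<phi> ` ?S"
      then have "finite T" by (auto simp: K_def intro: finite_subset)
      then have "T \<in> \<phi> ` ?Q" using bij T by (auto simp: bij_betw_def)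
      then obtain \<nu> where nu: "\<nu> \<in> ?Q" "T = \<phi> \<nu>" by blast
      with T have "part_size \<nu> \<noteq> n" by auto
      then have "(\<Sum>j = 0..<N. e T j) \<noteq> n + D" 
        using sum_e[OF nu(1)] e_\<phi>[OF nu(1)] nu(2) by simp
      then show "(if (\<Sum>j = 0..<N. e T j) = n + D then (det (mat N N (\<lambda>(i, j). y i ^ e T j)) *
          det (mat N N (\<lambda>(i, j). h (int (e T i) - int (N - 1 - j))))) else 0) = 0" by simp
    qed
    show "(if (\<Sum>j = 0..<N. e T j) = n + D then (det (mat N N (\<lambda>(i, j). y i ^ e T j)) *
          det (mat N N (\<lambda>(i, j). h (int (e T i) - int (N - 1 - j))))) else 0) =
       det (mat N N (\<lambda>(i, j). y i ^ e T j)) *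
          det (mat N N (\<lambda>(i, j). h (int (e T i) - int (N - 1 - j))))" if "T \<in> \<phi> ` ?S" for T
    proof -
      from that obtain \<nu> where nu: "\<nu> \<in> ?Q" "part_size \<nu> = n" "T = \<phi> \<nu>" by blast
      then have "(\<Sum>j = 0..<N. e T j) = n + D" 
        using sum_e[OF nu(1)] e_\<phi>[OF nu(1)] by simp
      then show ?thesis by simp
    qed
  qed
  also have "\<dots> = (\<Sum>\<nu>\<in>?S. det (mat N N (\<lambda>(i, j). y i ^ e (\<phi> \<nu>) j)) *
          det (mat N N (\<lambda>(i, j). h (int (e (\<phi> \<nu>) i) - int (N - 1 - j)))))"
    by (subst sum.reindex) (auto intro!: inj_on_subset[OF bij_betw_imp_inj_on[OF bij]])
  also have "\<dots> = (\<Sum>\<nu>\<in>?S. det (mat N N (\<lambda>(i, j). y i ^ shifted_parts N \<nu> j)) * schur \<nu> p)"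
  proof (rule sum.cong)
    fix \<nu> assume nu: "\<nu> \<in> ?S"
    then have e: "e (\<phi> \<nu>) = shifted_parts N \<nu>" by (intro e_\<phi>) simp
    have "h (int (shifted_parts N \<nu> i) - int (N - 1 - j)) = complete_sym p (int (\<nu> (Suc i)) - int i + int j)"
      if "i < N" "j < N" for i j
    proof -
      have "int (shifted_parts N \<nu> i) - int (N - 1 - j) = int (\<nu> (Suc i)) - int i + int j"
        using that by (simp add: shifted_parts_def of_nat_diff)
      moreover have "int (\<nu> (Suc i)) - int i + int j \<le> int L"
        using part_le_part_size[of \<nu> "Suc i"] nu that by (simp add: L_def)
      ultimately show ?thesis by (simp only: h_def if_True)
    qed
    then have "det (mat N N (\<lambda>(i, j). h (int (shifted_parts N \<nu> i) - int (N - 1 - j)))) =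
       det (mat N N (\<lambda>(i, j). complete_sym p (int (\<nu> (Suc i)) - int i + int j)))"
      by (intro arg_cong[where f = det] cong_mat) auto
    also have "\<dots> = schur \<nu> p" using nu by (intro schur_extend[symmetric]) auto
    finally show "det (mat N N (\<lambda>(i, j). y i ^ e (\<phi> \<nu>) j)) * det (mat N N (\<lambda>(i, j). h (int (e (\<phi> \<nu>) i) - int (N - 1 - j)))) =
       det (mat N N (\<lambda>(i, j). y i ^ shifted_parts N \<nu> j)) * schur \<nu> p" by (simp add: e)
  qed simp
  also have "fps_nth (\<Prod>i = 0..<N. H i) n = fps_nth (\<Prod>i = 0..<N. Abs_fps (\<lambda>k. y i ^ k * fps_nth (complete_fps p) k)) n"
  proof (rule fps_nth_prod_cong[of _ n])
    fix i k assume "i \<in> {0..<N}" "k \<le> n"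
    then show "fps_nth (H i) k = fps_nth (Abs_fps (\<lambda>k. y i ^ k * fps_nth (complete_fps p) k)) k"
      by (simp add: H_def fps_sum_nth h_def complete_sym_def L_def if_distrib[of "\<lambda>x. _ * x"] cong: if_cong)
  qed auto
  finally show ?thesis
    unfolding complete_fps_product_alphabet by (simp only: lessThan_atLeast0)
qed

section \<open>From finitely many variables to $q^{\mu+\rho}$\<close>

text \<open>
  Polynomial dependence on a parameter is expressed for functions rather than for polynomials, since
  the constructions applied to the parameter (Schur functions of power sums) are defined over a field.
\<close>

definition poly_fun :: "('a::comm_ring_1 \<Rightarrow> 'a) \<Rightarrow> bool" where
  "poly_fun f \<longleftrightarrow> (\<exists>P. \<forall>t. f t = poly P t)"

lemma poly_fun_const [intro]: "poly_fun (\<lambda>t. c)"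
  unfolding poly_fun_def by (rule exI[of _ "[:c:]"]) simp

lemma poly_fun_id [intro]: "poly_fun (\<lambda>t. t)"
  unfolding poly_fun_def by (rule exI[of _ "[:0, 1:]"]) simp

lemma poly_fun_add [intro]: "poly_fun f \<Longrightarrow> poly_fun g \<Longrightarrow> poly_fun (\<lambda>t. f t + g t)"
  unfolding poly_fun_def by (metis poly_add)

lemma poly_fun_diff [intro]: "poly_fun f \<Longrightarrow> poly_fun g \<Longrightarrow> poly_fun (\<lambda>t. f t - g t)"
  unfolding poly_fun_def by (metis poly_diff)

lemma poly_fun_mult [intro]: "poly_fun f \<Longrightarrow> poly_fun g \<Longrightarrow> poly_fun (\<lambda>t. f t * g t)"
  unfolding poly_fun_def by (metis poly_mult)

lemma poly_fun_power [intro]: "poly_fun f \<Longrightarrow> poly_fun (\<lambda>t. f t ^ n)"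
  unfolding poly_fun_def by (metis poly_power)

lemma poly_fun_divide [intro]:
  fixes f :: "'a::field \<Rightarrow> 'a" shows "poly_fun f \<Longrightarrow> poly_fun (\<lambda>t. f t / c)"
  using poly_fun_mult[OF _ poly_fun_const[of "inverse c"], of f] by (simp add: divide_inverse)

lemma poly_fun_sum [intro]: "(\<And>i. i \<in> A \<Longrightarrow> poly_fun (f i)) \<Longrightarrow> poly_fun (\<lambda>t. \<Sum>i\<in>A. f i t)"
  by (induction A rule: infinite_finite_induct) (auto intro!: poly_fun_const poly_fun_add)

lemma poly_fun_prod [intro]: "(\<And>i. i \<in> A \<Longrightarrow> poly_fun (f i)) \<Longrightarrow> poly_fun (\<lambda>t. \<Prod>i\<in>A. f i t)"
  by (induction A rule: infinite_finite_induct) (auto intro!: poly_fun_const poly_fun_mult)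

lemma poly_fun_eqI:
  fixes f g :: "'a::idom \<Rightarrow> 'a"
  assumes "poly_fun f" "poly_fun g" "infinite {t. f t = g t}"
  shows "f t = g t"
proof -
  obtain P Q where P: "\<And>t. f t = poly P t" and Q: "\<And>t. g t = poly Q t"
    using assms(1,2) unfolding poly_fun_def by metis
  have "{t. f t = g t} = {t. poly (P - Q) t = 0}" by (auto simp: P Q)
  with assms(3) have "P - Q = 0" using poly_roots_finite[of "P - Q"] by auto
  then show ?thesis by (simp add: P Q)
qed

text \<open>
  The recurrence divides only by positive integers, so \<open>h\<^sub>n\<close> is a polynomial in \<open>p\<^sub>1, \<dots>, p\<^sub>n\<close>.
\<close>

lemma poly_fun_complete_fps:
  fixes p :: "'a::field_char_0 \<Rightarrow> nat \<Rightarrow> 'a"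
  assumes "\<And>n. n \<ge> 1 \<Longrightarrow> poly_fun (\<lambda>t. p t n)"
  shows "poly_fun (\<lambda>t. fps_nth (complete_fps (p t)) n)"
proof (induction n rule: less_induct)
  case (less n)
  show ?case
  proof (cases n)
    case 0
    then show ?thesis by (simp add: poly_fun_const)
  next
    case (Suc m)
    have "fps_nth (complete_fps (p t)) (Suc m) = 
        (\<Sum>i=0..m. p t (Suc i) * fps_nth (complete_fps (p t)) (m - i)) / of_nat (Suc m)" for t
      using complete_fps_recurrence[of m "p t"] by (simp add: field_simps del: of_nat_Suc)
    then have "(\<lambda>t. fps_nth (complete_fps (p t)) n) = 
       (\<lambda>t. (\<Sum>i=0..m. p t (Suc i) * fps_nth (complete_fps (p t)) (m - i)) / of_nat (Suc m))"
      by (auto simp: Suc)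
    then show ?thesis
      using assms less Suc by (auto intro!: poly_fun_divide poly_fun_sum poly_fun_mult)
  qed
qed

lemma poly_fun_schur:
  fixes p :: "'a::field_char_0 \<Rightarrow> nat \<Rightarrow> 'a"
  assumes "\<And>n. n \<ge> 1 \<Longrightarrow> poly_fun (\<lambda>t. p t n)"
  shows "poly_fun (\<lambda>t. schur \<nu> (p t))"
proof -
  have c: "poly_fun (\<lambda>t. complete_sym (p t) k)" for k
    using poly_fun_complete_fps[of p "nat k", OF assms] by (cases "k < 0") (auto simp: complete_sym_def)
  have "q i < plen \<nu>" if "q permutes {0..<plen \<nu>}" "i < plen \<nu>" for q i
    using permutes_in_image[OF that(1), of i] that by auto
  then have "schur \<nu> (p t) = (\<Sum>q | q permutes {0..<plen \<nu>}. signof q *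
     (\<Prod>i = 0..<plen \<nu>. complete_sym (p t) (int (\<nu> (Suc i)) - int i + int (q i))))" for t
    unfolding schur_def by (subst det_def'[of _ "plen \<nu>"]) (auto intro!: sum.cong prod.cong)
  then show ?thesis
    by (simp only:) (intro poly_fun_sum poly_fun_mult poly_fun_prod poly_fun_const c)
qed

lemma schur_cong:
  assumes "\<And>n. n \<ge> 1 \<Longrightarrow> p n = p' n"
  shows "schur \<nu> p = schur \<nu> p'"
proof -
  have "complete_fps p = complete_fps p'" using assms by (intro complete_fps_cong) blast
  then show ?thesis unfolding schur_def complete_sym_def by (rule ssubst) (rule refl)
qed

lemma qh_nonzero [simp]: "qh \<noteq> 0"
  by (simp add: qh_def Zero_fract_def eq_fract)

lemma qh_power: "qh ^ n = Fract (monom 1 n) 1"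
  by (induction n) (auto simp: qh_def One_fract_def monom_Suc eq_fract simp flip: monom_0)

lemma qh_power_eq_1_iff: "qh ^ n = 1 \<longleftrightarrow> n = 0"
proof -
  have "monom (1::rat) n = 1 \<longleftrightarrow> n = 0"
    by (metis degree_1 degree_monom_eq monom_eq_1 one_neq_zero)
  then show ?thesis
    unfolding qh_power One_fract_def by (simp add: eq_fract)
qed

lemma qh_powi_eq_1_iff [simp]: "qh powi k = 1 \<longleftrightarrow> k = 0"
  by (cases "k \<ge> 0") (auto simp: power_int_def power_inverse qh_power_eq_1_iff)

lemma qh_powi_inject [simp]: "qh powi k = qh powi l \<longleftrightarrow> k = l"
proof
  assume "qh powi k = qh powi l"
  then have "qh powi (k - l) = 1" by (subst power_int_diff) auto
  then show "k = l" by simp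
qed simp

lemma qh_powi_add: "qh powi (k + l) = qh powi k * qh powi l"
  by (rule power_int_add) simp

lemma qbr_eq_0_iff [simp]: "qbr m = 0 \<longleftrightarrow> m = 0"
  by (simp add: qbr_def)

text \<open>
  The power sums of the \<open>N\<close> variables \<open>q\<^bsup>\<mu>\<^sub>i-i+1/2\<^esup>\<close>, with \<open>q\<^bsup>-N\<^esup>\<close> replaced by a parameter \<open>t\<close>: the
  geometric sum of \<open>q\<^bsup>n(-i+1/2)\<^esup>\<close> over \<open>i \<le> N\<close> is \<open>(1 - q\<^bsup>-nN\<^esup>) / (q\<^bsup>n/2\<^esup> - q\<^bsup>-n/2\<^esup>)\<close>.
  At \<open>t = 0\<close> these are the power sums of the infinite specialization.
\<close>

definition psum_trunc :: "(nat \<Rightarrow> nat) \<Rightarrow> qfun \<Rightarrow> nat \<Rightarrow> qfun" where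
  "psum_trunc \<mu> t n =
     (\<Sum>i=1..plen \<mu>. qh powi (int n * (2 * int (\<mu> i) - 2 * int i + 1))
                    - qh powi (int n * (- 2 * int i + 1)))
     + (1 - t ^ n) / (qh powi int n - qh powi (- int n))"

lemma psum_trunc_0: "n \<ge> 1 \<Longrightarrow> psum_trunc \<mu> 0 n = psum_rho \<mu> n"
  by (simp add: psum_trunc_def psum_rho_def)

lemma poly_fun_psum_trunc: "poly_fun (\<lambda>t. psum_trunc \<mu> t n)"
  unfolding psum_trunc_def by (intro poly_fun_add poly_fun_const poly_fun_divide poly_fun_diff poly_fun_power poly_fun_id)

lemma qh_geometric_sum:
  assumes "n \<ge> 1"
  shows "(\<Sum>i=1..N. qh powi (int n * (- 2 * int i + 1))) = 
    (1 - (qh powi (- 2 * int N)) ^ n) / (qh powi int n - qh powi (- int n))"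
proof -
  let ?d = "qh powi int n - qh powi (- int n)"
  have "?d \<noteq> 0" unfolding right_minus_eq qh_powi_inject using assms by simp
  have "(\<Sum>i=1..N. qh powi (int n * (- 2 * int i + 1))) * ?d = 1 - (qh powi (- 2 * int N)) ^ n"
  proof (induction N)
    case (Suc N)
    have e1: "int n * (- 2 * int (Suc N) + 1) + int n = - 2 * int N * int n - 0"
      and e2: "int n * (- 2 * int (Suc N) + 1) + - int n = - 2 * int (Suc N) * int n"
      by (simp_all add: algebra_simps)
    have 1: "qh powi (int n * (- 2 * int (Suc N) + 1)) * qh powi int n = qh powi (- 2 * int N * int n)"
      unfolding qh_powi_add[symmetric] e1 by simp
    have 2: "qh powi (int n * (- 2 * int (Suc N) + 1)) * qh powi (- int n) = qh powi (- 2 * int (Suc N) * int n)"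
      unfolding qh_powi_add[symmetric] e2 ..
    have 3: "(qh powi (- 2 * int M)) ^ n = qh powi (- 2 * int M * int n)" for M
      by (rule power_int_power')
    let ?S = "\<lambda>N. \<Sum>i=1..N. qh powi (int n * (- 2 * int i + 1))"
    have "?S (Suc N) * ?d = ?S N * ?d + qh powi (int n * (- 2 * int (Suc N) + 1)) * ?d"
      by (simp add: distrib_right)
    also have "\<dots> = 1 - (qh powi (- 2 * int (Suc N))) ^ n"
      unfolding Suc.IH unfolding right_diff_distrib 1 2 3 by (simp only: diff_add_cancel add_diff_eq)
    finally show ?case .
  qed simp
  with \<open>?d \<noteq> 0\<close> show ?thesis by (simp add: field_simps)
qed

lemma psum_trunc_finite:
  assumes "\<mu> \<in> partitions" "plen \<mu> \<le> N" "n \<ge> 1"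
  shows "psum_trunc \<mu> (qh powi (- 2 * int N)) n = (\<Sum>i<N. (qh powi (2 * int (\<mu> (Suc i)) - 2 * int (Suc i) + 1)) ^ n)"
proof -
  let ?f = "\<lambda>i. qh powi (int n * (2 * int (\<mu> i) - 2 * int i + 1))"
  let ?g = "\<lambda>i. qh powi (int n * (- 2 * int i + 1))"
  have "(\<Sum>i=1..plen \<mu>. ?f i - ?g i) = (\<Sum>i=1..N. ?f i - ?g i)"
    using assms(2) part_eq_0[OF assms(1)] by (intro sum.mono_neutral_left) auto
  then have "psum_trunc \<mu> (qh powi (- 2 * int N)) n = (\<Sum>i=1..N. ?f i - ?g i) + (\<Sum>i=1..N. ?g i)"
    unfolding psum_trunc_def qh_geometric_sum[OF assms(3)] by simp
  also have "\<dots> = (\<Sum>i=1..N. ?f i)" by (simp add: sum_subtractf)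
  also have "\<dots> = (\<Sum>i<N. ?f (Suc i))"
    by (simp add: sum.atLeast1_atMost_eq)
  also have "\<dots> = (\<Sum>i<N. (qh powi (2 * int (\<mu> (Suc i)) - 2 * int (Suc i) + 1)) ^ n)"
    unfolding power_int_power' by (simp only: mult.commute)
  finally show ?thesis .
qed

text \<open>
  The values \<open>q\<^bsup>-N\<^esup>\<close> are pairwise distinct, so that two polynomials agreeing at them for all large \<open>N\<close>
  also agree at 0, the formal limit for infinitely many variables.
\<close>

lemma truncation_principle:
  assumes "poly_fun f" "poly_fun g" "\<And>N. N \<ge> N0 \<Longrightarrow> f (qh powi (- 2 * int N)) = g (qh powi (- 2 * int N))"
  shows "f 0 = g 0"
proof (rule poly_fun_eqI[OF assms(1,2)])
  have "inj_on (\<lambda>N. qh powi (- 2 * int N)) {N0..}"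
  proof (rule inj_onI)
    fix x y assume "qh powi (- 2 * int x) = qh powi (- 2 * int y)"
    then have "- 2 * int x = - 2 * int y" by (rule qh_powi_inject[THEN iffD1])
    then show "x = y" by simp
  qed
  then have "infinite ((\<lambda>N. qh powi (- 2 * int N)) ` {N0..})"
    using finite_imageD infinite_Ici by blast
  moreover have "(\<lambda>N. qh powi (- 2 * int N)) ` {N0..} \<subseteq> {t. f t = g t}"
    using assms(3) by (intro image_subsetI) simp
  ultimately show "infinite {t. f t = g t}"
    using infinite_super by blast
qed

text \<open>
  The determinant of \<open>q\<^bsup>(\<mu>\<^sub>i+N-i)(\<nu>\<^sub>j+N-j)\<^esup>\<close>, whose symmetry under exchange of \<open>\<mu>\<close> and \<open>\<nu>\<close> is the source
  of the symmetry of \<open>W\<^bsub>\<mu>\<nu>\<^esub>\<close>.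
\<close>

definition part_alternant :: "nat \<Rightarrow> (nat \<Rightarrow> nat) \<Rightarrow> (nat \<Rightarrow> nat) \<Rightarrow> qfun" where
  "part_alternant N \<mu> \<nu> = det (mat N N (\<lambda>(i, j). qh powi (2 * int (shifted_parts N \<mu> i * shifted_parts N \<nu> j))))"

lemma part_alternant_sym: "part_alternant N \<mu> \<nu> = part_alternant N \<nu> \<mu>"
  unfolding part_alternant_def
  using det_transpose_entries[of N "\<lambda>i j. qh powi (2 * int (shifted_parts N \<nu> i * shifted_parts N \<mu> j))"]
  by (simp add: mult.commute)

lemma shifted_parts_empty: "shifted_parts N empty_part j = N - 1 - j"
  by (simp add: shifted_parts_def)

text \<open>
  The variable \<open>x\<^sub>i = q\<^bsup>\<mu>\<^sub>i-i+1/2\<^esup>\<close>.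
\<close>

definition qnode :: "(nat \<Rightarrow> nat) \<Rightarrow> nat \<Rightarrow> qfun" where
  "qnode \<mu> i = qh powi (2 * int (\<mu> i) - 2 * int i + 1)"

text \<open>
  The nodes are \<open>q\<^bsup>\<mu>\<^sub>i+N-i\<^esup>\<close> up to the common factor \<open>q\<^bsup>1/2-N\<^esup>\<close>, whose powers can be taken out of the columns.
\<close>

lemma det_qnode:
  assumes "\<nu> \<in> partitions" "plen \<nu> \<le> N"
  shows "det (mat N N (\<lambda>(i, j). qnode \<mu> (Suc i) ^ shifted_parts N \<nu> j)) =
    qh powi ((1 - 2 * int N) * int (part_size \<nu> + (\<Sum>j = 0..<N. N - 1 - j))) * part_alternant N \<mu> \<nu>"
proof -
  let ?c = "qh powi (1 - 2 * int N)"
  have "qnode \<mu> (Suc i) ^ e = ?c ^ e * qh powi (2 * int (shifted_parts N \<mu> i * e))" if "i < N" for i e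
  proof -
    have "2 * int (\<mu> (Suc i)) - 2 * int (Suc i) + 1 = (1 - 2 * int N) + 2 * int (shifted_parts N \<mu> i)"
      using that by (simp add: shifted_parts_def of_nat_diff)
    then have "qnode \<mu> (Suc i) = ?c * qh powi (2 * int (shifted_parts N \<mu> i))"
      unfolding qnode_def by (simp only: qh_powi_add)
    then show ?thesis
      by (simp add: power_mult_distrib power_int_power' mult.assoc)
  qed
  then have "det (mat N N (\<lambda>(i, j). qnode \<mu> (Suc i) ^ shifted_parts N \<nu> j)) =
     det (mat N N (\<lambda>(i, j). ?c ^ shifted_parts N \<nu> j * qh powi (2 * int (shifted_parts N \<mu> i * shifted_parts N \<nu> j))))"
    by (intro arg_cong[where f = det] cong_mat) auto
  also have "\<dots> = (\<Prod>j = 0..<N. ?c ^ shifted_parts N \<nu> j) * part_alternant N \<mu> \<nu>"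
    unfolding part_alternant_def by (rule det_cols_scale)
  also have "(\<Prod>j = 0..<N. ?c ^ shifted_parts N \<nu> j) = ?c ^ (\<Sum>j = 0..<N. shifted_parts N \<nu> j)"
    by (rule power_sum[symmetric])
  also have "(\<Sum>j = 0..<N. shifted_parts N \<nu> j) = part_size \<nu> + (\<Sum>j = 0..<N. N - 1 - j)"
    by (simp only: shifted_parts_def sum.distrib part_size_eq_sum[OF assms])
  finally show ?thesis by (simp only: power_int_power')
qed

lemma qnode_inject: "\<mu> \<in> partitions \<Longrightarrow> 1 \<le> i \<Longrightarrow> i < j \<Longrightarrow> qnode \<mu> i \<noteq> qnode \<mu> j"
  using part_antimono[of \<mu> i j] by (simp add: qnode_def)

lemma vandermonde_qnode_nonzero:
  assumes "\<mu> \<in> partitions"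
  shows "det (mat N N (\<lambda>(i, j). qnode \<mu> (Suc i) ^ (N - 1 - j))) \<noteq> 0"
proof -
  have "finite {(i, j). 1 \<le> i \<and> i < j \<and> j \<le> N}"
    by (rule finite_subset[of _ "{..N} \<times> {..N}"]) auto
  then show ?thesis
    unfolding vandermonde_det using qnode_inject[OF assms] by auto
qed

text \<open>
  The quotient of alternants for \<open>s\<^sub>\<nu>\<close> in \<open>N\<close> variables; the denominator is nonzero because the nodes are
  pairwise distinct.
\<close>

lemma schur_trunc:
  assumes "\<mu> \<in> partitions" "plen \<mu> \<le> N" "\<nu> \<in> partitions" "plen \<nu> \<le> N"
  shows "part_alternant N \<mu> empty_part * schur \<nu> (psum_trunc \<mu> (qh powi (- 2 * int N))) =
    qh powi ((1 - 2 * int N) * int (part_size \<nu>)) * part_alternant N \<mu> \<nu>"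
    and "part_alternant N \<mu> empty_part \<noteq> 0"
proof -
  let ?D = "\<Sum>j = 0..<N. N - 1 - j"
  have e: "part_size empty_part = 0" by (simp add: part_size_def)
  have v: "det (mat N N (\<lambda>(i, j). qnode \<mu> (Suc i) ^ (N - 1 - j))) = 
     qh powi ((1 - 2 * int N) * int ?D) * part_alternant N \<mu> empty_part"
    using det_qnode[of empty_part N \<mu>] by (simp only: shifted_parts_empty e) simp
  show ne: "part_alternant N \<mu> empty_part \<noteq> 0"
    using vandermonde_qnode_nonzero[OF assms(1), of N] unfolding v by auto
  have s: "schur \<nu> (psum_trunc \<mu> (qh powi (- 2 * int N))) = schur \<nu> (\<lambda>n. \<Sum>i<N. qnode \<mu> (Suc i) ^ n)"
    by (rule schur_cong) (unfold qnode_def, rule psum_trunc_finite[OF assms(1,2)])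
  have "qh powi ((1 - 2 * int N) * int ?D) * (qh powi ((1 - 2 * int N) * int (part_size \<nu>)) * part_alternant N \<mu> \<nu>) =
     det (mat N N (\<lambda>(i, j). qnode \<mu> (Suc i) ^ shifted_parts N \<nu> j))"
    unfolding det_qnode[OF assms(3,4)] of_nat_add distrib_left
    by (simp only: qh_powi_add mult_ac)
  also have "\<dots> = (qh powi ((1 - 2 * int N) * int ?D) * part_alternant N \<mu> empty_part) * schur \<nu> (\<lambda>n. \<Sum>i<N. qnode \<mu> (Suc i) ^ n)"
    unfolding bialternant[OF assms(3,4)] v ..
  finally show "part_alternant N \<mu> empty_part * schur \<nu> (psum_trunc \<mu> (qh powi (- 2 * int N))) =
    qh powi ((1 - 2 * int N) * int (part_size \<nu>)) * part_alternant N \<mu> \<nu>"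
    unfolding s by simp
qed

text \<open>
  In \<open>N\<close> variables each side is \<open>part_alternant N \<mu> \<nu> / part_alternant N 0 0\<close> up to the factor
  \<open>q\<^bsup>(1/2-N)(|\<mu>|+|\<nu>|)\<^esup>\<close>; the denominators \<open>part_alternant N \<mu> 0\<close> cancel.
\<close>

lemma schur_rho_symmetric:
  assumes "\<mu> \<in> partitions" "\<nu> \<in> partitions"
  shows "schur \<mu> (psum_rho empty_part) * schur \<nu> (psum_rho \<mu>) =
         schur \<nu> (psum_rho empty_part) * schur \<mu> (psum_rho \<nu>)"
proof -
  have "schur \<mu> (psum_trunc empty_part 0) * schur \<nu> (psum_trunc \<mu> 0) =
         schur \<nu> (psum_trunc empty_part 0) * schur \<mu> (psum_trunc \<nu> 0)"
  proof (rule truncation_principle[where f = "\<lambda>t. schur \<mu> (psum_trunc empty_part t) * schur \<nu> (psum_trunc \<mu> t)"])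
    fix N assume "N \<ge> max (plen \<mu>) (plen \<nu>)"
    then have N: "plen \<mu> \<le> N" "plen \<nu> \<le> N" by auto
    let ?t = "qh powi (- 2 * int N)"
    have e: "empty_part \<in> partitions" "plen empty_part \<le> N" by auto
    let ?e = "part_alternant N empty_part empty_part"
    have *: "?e * (schur \<alpha> (psum_trunc empty_part ?t) * schur \<beta> (psum_trunc \<alpha> ?t)) =
        qh powi ((1 - 2 * int N) * int (part_size \<alpha>)) * qh powi ((1 - 2 * int N) * int (part_size \<beta>)) * part_alternant N \<alpha> \<beta>"
      if "\<alpha> \<in> partitions" "plen \<alpha> \<le> N" "\<beta> \<in> partitions" "plen \<beta> \<le> N" for \<alpha> \<beta>
    proof -
      have alg: "u * (x * y) = c * d * w" if "u * x = c * v" "v * y = d * w" for u v w x y c d :: qfun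
      proof -
        have "u * (x * y) = (u * x) * y" by (rule mult.assoc[symmetric])
        also have "\<dots> = c * (v * y)" unfolding that(1) by (rule mult.assoc)
        finally show ?thesis unfolding that(2) by (simp only: mult.assoc)
      qed
      show ?thesis
        using schur_trunc(1)[OF e that(1,2)] schur_trunc(1)[OF that]
        unfolding part_alternant_sym[of N empty_part \<alpha>] by (rule alg)
    qed
    have "?e * (schur \<mu> (psum_trunc empty_part ?t) * schur \<nu> (psum_trunc \<mu> ?t)) =
        ?e * (schur \<nu> (psum_trunc empty_part ?t) * schur \<mu> (psum_trunc \<nu> ?t))"
      using *[OF assms(1) N(1) assms(2) N(2)] *[OF assms(2) N(2) assms(1) N(1)]
      by (simp only: part_alternant_sym[of N \<mu>] mult_ac)
    then show "schur \<mu> (psum_trunc empty_part ?t) * schur \<nu> (psum_trunc \<mu> ?t) =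
        schur \<nu> (psum_trunc empty_part ?t) * schur \<mu> (psum_trunc \<nu> ?t)"
      using schur_trunc(2)[OF e e] by simp
  qed (auto intro!: poly_fun_mult poly_fun_schur poly_fun_psum_trunc)
  moreover have "schur \<alpha> (psum_trunc \<beta> 0) = schur \<alpha> (psum_rho \<beta>)" for \<alpha> \<beta>
    by (rule schur_cong) (rule psum_trunc_0)
  ultimately show ?thesis by simp
qed

text \<open>
  All partitions of \<open>n\<close> have length at most \<open>N\<close> once \<open>n \<le> N\<close>, so the Cauchy identity in \<open>N\<close> variables
  has the same summands for all such \<open>N\<close> and the truncation principle applies.
\<close>

lemma cauchy_rho:
  assumes "\<mu> \<in> partitions"
  shows "(\<Sum>\<nu> | \<nu> \<in> partitions \<and> part_size \<nu> = n. schur \<nu> p * schur \<nu> (psum_rho \<mu>)) =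
    fps_nth (complete_fps (\<lambda>m. p m * psum_rho \<mu> m)) n"
proof -
  have "(\<Sum>\<nu> | \<nu> \<in> partitions \<and> part_size \<nu> = n. schur \<nu> p * schur \<nu> (psum_trunc \<mu> 0)) =
    fps_nth (complete_fps (\<lambda>m. p m * psum_trunc \<mu> 0 m)) n"
  proof (rule truncation_principle[where 
        f = "\<lambda>t. \<Sum>\<nu> | \<nu> \<in> partitions \<and> part_size \<nu> = n. schur \<nu> p * schur \<nu> (psum_trunc \<mu> t)" and
        g = "\<lambda>t. fps_nth (complete_fps (\<lambda>m. p m * psum_trunc \<mu> t m)) n"])
    fix N assume "N \<ge> max (plen \<mu>) n"
    then have N: "plen \<mu> \<le> N" "n \<le> N" by auto
    let ?t = "qh powi (- 2 * int N)" and ?V = "det (mat N N (\<lambda>(i, j). qnode \<mu> (Suc i) ^ (N - 1 - j)))"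
    have s: "schur \<nu> (psum_trunc \<mu> ?t) = schur \<nu> (\<lambda>n. \<Sum>i<N. qnode \<mu> (Suc i) ^ n)" for \<nu>
      by (rule schur_cong) (unfold qnode_def, rule psum_trunc_finite[OF assms N(1)])
    have h: "complete_fps (\<lambda>m. p m * psum_trunc \<mu> ?t m) = complete_fps (\<lambda>m. p m * (\<Sum>i<N. qnode \<mu> (Suc i) ^ m))"
      by (rule complete_fps_cong) (unfold qnode_def psum_trunc_finite[OF assms N(1)], rule refl)
    have len: "plen \<nu> \<le> N" if "\<nu> \<in> partitions" "part_size \<nu> = n" for \<nu>
      using plen_le_part_size[OF that(1)] that N by simp
    have "?V * (\<Sum>\<nu> | \<nu> \<in> partitions \<and> part_size \<nu> = n. schur \<nu> p * schur \<nu> (psum_trunc \<mu> ?t)) =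
        (\<Sum>\<nu> | \<nu> \<in> partitions \<and> plen \<nu> \<le> N \<and> part_size \<nu> = n.
           det (mat N N (\<lambda>(i, j). qnode \<mu> (Suc i) ^ shifted_parts N \<nu> j)) * schur \<nu> p)"
      unfolding sum_distrib_left
    proof (rule sum.cong)
      fix \<nu> assume "\<nu> \<in> {\<nu>. \<nu> \<in> partitions \<and> plen \<nu> \<le> N \<and> part_size \<nu> = n}"
      then have "\<nu> \<in> partitions" "plen \<nu> \<le> N" by auto
      from bialternant[OF this, of "\<lambda>i. qnode \<mu> (Suc i)"]
      show "?V * (schur \<nu> p * schur \<nu> (psum_trunc \<mu> ?t)) = 
          det (mat N N (\<lambda>(i, j). qnode \<mu> (Suc i) ^ shifted_parts N \<nu> j)) * schur \<nu> p"
        unfolding s by (simp only: mult_ac)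
    qed (auto intro: len)
    also have "\<dots> = ?V * fps_nth (complete_fps (\<lambda>m. p m * psum_trunc \<mu> ?t m)) n"
      unfolding h by (rule cauchy_alternants)
    finally show "(\<Sum>\<nu> | \<nu> \<in> partitions \<and> part_size \<nu> = n. schur \<nu> p * schur \<nu> (psum_trunc \<mu> ?t)) =
        fps_nth (complete_fps (\<lambda>m. p m * psum_trunc \<mu> ?t m)) n"
      using vandermonde_qnode_nonzero[OF assms, of N] by simp
  qed (auto intro!: poly_fun_mult poly_fun_const poly_fun_sum poly_fun_schur poly_fun_complete_fps poly_fun_psum_trunc)
  moreover have "schur \<alpha> (psum_trunc \<beta> 0) = schur \<alpha> (psum_rho \<beta>)" for \<alpha> \<beta>
    by (rule schur_cong) (rule psum_trunc_0)
  moreover have "complete_fps (\<lambda>m. p m * psum_trunc \<mu> 0 m) = complete_fps (\<lambda>m. p m * psum_rho \<mu> m)"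
    by (rule complete_fps_cong) (simp add: psum_trunc_0)
  ultimately show ?thesis by simp
qed

section \<open>The principal specialization\<close>

text \<open>
  Both sides run over the integers from \<open>l - i + 1\<close> to \<open>N - i + a\<close>.  The lemma is used
  multiplicatively for the product formula of \<open>W\<^sub>\<mu>\<close> and additively for the exponents of the hyperbolic sines,
  hence the formulation for commutative monoids.
\<close>

lemma (in comm_monoid_set) shift_window:
  assumes "l \<le> N"
  shows "F (\<lambda>j. g (int a + int j - int i)) {l<..N} \<^bold>* F (\<lambda>v. g (int v - int i + int l)) {1..a} =
    F (\<lambda>j. g (int j - int i)) {l<..N} \<^bold>* F (\<lambda>v. g (int v - int i + int N)) {1..a}"
  using assms
proof (induction N rule: dec_induct)
  case base
  then show ?case by simp
next
  case (step N)
  have ins: "{l<..Suc N} = insert (Suc N) {l<..N}" using step by auto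
  have window: "g (int (Suc N) - int i) \<^bold>* F (\<lambda>v. g (int v - int i + int (Suc N))) {1..a} =
      g (int a + int (Suc N) - int i) \<^bold>* F (\<lambda>v. g (int v - int i + int N)) {1..a}"
  proof (induction a)
    case (Suc a)
    let ?G = "\<lambda>a. F (\<lambda>v. g (int v - int i + int (Suc N))) {1..a}"
    let ?H = "\<lambda>a. F (\<lambda>v. g (int v - int i + int N)) {1..a}"
    have last: "int (Suc a) - int i + int (Suc N) = int (Suc a) + int (Suc N) - int i"
       "int (Suc a) - int i + int N = int a + int (Suc N) - int i" by simp_all
    have G: "?G (Suc a) = ?G a \<^bold>* g (int (Suc a) + int (Suc N) - int i)"
      and H: "?H (Suc a) = ?H a \<^bold>* g (int a + int (Suc N) - int i)"
      unfolding cl_ivl_Suc last by simp_all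
    have "g (int (Suc N) - int i) \<^bold>* ?G (Suc a) = (g (int a + int (Suc N) - int i) \<^bold>* ?H a) \<^bold>* g (int (Suc a) + int (Suc N) - int i)"
      unfolding G Suc.IH[symmetric] by (rule assoc[symmetric])
    also have "\<dots> = g (int (Suc a) + int (Suc N) - int i) \<^bold>* ?H (Suc a)"
      unfolding H by (simp only: ac_simps)
    finally show ?case .
  qed simp
  let ?A = "F (\<lambda>j. g (int a + int j - int i)) {l<..N}" and ?B = "F (\<lambda>j. g (int j - int i)) {l<..N}"
  let ?a = "g (int a + int (Suc N) - int i)" and ?b = "g (int (Suc N) - int i)"
  have "F (\<lambda>j. g (int a + int j - int i)) {l<..Suc N} = ?a \<^bold>* ?A"
    and B: "F (\<lambda>j. g (int j - int i)) {l<..Suc N} = ?b \<^bold>* ?B"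
    unfolding ins by simp_all
  then have "F (\<lambda>j. g (int a + int j - int i)) {l<..Suc N} \<^bold>* F (\<lambda>v. g (int v - int i + int l)) {1..a} =
      ?a \<^bold>* (?B \<^bold>* F (\<lambda>v. g (int v - int i + int N)) {1..a})"
    by (simp only: step.IH[symmetric] assoc)
  also have "\<dots> = ?B \<^bold>* (?b \<^bold>* F (\<lambda>v. g (int v - int i + int (Suc N))) {1..a})"
    unfolding window by (rule left_commute)
  finally show ?case unfolding B by (simp only: ac_simps)
qed

lemma (in comm_monoid_set) pairs_split:
  fixes l N :: nat
  assumes "l \<le> N" and triv: "\<And>i j. l < i \<Longrightarrow> i < j \<Longrightarrow> j \<le> N \<Longrightarrow> g i j = \<^bold>1"
  shows "F (\<lambda>(i, j). g i j) {(i, j). 1 \<le> i \<and> i < j \<and> j \<le> N} =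
     F (\<lambda>(i, j). g i j) {(i, j). 1 \<le> i \<and> i < j \<and> j \<le> l} \<^bold>* F (\<lambda>i. F (g i) {l<..N}) {1..l}"
proof -
  let ?A = "{(i, j). 1 \<le> i \<and> i < j \<and> j \<le> N}"
  let ?B = "{(i, j). 1 \<le> i \<and> i < j \<and> j \<le> l}"
  let ?C = "SIGMA i:{1..l}. {l<..N}"
  have fin: "finite ?A" by (rule finite_subset[of _ "{..N} \<times> {..N}"]) auto
  have "?B \<union> ?C \<subseteq> ?A" using assms(1) by auto
  then have "F (\<lambda>(i, j). g i j) ?A = F (\<lambda>(i, j). g i j) (?B \<union> ?C)"
    using triv by (intro mono_neutral_right[OF fin]) auto
  also have "\<dots> = F (\<lambda>(i, j). g i j) ?B \<^bold>* F (\<lambda>(i, j). g i j) ?C"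
    using finite_subset[OF \<open>?B \<union> ?C \<subseteq> ?A\<close> fin] by (intro union_disjoint) auto
  also have "F (\<lambda>(i, j). g i j) ?C = F (\<lambda>i. F (g i) {l<..N}) {1..l}"
    by (rule Sigma[symmetric]) auto
  finally show ?thesis .
qed

lemma sum_pairs:
  "(\<Sum>(i, j) | 1 \<le> i \<and> i < j \<and> j \<le> N. f i + f j) = (int N - 1) * (\<Sum>i = 1..N. f i :: int)"
proof (induction N)
  case 0
  have "{(i, j). 1 \<le> i \<and> i < j \<and> j \<le> (0::nat)} = {}" by auto
  then show ?case by (simp only: sum.empty) simp
next
  case (Suc N)
  have "(\<Sum>(i, j) | 1 \<le> i \<and> i < j \<and> j \<le> Suc N. f i + f j) =
     (\<Sum>(i, j) | 1 \<le> i \<and> i < j \<and> j \<le> N. f i + f j) + (\<Sum>i = 1..N. \<Sum>j\<in>{N<..Suc N}. f i + f j)"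
    by (rule sum.pairs_split) auto
  moreover have "{N<..Suc N} = {Suc N}" by auto
  ultimately show ?case unfolding Suc.IH by (simp add: sum.distrib algebra_simps)
qed

lemma finite_pairs: "finite {(i, j). 1 \<le> i \<and> i < j \<and> j \<le> (N::nat)}"
  by (rule finite_subset[of _ "{..N} \<times> {..N}"]) auto

lemma prod_qh_powi:
  "finite A \<Longrightarrow> (\<Prod>a\<in>A. qh powi f a) = qh powi (\<Sum>a\<in>A. f a)"
  by (induction A rule: finite_induct) (auto simp: qh_powi_add)

text \<open>
  A Vandermonde determinant: \<open>q\<^sup>x - q\<^sup>y = q\<^bsup>(x+y)/2\<^esup> [x - y]\<close>.
\<close>

lemma part_alternant_empty:
  assumes "\<mu> \<in> partitions" "plen \<mu> \<le> N"
  shows "part_alternant N \<mu> empty_part = 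
    qh powi ((int N - 1) * (int (part_size \<mu>) + (\<Sum>i = 1..N. int N - int i))) *
      (\<Prod>(i, j) | 1 \<le> i \<and> i < j \<and> j \<le> N. qbr (int (\<mu> i) - int (\<mu> j) + int j - int i))"
proof -
  define x where "x = (\<lambda>i. int (\<mu> i) + (int N - int i))"
  have "int (shifted_parts N \<mu> i) = x (Suc i)" if "i < N" for i
    using that by (simp add: shifted_parts_def x_def of_nat_diff)
  then have "part_alternant N \<mu> empty_part = det (mat N N (\<lambda>(i, j). (qh powi (2 * x (Suc i))) ^ (N - 1 - j)))"
    unfolding part_alternant_def shifted_parts_empty
    by (intro arg_cong[where f = det] cong_mat)
      (simp_all only: split_conv power_int_power' of_nat_mult mult.assoc)
  also have "\<dots> = (\<Prod>(i, j) | 1 \<le> i \<and> i < j \<and> j \<le> N. qh powi (2 * x i) - qh powi (2 * x j))"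
    by (rule vandermonde_det[where x = "\<lambda>i. qh powi (2 * x i)"])
  also have "\<dots> = (\<Prod>(i, j) | 1 \<le> i \<and> i < j \<and> j \<le> N. qh powi (x i + x j) * qbr (int (\<mu> i) - int (\<mu> j) + int j - int i))"
  proof (rule prod.cong; clarify?)
    fix i j
    have 1: "int (\<mu> i) - int (\<mu> j) + int j - int i = x i - x j" by (simp add: x_def)
    have "x i + x j + (x i - x j) = 2 * x i" "x i + x j + - (x i - x j) = 2 * x j" by simp_all
    then show "qh powi (2 * x i) - qh powi (2 * x j) = qh powi (x i + x j) * qbr (int (\<mu> i) - int (\<mu> j) + int j - int i)"
      unfolding 1 qbr_def right_diff_distrib qh_powi_add[symmetric] by simp
  qed
  also have "\<dots> = (\<Prod>(i, j) | 1 \<le> i \<and> i < j \<and> j \<le> N. qh powi (x i + x j)) * 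
     (\<Prod>(i, j) | 1 \<le> i \<and> i < j \<and> j \<le> N. qbr (int (\<mu> i) - int (\<mu> j) + int j - int i))"
    by (simp add: prod.distrib case_prod_unfold)
  also have "(\<Prod>(i, j) | 1 \<le> i \<and> i < j \<and> j \<le> N. qh powi (x i + x j)) = 
      qh powi (\<Sum>(i, j) | 1 \<le> i \<and> i < j \<and> j \<le> N. x i + x j)"
    unfolding case_prod_unfold by (rule prod_qh_powi) (use finite_pairs in \<open>simp add: case_prod_unfold\<close>)
  also have "(\<Sum>(i, j) | 1 \<le> i \<and> i < j \<and> j \<le> N. x i + x j) = (int N - 1) * (\<Sum>i = 1..N. x i)"
    by (rule sum_pairs)
  also have "(\<Sum>i = 1..N. x i) = int (part_size \<mu>) + (\<Sum>i = 1..N. int N - int i)"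
    unfolding x_def sum.distrib using part_size_eq_sum[OF assms]
    by (simp add: sum.atLeast1_atMost_eq lessThan_atLeast0)
  finally show ?thesis .
qed

text \<open>
  The box in row \<open>i\<close> and column \<open>v\<close> has content \<open>v - i\<close>.
\<close>

definition content_sum :: "(nat \<Rightarrow> nat) \<Rightarrow> (int \<Rightarrow> 'a::comm_monoid_add) \<Rightarrow> 'a" where
  "content_sum \<mu> \<phi> = (\<Sum>i = 1..plen \<mu>. \<Sum>v = 1..\<mu> i. \<phi> (int v - int i))"

lemma kappa_content_sum: "kappa \<mu> = 2 * content_sum \<mu> (\<lambda>c. c)"
proof -
  have "int a * (int a - 2 * int i + 1) = 2 * (\<Sum>v = 1..a. int v - int i)" for a i
    by (induction a) (auto simp: algebra_simps)
  then show ?thesis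
    unfolding kappa_def content_sum_def sum_distrib_left by (intro sum.cong) (auto simp: sum_distrib_left)
qed

lemma part_size_content_sum: "part_size \<mu> = content_sum \<mu> (\<lambda>c. 1)"
  by (simp add: part_size_def content_sum_def)

text \<open>
  In \<open>N\<close> variables the principal specialization is a product over all pairs \<open>i < j \<le> N\<close>.  For \<open>j > l(\<mu>)\<close>
  the factors telescope to a product over the boxes in which \<open>N\<close> occurs only through brackets
  \<open>[v - i + N]\<close>; with the power of \<open>q\<close> in front these are polynomials in \<open>t = q\<^bsup>-N\<^esup>\<close>, and at \<open>t = 0\<close> only
  \<open>q\<^bsup>(v-i)/2\<^esup>\<close> is left.  The product of the latter is \<open>q\<^bsup>\<kappa>/4\<^esup>\<close>.
\<close>

lemma W1_eq_schur:
  assumes mu: "\<mu> \<in> partitions"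
  shows "W1 \<mu> = schur \<mu> (psum_rho empty_part)"
proof -
  define l where "l = plen \<mu>"
  define R where "R = (\<Prod>(i, j) | 1 \<le> i \<and> i < j \<and> j \<le> l. qbr (int (\<mu> i) - int (\<mu> j) + int j - int i) / qbr (int j - int i))"
  define g where "g = (\<lambda>t. R * (\<Prod>i = 1..l. \<Prod>v = 1..\<mu> i. (qh powi (int v - int i) - t * qh powi (int i - int v)) / qbr (int v - int i + int l)))"
  have "schur \<mu> (psum_trunc empty_part 0) = g 0"
  proof (rule truncation_principle)
    fix N assume N: "l \<le> N"
    let ?t = "qh powi (- 2 * int N)"
    let ?P = "{(i, j). 1 \<le> i \<and> i < j \<and> j \<le> N}"
    let ?V = "\<Prod>(i, j)\<in>?P. qbr (int (\<mu> i) - int (\<mu> j) + int j - int i)"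
    let ?U = "\<Prod>(i, j)\<in>?P. qbr (int j - int i)"
    let ?C = "\<Sum>i = 1..N. int N - int i"
    have e: "empty_part \<in> partitions" "plen empty_part \<le> N" by auto
    have e0: "part_size empty_part = 0" by (simp add: part_size_def)
    have m: "plen \<mu> \<le> N" using N by (simp add: l_def)
    have V0: "?U \<noteq> 0" using finite_pairs[of N] by auto
    have a0: "part_alternant N empty_part empty_part = qh powi ((int N - 1) * ?C) * ?U"
      using part_alternant_empty[OF e] by (simp add: e0)
    have "qh powi ((int N - 1) * ?C) * ?U * schur \<mu> (psum_trunc empty_part ?t) =
       qh powi ((1 - 2 * int N) * int (part_size \<mu>)) * (qh powi ((int N - 1) * (int (part_size \<mu>) + ?C)) * ?V)"
      using schur_trunc(1)[OF e mu m]
      unfolding part_alternant_sym[of N empty_part \<mu>] a0 part_alternant_empty[OF mu m] .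
    also have "\<dots> = qh powi ((int N - 1) * ?C) * (qh powi (- int N * int (part_size \<mu>)) * ?V)"
    proof -
      have "(1 - 2 * int N) * int (part_size \<mu>) + (int N - 1) * (int (part_size \<mu>) + ?C) =
          (int N - 1) * ?C + - int N * int (part_size \<mu>)" by (simp add: algebra_simps)
      then show ?thesis by (simp only: mult.assoc[symmetric] qh_powi_add[symmetric])
    qed
    finally have "?U * schur \<mu> (psum_trunc empty_part ?t) = qh powi (- int N * int (part_size \<mu>)) * ?V"
      by (simp add: mult.assoc)
    then have "schur \<mu> (psum_trunc empty_part ?t) = qh powi (- int N * int (part_size \<mu>)) * (?V / ?U)"
      using V0 by (simp add: field_simps)
    also have "?V / ?U = (\<Prod>(i, j)\<in>?P. qbr (int (\<mu> i) - int (\<mu> j) + int j - int i) / qbr (int j - int i))"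
      by (simp add: case_prod_unfold prod_dividef)
    also have "\<dots> = R * (\<Prod>i = 1..l. \<Prod>j\<in>{l<..N}. qbr (int (\<mu> i) - int (\<mu> j) + int j - int i) / qbr (int j - int i))"
      unfolding R_def using N part_eq_0[OF mu] by (intro prod.pairs_split) (auto simp: l_def)
    also have "(\<Prod>i = 1..l. \<Prod>j\<in>{l<..N}. qbr (int (\<mu> i) - int (\<mu> j) + int j - int i) / qbr (int j - int i)) =
       (\<Prod>i = 1..l. \<Prod>v = 1..\<mu> i. qbr (int v - int i + int N) / qbr (int v - int i + int l))"
    proof (rule prod.cong)
      fix i assume i: "i \<in> {1..l}"
      have "(\<Prod>j\<in>{l<..N}. qbr (int (\<mu> i) - int (\<mu> j) + int j - int i)) = (\<Prod>j\<in>{l<..N}. qbr (int (\<mu> i) + int j - int i))"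
        using part_eq_0[OF mu] by (intro prod.cong) (auto simp: l_def)
      moreover have "(\<Prod>j\<in>{l<..N}. qbr (int j - int i)) \<noteq> 0" "(\<Prod>v = 1..\<mu> i. qbr (int v - int i + int l)) \<noteq> 0"
        using i by auto
      ultimately show "(\<Prod>j\<in>{l<..N}. qbr (int (\<mu> i) - int (\<mu> j) + int j - int i) / qbr (int j - int i)) =
         (\<Prod>v = 1..\<mu> i. qbr (int v - int i + int N) / qbr (int v - int i + int l))"
        using prod.shift_window[OF N, of qbr "\<mu> i" i] by (simp add: prod_dividef frac_eq_eq mult.commute)
    qed simp
    also have "qh powi (- int N * int (part_size \<mu>)) = (\<Prod>i = 1..l. \<Prod>v = 1..\<mu> i. qh powi (- int N))"
      unfolding part_size_def l_def
      by (simp add: prod_qh_powi sum_distrib_left mult.commute power_int_power' flip: power_sum)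
    also have "(\<Prod>i = 1..l. \<Prod>v = 1..\<mu> i. qh powi (- int N)) *
      (R * (\<Prod>i = 1..l. \<Prod>v = 1..\<mu> i. qbr (int v - int i + int N) / qbr (int v - int i + int l))) = 
      R * (\<Prod>i = 1..l. \<Prod>v = 1..\<mu> i. qh powi (- int N) * (qbr (int v - int i + int N) / qbr (int v - int i + int l)))"
      by (simp only: prod.distrib mult_ac)
    also have "\<dots> = g ?t"
    proof -
      have "qh powi (- int N) * qbr (int v - int i + int N) = qh powi (int v - int i) - ?t * qh powi (int i - int v)" for v i
        unfolding qbr_def right_diff_distrib qh_powi_add[symmetric] by simp
      then show ?thesis unfolding g_def by (simp only: times_divide_eq_right)
    qed
    finally show "schur \<mu> (psum_trunc empty_part ?t) = g ?t" .
  next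
    show "poly_fun (\<lambda>t. schur \<mu> (psum_trunc empty_part t))"
      by (intro poly_fun_schur poly_fun_psum_trunc)
    show "poly_fun g" unfolding g_def
      by (intro poly_fun_mult poly_fun_prod poly_fun_divide poly_fun_diff poly_fun_const poly_fun_id)
  qed
  also have "schur \<mu> (psum_trunc empty_part 0) = schur \<mu> (psum_rho empty_part)"
    by (rule schur_cong) (rule psum_trunc_0)
  also have "g 0 = W1 \<mu>"
  proof -
    have "(\<Prod>i = 1..l. \<Prod>v = 1..\<mu> i. qh powi (int v - int i)) = qh powi (kappa \<mu> div 2)"
      by (simp add: kappa_content_sum content_sum_def l_def prod_qh_powi)
    moreover have "g 0 = R * ((\<Prod>i = 1..l. \<Prod>v = 1..\<mu> i. qh powi (int v - int i)) *
        (\<Prod>i = 1..l. \<Prod>v = 1..\<mu> i. 1 / qbr (int v - int i + int l)))"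
      unfolding g_def prod.distrib[symmetric] by simp
    ultimately show ?thesis
      unfolding W1_def R_def l_def by (simp only: mult_ac)
  qed
  finally show ?thesis ..
qed

lemma W2_commute:
  assumes "\<mu> \<in> partitions" "\<nu> \<in> partitions"
  shows "W2 \<mu> \<nu> = W2 \<nu> \<mu>"
  unfolding W2_def using assms by (simp add: W1_eq_schur schur_rho_symmetric)

section \<open>Contents and the exponents of the hyperbolic sines\<close>

lemma content_sum_extend:
  assumes "\<mu> \<in> partitions" "plen \<mu> \<le> N"
  shows "content_sum \<mu> \<phi> = (\<Sum>i = 1..N. \<Sum>v = 1..\<mu> i. \<phi> (int v - int i))"
  unfolding content_sum_def using assms part_eq_0[OF assms(1)] by (intro sum.mono_neutral_left) auto

lemma content_sum_cong:
  assumes "\<mu> \<in> partitions"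
    and "\<And>c. 1 - int (plen \<mu>) \<le> c \<Longrightarrow> c \<le> int (part_size \<mu>) \<Longrightarrow> \<phi> c = \<psi> c"
  shows "content_sum \<mu> \<phi> = content_sum \<mu> \<psi>"
  unfolding content_sum_def
proof (intro sum.cong refl)
  fix i v assume "i \<in> {1..plen \<mu>}" "v \<in> {1..\<mu> i}"
  then show "\<phi> (int v - int i) = \<psi> (int v - int i)"
    using part_le_part_size[OF assms(1), of i] by (intro assms(2)) auto
qed

lemma content_sum_add: "content_sum \<mu> (\<lambda>c. \<phi> c + \<psi> c) = content_sum \<mu> \<phi> + content_sum \<mu> \<psi>"
  by (simp add: content_sum_def sum.distrib)

lemma content_sum_diff:
  fixes \<phi> \<psi> :: "int \<Rightarrow> 'a::ab_group_add"
  shows "content_sum \<mu> (\<lambda>c. \<phi> c - \<psi> c) = content_sum \<mu> \<phi> - content_sum \<mu> \<psi>"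
  by (simp add: content_sum_def sum_subtractf)

lemma content_sum_mult:
  fixes \<phi> :: "int \<Rightarrow> 'a::semiring_0"
  shows "content_sum \<mu> (\<lambda>c. a * \<phi> c) = a * content_sum \<mu> \<phi>"
  by (simp add: content_sum_def sum_distrib_left)

lemma content_sum_zero: "content_sum \<mu> (\<lambda>c. 0) = 0"
  by (simp add: content_sum_def)

lemma content_sum_sum: "content_sum \<mu> (\<lambda>c. \<Sum>x\<in>A. f x c) = (\<Sum>x\<in>A. content_sum \<mu> (f x))"
  by (induction A rule: infinite_finite_induct) (auto simp: content_sum_zero content_sum_add)

lemma content_sum_swap:
  "content_sum \<mu> (\<lambda>c. content_sum \<alpha> (\<lambda>d. f c d)) = content_sum \<alpha> (\<lambda>d. content_sum \<mu> (\<lambda>c. f c d))"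
  unfolding content_sum_def[of \<alpha>] by (simp add: content_sum_sum)

lemma content_sum_of_int: "of_int (content_sum \<mu> \<phi>) = content_sum \<mu> (\<lambda>c. of_int (\<phi> c))"
  by (simp add: content_sum_def)

lemma le_ptrans_iff:
  assumes "\<mu> \<in> partitions" "i \<ge> 1" "v \<ge> 1"
  shows "v \<le> ptrans \<mu> i \<longleftrightarrow> i \<le> \<mu> v"
proof -
  let ?S = "{j. j \<ge> 1 \<and> \<mu> j \<ge> i}"
  have fin: "finite ?S"
    by (rule finite_subset[of _ "{1..plen \<mu>}"])
      (use part_support[OF assms(1)] assms(2) in auto)
  have down: "k \<in> ?S" if "j \<in> ?S" "1 \<le> k" "k \<le> j" for j k
    using part_antimono[OF assms(1) that(2,3)] that by auto
  show ?thesis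
  proof
    assume "i \<le> \<mu> v"
    then have "{1..v} \<subseteq> ?S" using down[of v] assms by auto
    from card_mono[OF fin this] show "v \<le> ptrans \<mu> i" using assms by (simp add: ptrans_def)
  next
    assume v: "v \<le> ptrans \<mu> i"
    show "i \<le> \<mu> v"
    proof (rule ccontr)
      assume "\<not> i \<le> \<mu> v"
      then have "?S \<subseteq> {1..<v}" using down[of _ v] assms by (auto simp: not_le) (metis leI)
      from card_mono[OF _ this] show False using v assms by (simp add: ptrans_def)
    qed
  qed
qed

lemma ptrans_in_partitions:
  assumes "\<mu> \<in> partitions" shows "ptrans \<mu> \<in> partitions"
proof -
  have "ptrans \<mu> (Suc i) \<le> ptrans \<mu> i" if "i \<ge> 1" for i
  proof (cases "ptrans \<mu> (Suc i) = 0")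
    case False
    then show ?thesis
      using le_ptrans_iff[OF assms, of "Suc i" "ptrans \<mu> (Suc i)"] le_ptrans_iff[OF assms that, of "ptrans \<mu> (Suc i)"] by simp
  qed simp
  moreover have "{i. ptrans \<mu> i \<noteq> 0} \<subseteq> {..\<mu> 1}"
  proof (rule subsetI)
    fix i assume "i \<in> {i. ptrans \<mu> i \<noteq> 0}"
    then have "1 \<le> ptrans \<mu> i" "1 \<le> i" by (auto simp: ptrans_def split: if_splits)
    then show "i \<in> {..\<mu> 1}" using le_ptrans_iff[OF assms, of i 1] by simp
  qed
  moreover have "ptrans \<mu> 0 = 0" by (simp add: ptrans_def)
  ultimately show ?thesis
    by (auto simp: partitions_def intro: finite_subset)
qed

lemma content_sum_ptrans:
  assumes "\<mu> \<in> partitions"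
  shows "content_sum (ptrans \<mu>) \<phi> = content_sum \<mu> (\<lambda>c. \<phi> (- c))"
proof -
  have *: "content_sum \<nu> \<psi> = (\<Sum>(i, v) | 1 \<le> i \<and> 1 \<le> v \<and> v \<le> \<nu> i. \<psi> (int v - int i))"
    if "\<nu> \<in> partitions" for \<nu> and \<psi> :: "int \<Rightarrow> 'a"
  proof -
    have "(SIGMA i:{1..plen \<nu>}. {1..\<nu> i}) = {(i, v). 1 \<le> i \<and> 1 \<le> v \<and> v \<le> \<nu> i}"
      using part_eq_0[OF that] by (force simp: not_le[symmetric])
    moreover have "content_sum \<nu> \<psi> = (\<Sum>(i, v)\<in>(SIGMA i:{1..plen \<nu>}. {1..\<nu> i}). \<psi> (int v - int i))"
      unfolding content_sum_def by (rule sum.Sigma) auto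
    ultimately show ?thesis by simp
  qed
  show ?thesis
    unfolding *[OF assms] *[OF ptrans_in_partitions[OF assms]]
    by (rule sum.reindex_bij_witness[of _ prod.swap prod.swap]) (auto simp: le_ptrans_iff[OF assms])
qed

lemma part_size_ptrans: "\<mu> \<in> partitions \<Longrightarrow> part_size (ptrans \<mu>) = part_size \<mu>"
  by (simp add: part_size_content_sum content_sum_ptrans)

lemma kappa_ptrans: "\<mu> \<in> partitions \<Longrightarrow> kappa (ptrans \<mu>) = - kappa \<mu>"
  using content_sum_mult[of \<mu> "-1" "\<lambda>c. c :: int"] by (simp add: kappa_content_sum content_sum_ptrans)

lemma row_telescope:
  fixes \<psi> :: "int \<Rightarrow> 'a::ab_group_add"
  assumes "\<mu> \<in> partitions" "plen \<mu> \<le> N"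
  shows "(\<Sum>i = 1..N. \<psi> (int (\<mu> i) - int i) - \<psi> (- int i)) = content_sum \<mu> (\<lambda>c. \<psi> c - \<psi> (c - 1))"
proof -
  have "(\<Sum>v = 1..a. \<psi> (int v - i) - \<psi> (int v - i - 1)) = \<psi> (int a - i) - \<psi> (- i)" for a i
    by (induction a) (auto simp: algebra_simps)
  then show ?thesis by (simp add: content_sum_extend[OF assms])
qed

lemma int_telescope:
  fixes \<phi> :: "int \<Rightarrow> 'a::ab_group_add"
  shows "(\<Sum>j = 1..N. \<phi> (c + int j) - \<phi> (c - 1 + int j)) = \<phi> (c + int N) - \<phi> c"
  by (induction N) (auto simp: algebra_simps)

text \<open>
  For \<open>\<phi> k = w\<^sup>k\<close> this is \<open>- (w - 2 + 1/w) C\<^sub>\<alpha>(w) C\<^sub>\<mu>(1/w) - C\<^sub>\<alpha>(w) - C\<^sub>\<mu>(1/w)\<close> with the content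
  polynomials \<open>C\<close>.  With a general \<open>\<phi>\<close> the same formula serves to extract coefficients and to evaluate.
\<close>

definition pair_functional :: "(nat \<Rightarrow> nat) \<Rightarrow> (nat \<Rightarrow> nat) \<Rightarrow> (int \<Rightarrow> 'a::comm_ring_1) \<Rightarrow> 'a" where
  "pair_functional \<alpha> \<mu> \<phi> =
     content_sum \<alpha> (\<lambda>c. content_sum \<mu> (\<lambda>d. 2 * \<phi> (c - d) - \<phi> (c - d - 1) - \<phi> (c - d + 1)))
     - content_sum \<alpha> \<phi> - content_sum \<mu> (\<lambda>d. \<phi> (- d))"

text \<open>
  Telescoping in \<open>i\<close> along the rows of \<open>\<alpha>\<close> and in \<open>j\<close> along the rows of \<open>\<mu>\<close>.  The last two terms are the
  boundary contributions of the truncation at \<open>N\<close>.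
\<close>

lemma double_sum_eq_pair_functional:
  fixes \<phi> :: "int \<Rightarrow> 'a::comm_ring_1"
  assumes "\<alpha> \<in> partitions" "plen \<alpha> \<le> N" "\<mu> \<in> partitions" "plen \<mu> \<le> N"
  shows "(\<Sum>i = 1..N. \<Sum>j = 1..N. \<phi> (int (\<alpha> i) - int (\<mu> j) + int j - int i) - \<phi> (int j - int i)) =
    pair_functional \<alpha> \<mu> \<phi> + content_sum \<alpha> (\<lambda>c. \<phi> (c + int N)) + content_sum \<mu> (\<lambda>d. \<phi> (- d - int N))"
proof -
  have col: "(\<Sum>j = 1..N. \<chi> (int j - int (\<mu> j)) - \<chi> (int j)) = content_sum \<mu> (\<lambda>d. \<chi> (- d) - \<chi> (1 - d))" 
    for \<chi> :: "int \<Rightarrow> 'a"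
    using row_telescope[OF assms(3,4), of "\<lambda>k. \<chi> (- k)"] by simp
  have "(\<Sum>i = 1..N. \<Sum>j = 1..N. \<phi> (int (\<alpha> i) - int (\<mu> j) + int j - int i) - \<phi> (int j - int i)) =
    (\<Sum>j = 1..N. \<Sum>i = 1..N. \<phi> (int (\<alpha> i) - int i + (int j - int (\<mu> j))) - \<phi> (- int i + (int j - int (\<mu> j)))) +
    (\<Sum>i = 1..N. \<Sum>j = 1..N. \<phi> (int j - int (\<mu> j) - int i) - \<phi> (int j - int i))"
    by (subst (2) sum.swap) (simp add: algebra_simps flip: sum.distrib)
  also have "(\<Sum>j = 1..N. \<Sum>i = 1..N. \<phi> (int (\<alpha> i) - int i + (int j - int (\<mu> j))) - \<phi> (- int i + (int j - int (\<mu> j)))) = 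
     (\<Sum>j = 1..N. content_sum \<alpha> (\<lambda>c. \<phi> (c + (int j - int (\<mu> j))) - \<phi> (c - 1 + (int j - int (\<mu> j)))))"
    by (intro sum.cong refl row_telescope[OF assms(1,2)])
  also have "\<dots> = content_sum \<alpha> (\<lambda>c. \<Sum>j = 1..N. \<phi> (c + (int j - int (\<mu> j))) - \<phi> (c - 1 + (int j - int (\<mu> j))))"
    by (rule content_sum_sum[symmetric])
  also have "\<dots> = content_sum \<alpha> (\<lambda>c. (\<phi> (c + int N) - \<phi> c) + 
      content_sum \<mu> (\<lambda>d. 2 * \<phi> (c - d) - \<phi> (c - d - 1) - \<phi> (c - d + 1)))"
  proof (rule arg_cong[where f = "content_sum \<alpha>"], rule ext)
    fix c
    \<comment> \<open>The difference left by the telescoping in \<open>i\<close>, to be telescoped again in \<open>j\<close>.\<close>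
    let ?\<chi> = "\<lambda>k. \<phi> (c + k) - \<phi> (c - 1 + k)"
    have "(\<Sum>j = 1..N. ?\<chi> (int j - int (\<mu> j))) = (\<Sum>j = 1..N. ?\<chi> (int j)) + (\<Sum>j = 1..N. ?\<chi> (int j - int (\<mu> j)) - ?\<chi> (int j))"
      by (simp flip: sum.distrib)
    also have "\<dots> = (\<phi> (c + int N) - \<phi> c) + content_sum \<mu> (\<lambda>d. ?\<chi> (- d) - ?\<chi> (1 - d))"
      unfolding int_telescope by (simp only: col[of ?\<chi>])
    also have "(\<lambda>d. ?\<chi> (- d) - ?\<chi> (1 - d)) = (\<lambda>d. 2 * \<phi> (c - d) - \<phi> (c - d - 1) - \<phi> (c - d + 1))"
      by (simp add: algebra_simps)
    finally show "(\<Sum>j = 1..N. ?\<chi> (int j - int (\<mu> j))) = (\<phi> (c + int N) - \<phi> c) + 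
      content_sum \<mu> (\<lambda>d. 2 * \<phi> (c - d) - \<phi> (c - d - 1) - \<phi> (c - d + 1))" .
  qed
  also have "(\<Sum>i = 1..N. \<Sum>j = 1..N. \<phi> (int j - int (\<mu> j) - int i) - \<phi> (int j - int i)) =
     (\<Sum>i = 1..N. content_sum \<mu> (\<lambda>d. \<phi> (- d - int i) - \<phi> (1 - d - int i)))"
    by (intro sum.cong refl) (rule col[where \<chi> = "\<lambda>k. \<phi> (k - int i)" for i])
  also have "\<dots> = content_sum \<mu> (\<lambda>d. \<Sum>i = 1..N. \<phi> (- d - int i) - \<phi> (1 - d - int i))"
    by (rule content_sum_sum[symmetric])
  also have "\<dots> = content_sum \<mu> (\<lambda>d. \<phi> (- d - int N) - \<phi> (- d))"
  proof (rule arg_cong[where f = "content_sum \<mu>"], rule ext)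
    fix d
    show "(\<Sum>i = 1..N. \<phi> (- d - int i) - \<phi> (1 - d - int i)) = \<phi> (- d - int N) - \<phi> (- d)"
      using int_telescope[of "\<lambda>k. \<phi> (- k)" d N] by (simp add: algebra_simps)
  qed
  finally show ?thesis
    by (simp add: pair_functional_def content_sum_add content_sum_diff)
qed

lemma pair_functional_cong:
  assumes "\<alpha> \<in> partitions" "\<mu> \<in> partitions"
    and "\<And>k. \<bar>k\<bar> \<le> int (plen \<alpha> + plen \<mu> + part_size \<alpha> + part_size \<mu> + 1) \<Longrightarrow> \<phi> k = \<psi> k"
  shows "pair_functional \<alpha> \<mu> \<phi> = pair_functional \<alpha> \<mu> \<psi>"
  unfolding pair_functional_def
  by (intro arg_cong2[where f = "(-)"] arg_cong2[where f = "(*)"] content_sum_cong assms(1,2) refl assms(3)) auto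

lemma pair_functional_mult: "pair_functional \<alpha> \<mu> (\<lambda>k. \<phi> k * a) = pair_functional \<alpha> \<mu> \<phi> * a"
proof -
  have "pair_functional \<alpha> \<mu> (\<lambda>k. a * \<phi> k) = a * pair_functional \<alpha> \<mu> \<phi>"
    unfolding pair_functional_def right_diff_distrib content_sum_mult[symmetric] by (simp add: mult_ac)
  then show ?thesis by (simp add: mult.commute)
qed

lemma pair_functional_zero: "pair_functional \<alpha> \<mu> (\<lambda>k. 0) = 0"
  by (simp add: pair_functional_def content_sum_zero)

lemma pair_functional_add: 
  "pair_functional \<alpha> \<mu> (\<lambda>k. \<phi> k + \<psi> k) = pair_functional \<alpha> \<mu> \<phi> + pair_functional \<alpha> \<mu> \<psi>"
  by (simp add: pair_functional_def content_sum_add content_sum_diff content_sum_mult distrib_left)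

lemma pair_functional_sum:
  "pair_functional \<alpha> \<mu> (\<lambda>k. \<Sum>x\<in>A. f x k) = (\<Sum>x\<in>A. pair_functional \<alpha> \<mu> (f x))"
  by (induction A rule: infinite_finite_induct) (auto simp: pair_functional_zero pair_functional_add)

lemma pair_functional_of_int: "of_int (pair_functional \<alpha> \<mu> \<phi>) = pair_functional \<alpha> \<mu> (\<lambda>k. of_int (\<phi> k))"
  by (simp add: pair_functional_def content_sum_of_int)

text \<open>
  Transposition negates contents, and the exchange of the two partitions restores the differences \<open>c - d\<close>.
\<close>

lemma pair_functional_ptrans:
  assumes "\<alpha> \<in> partitions" "\<mu> \<in> partitions"
  shows "pair_functional (ptrans \<mu>) (ptrans \<alpha>) \<phi> = pair_functional \<alpha> \<mu> \<phi>"
  unfolding pair_functional_def content_sum_ptrans[OF assms(1)] content_sum_ptrans[OF assms(2)]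
  by (subst content_sum_swap) (simp add: algebra_simps)

text \<open>
  For \<open>N\<close> large compared with \<open>|m|\<close> the truncated double sum contains all contributing pairs, while its
  boundary contributions are concentrated at exponents of absolute value greater than \<open>|m|\<close>.
\<close>

lemma ecoef_eq_pair_functional:
  assumes "\<alpha> \<in> partitions" "\<mu> \<in> partitions"
  shows "ecoef \<alpha> \<mu> m = pair_functional \<alpha> \<mu> (\<lambda>k. of_bool (k = m))"
proof -
  define N where "N = plen \<alpha> + plen \<mu> + nat \<bar>m\<bar>"
  have N: "plen \<alpha> \<le> N" "plen \<mu> \<le> N" by (auto simp: N_def)
  have bound: "i \<le> N \<and> j \<le> N" if "1 \<le> i" "1 \<le> j" "ecoef_term \<alpha> \<mu> m i j \<noteq> 0" for i j
    using that part_eq_0[OF assms(1), of i] part_eq_0[OF assms(2), of j]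
    by (cases "i \<le> plen \<alpha>"; cases "j \<le> plen \<mu>") (auto simp: ecoef_term_def N_def of_bool_def split: if_splits)
  have "ecoef \<alpha> \<mu> m = (\<Sum>(i, j)\<in>{1..N} \<times> {1..N}. ecoef_term \<alpha> \<mu> m i j)"
    unfolding ecoef_def using bound by (intro sum.mono_neutral_left) auto
  also have "\<dots> = (\<Sum>i = 1..N. \<Sum>j = 1..N. ecoef_term \<alpha> \<mu> m i j)"
    by (rule sum.cartesian_product[symmetric])
  also have "\<dots> = pair_functional \<alpha> \<mu> (\<lambda>k. of_bool (k = m)) + content_sum \<alpha> (\<lambda>c. of_bool (c + int N = m)) 
      + content_sum \<mu> (\<lambda>d. of_bool (- d - int N = m))"
    unfolding ecoef_term_def by (rule double_sum_eq_pair_functional[OF assms(1) N(1) assms(2) N(2)])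
  also have "content_sum \<alpha> (\<lambda>c. of_bool (c + int N = m)) = content_sum \<alpha> (\<lambda>c. 0 :: int)"
    by (rule content_sum_cong[OF assms(1)]) (auto simp: N_def)
  also have "content_sum \<mu> (\<lambda>d. of_bool (- d - int N = m)) = content_sum \<mu> (\<lambda>c. 0 :: int)"
    by (rule content_sum_cong[OF assms(2)]) (auto simp: N_def)
  finally show ?thesis by (simp add: content_sum_zero)
qed

text \<open>
  This evaluates the sum of the exponents, their first moment, and the Laurent polynomial with coefficients
  \<open>e\<^sub>m\<close>.
\<close>

lemma ecoef_sum:
  assumes "\<alpha> \<in> partitions" "\<mu> \<in> partitions"
  shows "finite {m. ecoef \<alpha> \<mu> m \<noteq> 0}"
    and "(\<Sum>m | ecoef \<alpha> \<mu> m \<noteq> 0. of_int (ecoef \<alpha> \<mu> m) * \<psi> m) = pair_functional \<alpha> \<mu> \<psi>"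
proof -
  define B where "B = int (plen \<alpha> + plen \<mu> + part_size \<alpha> + part_size \<mu> + 1)"
  have out: "ecoef \<alpha> \<mu> m = 0" if "m \<notin> {-B..B}" for m
  proof -
    have "pair_functional \<alpha> \<mu> (\<lambda>k. of_bool (k = m)) = pair_functional \<alpha> \<mu> (\<lambda>k. 0 :: int)"
      using that by (intro pair_functional_cong assms) (auto simp: B_def)
    then show ?thesis by (simp add: ecoef_eq_pair_functional[OF assms] pair_functional_zero)
  qed
  then have sub: "{m. ecoef \<alpha> \<mu> m \<noteq> 0} \<subseteq> {-B..B}" by blast
  then show "finite {m. ecoef \<alpha> \<mu> m \<noteq> 0}" by (rule finite_subset) simp
  have "(\<Sum>m | ecoef \<alpha> \<mu> m \<noteq> 0. of_int (ecoef \<alpha> \<mu> m) * \<psi> m) = (\<Sum>m\<in>{-B..B}. of_int (ecoef \<alpha> \<mu> m) * \<psi> m)"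
    using sub by (intro sum.mono_neutral_left) auto
  also have "\<dots> = (\<Sum>m\<in>{-B..B}. pair_functional \<alpha> \<mu> (\<lambda>k. of_bool (k = m) * \<psi> m))"
    by (simp add: ecoef_eq_pair_functional[OF assms] pair_functional_of_int pair_functional_mult)
  also have "\<dots> = pair_functional \<alpha> \<mu> (\<lambda>k. \<Sum>m\<in>{-B..B}. of_bool (k = m) * \<psi> m)"
    by (rule pair_functional_sum[symmetric])
  also have "\<dots> = pair_functional \<alpha> \<mu> \<psi>"
  proof (rule pair_functional_cong[OF assms])
    fix k assume "\<bar>k\<bar> \<le> int (plen \<alpha> + plen \<mu> + part_size \<alpha> + part_size \<mu> + 1)"
    then have "k \<in> {-B..B}" by (auto simp: B_def)
    then show "(\<Sum>m\<in>{-B..B}. of_bool (k = m) * \<psi> m) = \<psi> k"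
      by (simp add: of_bool_def if_distrib[of "\<lambda>x. x * _"] cong: if_cong)
  qed
  finally show "(\<Sum>m | ecoef \<alpha> \<mu> m \<noteq> 0. of_int (ecoef \<alpha> \<mu> m) * \<psi> m) = pair_functional \<alpha> \<mu> \<psi>" .
qed

text \<open>
  For \<open>i \<ge> j\<close> both \<open>\<mu>\<^sub>i - \<mu>\<^sub>j + j - i\<close> and \<open>j - i\<close> are at most 0, so only pairs \<open>i < j\<close> contribute to \<open>e\<^sub>m(\<mu>, \<mu>)\<close>.
\<close>

lemma ecoef'_eq_ecoef:
  assumes "\<mu> \<in> partitions" "m \<ge> 1"
  shows "ecoef' \<mu> m = ecoef \<mu> \<mu> m"
proof -
  have "i < j" if "1 \<le> i" "1 \<le> j" "ecoef_term \<mu> \<mu> m i j \<noteq> 0" for i j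
  proof (rule ccontr)
    assume "\<not> i < j"
    then have "int (\<mu> i) - int (\<mu> j) + int j - int i \<le> 0" "int j - int i \<le> 0"
      using part_antimono[OF assms(1), of j i] that by auto
    with that(3) assms(2) show False by (simp add: ecoef_term_def)
  qed
  then have "{(i, j). 1 \<le> i \<and> 1 \<le> j \<and> ecoef_term \<mu> \<mu> m i j \<noteq> 0} = {(i, j). 1 \<le> i \<and> i < j \<and> ecoef_term \<mu> \<mu> m i j \<noteq> 0}"
    by auto
  then show ?thesis unfolding ecoef_def ecoef'_def by simp
qed

lemma sinh_prod_self_ptrans:
  assumes "\<mu> \<in> partitions"
  shows "sinh_prod_self (ptrans \<mu>) = sinh_prod_self \<mu>"
proof -
  have "ecoef' (ptrans \<mu>) m = ecoef' \<mu> m" if "m \<ge> 1" for m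
    using that assms ptrans_in_partitions[OF assms]
    by (simp add: ecoef'_eq_ecoef ecoef_eq_pair_functional pair_functional_ptrans)
  then show ?thesis
    unfolding sinh_prod_self_def by (intro arg_cong[where f = "\<lambda>x. x ^ 2"] prod.cong) auto
qed

text \<open>
  The exponents with which the brackets \<open>[m]\<close> occur in the product formula of \<open>W\<^sub>\<mu>\<close>.
\<close>

lemma ecoef'_decomposition:
  assumes mu: "\<mu> \<in> partitions" and m: "m \<ge> 1"
  shows "ecoef' \<mu> m = (\<Sum>(i, j) | 1 \<le> i \<and> i < j \<and> j \<le> plen \<mu>. of_bool (int (\<mu> i) - int (\<mu> j) + int j - int i = m))
     - (\<Sum>(i, j) | 1 \<le> i \<and> i < j \<and> j \<le> plen \<mu>. of_bool (int j - int i = m))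
     - (\<Sum>(i, v)\<in>(SIGMA i:{1..plen \<mu>}. {1..\<mu> i}). of_bool (int v - int i + int (plen \<mu>) = m))"
proof -
  define l N where "l = plen \<mu>" and "N = plen \<mu> + nat m"
  let ?\<delta> = "\<lambda>k. of_bool (k = m) :: int"
  have lN: "l \<le> N" by (simp add: l_def N_def)
  have bound: "j \<le> N" if "1 \<le> i" "i < j" "ecoef_term \<mu> \<mu> m i j \<noteq> 0" for i j
    using that part_eq_0[OF mu, of i] part_eq_0[OF mu, of j]
    by (cases "i \<le> plen \<mu>"; cases "j \<le> plen \<mu>") (auto simp: ecoef_term_def N_def of_bool_def split: if_splits)
  have "ecoef' \<mu> m = (\<Sum>(i, j) | 1 \<le> i \<and> i < j \<and> j \<le> N. ecoef_term \<mu> \<mu> m i j)"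
    unfolding ecoef'_def using bound by (intro sum.mono_neutral_left finite_pairs) auto
  also have "\<dots> = (\<Sum>(i, j) | 1 \<le> i \<and> i < j \<and> j \<le> l. ecoef_term \<mu> \<mu> m i j) + (\<Sum>i = 1..l. \<Sum>j\<in>{l<..N}. ecoef_term \<mu> \<mu> m i j)"
    using part_eq_0[OF mu] by (intro sum.pairs_split lN) (simp add: ecoef_term_def l_def)
  also have "(\<Sum>i = 1..l. \<Sum>j\<in>{l<..N}. ecoef_term \<mu> \<mu> m i j) = (\<Sum>i = 1..l. - (\<Sum>v = 1..\<mu> i. ?\<delta> (int v - int i + int l)))"
  proof (rule sum.cong)
    fix i assume i: "i \<in> {1..l}"
    have "(\<Sum>j\<in>{l<..N}. ecoef_term \<mu> \<mu> m i j) = (\<Sum>j\<in>{l<..N}. ?\<delta> (int (\<mu> i) + int j - int i) - ?\<delta> (int j - int i))"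
      using part_eq_0[OF mu] by (intro sum.cong) (auto simp: ecoef_term_def l_def)
    also have "\<dots> = (\<Sum>v = 1..\<mu> i. ?\<delta> (int v - int i + int N)) - (\<Sum>v = 1..\<mu> i. ?\<delta> (int v - int i + int l))"
      using sum.shift_window[OF lN, of ?\<delta> "\<mu> i" i] by (simp add: sum_subtractf)
    also have "(\<Sum>v = 1..\<mu> i. ?\<delta> (int v - int i + int N)) = 0"
      using i m by (intro sum.neutral) (auto simp: N_def l_def)
    finally show "(\<Sum>j\<in>{l<..N}. ecoef_term \<mu> \<mu> m i j) = - (\<Sum>v = 1..\<mu> i. ?\<delta> (int v - int i + int l))" by simp
  qed simp
  also have "\<dots> = - (\<Sum>(i, v)\<in>(SIGMA i:{1..plen \<mu>}. {1..\<mu> i}). ?\<delta> (int v - int i + int l))"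
    unfolding sum_negf l_def by (intro arg_cong[where f = uminus] sum.Sigma) auto
  finally show ?thesis
    by (simp add: ecoef_term_def case_prod_unfold sum_subtractf l_def)
qed

lemma prod_powi_count:
  fixes f :: "int \<Rightarrow> 'a::field"
  assumes "finite A" "finite M" "a ` A \<subseteq> M"
  shows "(\<Prod>m\<in>M. f m powi (\<Sum>x\<in>A. of_bool (a x = m))) = (\<Prod>x\<in>A. f (a x))"
proof -
  have "f m powi (\<Sum>x\<in>A. of_bool (a x = m)) = (\<Prod>x | x \<in> A \<and> a x = m. f (a x))" for m
  proof -
    have "(\<Sum>x\<in>A. of_bool (a x = m)) = int (card {x \<in> A. a x = m})"
      using assms(1) by (simp add: of_bool_def sum.If_cases Int_def)
    then show ?thesis by simp
  qed
  then show ?thesis using sum.group[of A M a] prod.group[OF assms, of "\<lambda>x. f (a x)"] by simp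
qed

lemma prod_powi_ecoef':
  fixes f :: "int \<Rightarrow> 'a::field"
  assumes mu: "\<mu> \<in> partitions" and f: "\<And>m. m \<ge> 1 \<Longrightarrow> f m \<noteq> 0"
  shows "(\<Prod>m | m \<ge> 1 \<and> ecoef' \<mu> m \<noteq> 0. f m powi ecoef' \<mu> m) =
    (\<Prod>(i, j) | 1 \<le> i \<and> i < j \<and> j \<le> plen \<mu>. f (int (\<mu> i) - int (\<mu> j) + int j - int i) / f (int j - int i))
    * (\<Prod>i=1..plen \<mu>. \<Prod>v=1..\<mu> i. 1 / f (int v - int i + int (plen \<mu>)))"
proof -
  let ?P = "{(i, j). 1 \<le> i \<and> i < j \<and> j \<le> plen \<mu>}" and ?S = "SIGMA i:{1..plen \<mu>}. {1..\<mu> i}"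
  let ?a = "\<lambda>(i, j). int (\<mu> i) - int (\<mu> j) + int j - int i"
  let ?b = "\<lambda>(i, j). int j - int i"
  let ?c = "\<lambda>(i, v). int v - int i + int (plen \<mu>)"
  let ?M = "?a ` ?P \<union> ?b ` ?P \<union> ?c ` ?S"
  have finP: "finite ?P" by (rule finite_pairs)
  have finS: "finite ?S" by auto
  have fin: "finite ?M" using finP finS by blast
  have ge: "m \<ge> 1" if "m \<in> ?M" for m
  proof -
    have "?a x \<ge> 1" if "x \<in> ?P" for x
      using part_antimono[OF mu, of "fst x" "snd x"] that by auto
    moreover have "?b x \<ge> 1" if "x \<in> ?P" for x using that by auto
    moreover have "?c x \<ge> 1" if "x \<in> ?S" for x using that by auto
    ultimately show ?thesis using that by blast
  qed
  have e: "ecoef' \<mu> m = (\<Sum>x\<in>?P. of_bool (?a x = m)) - (\<Sum>x\<in>?P. of_bool (?b x = m)) - (\<Sum>x\<in>?S. of_bool (?c x = m))" 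
    if "m \<ge> 1" for m
    using ecoef'_decomposition[OF mu that] by (simp add: case_prod_unfold)
  have out: "ecoef' \<mu> m = 0" if "m \<ge> 1" "m \<notin> ?M" for m
  proof -
    have "(\<Sum>x\<in>?P. of_bool (?a x = m)) = (0::int)" "(\<Sum>x\<in>?P. of_bool (?b x = m)) = (0::int)" "(\<Sum>x\<in>?S. of_bool (?c x = m)) = (0::int)"
      using that(2) by (intro sum.neutral ballI; auto)+
    then show ?thesis unfolding e[OF that(1)] by simp
  qed
  have "(\<Prod>m | m \<ge> 1 \<and> ecoef' \<mu> m \<noteq> 0. f m powi ecoef' \<mu> m) = (\<Prod>m\<in>?M. f m powi ecoef' \<mu> m)"
    using out ge by (intro prod.mono_neutral_left fin) auto
  also have "\<dots> = (\<Prod>m\<in>?M. f m powi (\<Sum>x\<in>?P. of_bool (?a x = m)) / f m powi (\<Sum>x\<in>?P. of_bool (?b x = m)) / f m powi (\<Sum>x\<in>?S. of_bool (?c x = m)))"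
    using ge f by (intro prod.cong refl) (simp only: e power_int_diff simp_thms)
  also have "\<dots> = (\<Prod>x\<in>?P. f (?a x)) / (\<Prod>x\<in>?P. f (?b x)) / (\<Prod>x\<in>?S. f (?c x))"
    unfolding prod_dividef
    by (subst prod_powi_count[OF finP fin] prod_powi_count[OF finS fin], blast)+ (rule refl)
  also have "(\<Prod>x\<in>?S. f (?c x)) = (\<Prod>i=1..plen \<mu>. \<Prod>v=1..\<mu> i. f (int v - int i + int (plen \<mu>)))"
    by (simp add: prod.Sigma case_prod_unfold)
  finally show ?thesis
    by (simp add: case_prod_unfold prod_dividef)
qed

section \<open>The partition function\<close>

lemma psum_rho_content_sum:
  assumes mu: "\<mu> \<in> partitions" and n: "n \<ge> 1"
  shows "psum_rho \<mu> n = (qh powi int n - qh powi (- int n)) * content_sum \<mu> (\<lambda>c. (qh powi (2 * c)) ^ n)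
      + 1 / (qh powi int n - qh powi (- int n))"
proof -
  let ?\<psi> = "\<lambda>k. qh powi (int n * (2 * k + 1))"
  have "(\<Sum>i = 1..plen \<mu>. qh powi (int n * (2 * int (\<mu> i) - 2 * int i + 1)) - qh powi (int n * (- 2 * int i + 1))) =
     (\<Sum>i = 1..plen \<mu>. ?\<psi> (int (\<mu> i) - int i) - ?\<psi> (- int i))"
    by (simp add: algebra_simps)
  also have "\<dots> = content_sum \<mu> (\<lambda>c. ?\<psi> c - ?\<psi> (c - 1))"
    by (rule row_telescope[OF mu order_refl])
  also have "(\<lambda>c. ?\<psi> c - ?\<psi> (c - 1)) = (\<lambda>c. (qh powi int n - qh powi (- int n)) * (qh powi (2 * c)) ^ n)"
  proof
    fix c
    have 1: "int n + 2 * c * int n = int n * (2 * c + 1)" "- int n + 2 * c * int n = int n * (2 * (c - 1) + 1)"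
      by (simp_all add: algebra_simps)
    show "?\<psi> c - ?\<psi> (c - 1) = (qh powi int n - qh powi (- int n)) * (qh powi (2 * c)) ^ n"
      unfolding left_diff_distrib power_int_power' qh_powi_add[symmetric] 1 ..
  qed
  finally show ?thesis unfolding psum_rho_def content_sum_mult by simp
qed

lemma psum_rho_empty: "psum_rho empty_part n = 1 / (qh powi int n - qh powi (- int n))"
  by (simp add: psum_rho_def)

text \<open>
  With \<open>d = q\<^bsup>n/2\<^esup> - q\<^bsup>-n/2\<^esup>\<close> the claim is
  \<open>(d C + 1/d) (d C' + 1/d) = d\<^sup>2 C C' + C + C' + 1/d\<^sup>2\<close>, where \<open>d\<^sup>2 = q\<^sup>n - 2 + q\<^bsup>-n\<^esup>\<close> produces the second
  difference in \<open>pair_functional\<close>.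
\<close>

lemma psum_rho_product:
  assumes mu: "\<mu> \<in> partitions" and la: "\<alpha> \<in> partitions" and n: "n \<ge> 1"
  shows "psum_rho \<mu> n * psum_rho (ptrans \<alpha>) n
      + (\<Sum>m | ecoef \<mu> \<alpha> m \<noteq> 0. of_int (ecoef \<mu> \<alpha> m) * (qh powi (2 * m)) ^ n) =
    psum_rho empty_part n * psum_rho empty_part n"
proof -
  define \<omega> where "\<omega> = (\<lambda>c. (qh powi (2 * c)) ^ n)"
  define z where "z = qh powi int n"
  have z: "z \<noteq> 0" by (simp add: z_def)
  have zi: "qh powi (- int n) = inverse z" unfolding z_def by (rule power_int_minus)
  define C where "C = content_sum \<mu> \<omega>"
  define C' where "C' = content_sum \<alpha> (\<lambda>d. \<omega> (- d))"
  have \<omega>_add: "\<omega> (c + d) = \<omega> c * \<omega> d" for c d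
    by (simp add: \<omega>_def distrib_left qh_powi_add power_mult_distrib)
  have \<omega>1: "\<omega> 1 = z ^ 2" "\<omega> (-1) = inverse z ^ 2"
    unfolding z_def \<omega>_def power_int_minus[symmetric] power_int_power' by (simp_all add: mult.commute)
  have "pair_functional \<mu> \<alpha> \<omega> = content_sum \<mu> (\<lambda>c. content_sum \<alpha> (\<lambda>d. ((2 - z ^ 2 - inverse z ^ 2) * \<omega> c) * \<omega> (- d))) - C - C'"
  proof -
    have "2 * \<omega> (c - d) - \<omega> (c - d - 1) - \<omega> (c - d + 1) = ((2 - z ^ 2 - inverse z ^ 2) * \<omega> c) * \<omega> (- d)" for c d
      using \<omega>_add[of "c + - d" "-1"] \<omega>_add[of "c + - d" 1] \<omega>_add[of c "- d"] by (simp add: \<omega>1 algebra_simps)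
    then show ?thesis by (simp only: pair_functional_def C_def C'_def)
  qed
  also have "content_sum \<mu> (\<lambda>c. content_sum \<alpha> (\<lambda>d. ((2 - z ^ 2 - inverse z ^ 2) * \<omega> c) * \<omega> (- d))) =
     (2 - z ^ 2 - inverse z ^ 2) * (C * C')"
    unfolding content_sum_mult C'_def[symmetric]
    using content_sum_mult[of \<mu> "(2 - z ^ 2 - inverse z ^ 2) * C'" \<omega>] by (simp add: mult_ac C_def)
  finally have pf: "(\<Sum>m | ecoef \<mu> \<alpha> m \<noteq> 0. of_int (ecoef \<mu> \<alpha> m) * \<omega> m) = (2 - z ^ 2 - inverse z ^ 2) * (C * C') - C - C'"
    unfolding ecoef_sum(2)[OF mu la] .
  have p: "psum_rho \<mu> n = (z - inverse z) * C + 1 / (z - inverse z)"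
    unfolding psum_rho_content_sum[OF mu n] zi[symmetric] by (simp only: z_def C_def \<omega>_def)
  have p': "psum_rho (ptrans \<alpha>) n = (z - inverse z) * C' + 1 / (z - inverse z)"
    unfolding psum_rho_content_sum[OF ptrans_in_partitions[OF la] n] zi[symmetric] content_sum_ptrans[OF la]
    by (simp only: z_def C'_def \<omega>_def)
  have p0: "psum_rho empty_part n = 1 / (z - inverse z)"
    unfolding psum_rho_empty zi unfolding z_def ..
  have "z - inverse z \<noteq> 0"
    unfolding zi[symmetric] unfolding z_def right_minus_eq qh_powi_inject using n by simp
  define d where "d = z - inverse z"
  have d: "d \<noteq> 0" "2 - z ^ 2 - inverse z ^ 2 = - (d * d)"
    using \<open>z - inverse z \<noteq> 0\<close> z by (auto simp: d_def power2_eq_square algebra_simps)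
  have "(d * C + 1 / d) * (d * C' + 1 / d) = d * d * (C * C') + C + C' + 1 / d * (1 / d)"
    using d(1) by (simp add: field_simps)
  then show ?thesis
    using pf unfolding p p' p0 d_def[symmetric] d(2) \<omega>_def by simp
qed

text \<open>
  After \<open>W\<^bsub>\<nu>\<alpha>\<^esub>\<close> is replaced by \<open>W\<^bsub>\<alpha>\<nu>\<^esub>\<close>, the summation index \<open>\<nu>\<close> occurs only in Schur functions and the
  Cauchy identity applies.
\<close>

lemma Kser_eq:
  assumes "\<mu> \<in> partitions" "\<alpha> \<in> partitions"
  shows "Kser \<mu> \<alpha> = fps_const (W1 \<mu> * W1 \<alpha>) * complete_fps (\<lambda>n. psum_rho \<mu> n * psum_rho \<alpha> n)"
proof (rule fps_ext)
  fix n
  let ?c = "\<lambda>\<nu>. W2 \<mu> \<nu> * W2 \<nu> \<alpha>"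
  have nth: "fps_nth (fps_X ^ part_size \<nu> * fps_const (?c \<nu>)) n = (if part_size \<nu> = n then ?c \<nu> else 0)" for \<nu>
    by (simp add: fps_X_power_mult_nth)
  have "fps_nth (Kser \<mu> \<alpha>) n = (\<Sum>\<nu> | \<nu> \<in> partitions \<and> (if part_size \<nu> = n then ?c \<nu> else 0) \<noteq> 0. if part_size \<nu> = n then ?c \<nu> else 0)"
    by (simp only: Kser_def fps_family_sum_def nth fps_nth_Abs_fps)
  also have "\<dots> = (\<Sum>\<nu> | \<nu> \<in> partitions \<and> part_size \<nu> = n. ?c \<nu>)"
    using finite_partitions_of_size[of n] by (intro sum.mono_neutral_cong_left) (auto split: if_splits)
  also have "\<dots> = (\<Sum>\<nu> | \<nu> \<in> partitions \<and> part_size \<nu> = n. (W1 \<mu> * W1 \<alpha>) * (schur \<nu> (psum_rho \<mu>) * schur \<nu> (psum_rho \<alpha>)))"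
  proof (rule sum.cong)
    fix \<nu> assume "\<nu> \<in> {\<nu>. \<nu> \<in> partitions \<and> part_size \<nu> = n}"
    then have "W2 \<nu> \<alpha> = W2 \<alpha> \<nu>" using assms(2) by (intro W2_commute) auto
    then show "?c \<nu> = (W1 \<mu> * W1 \<alpha>) * (schur \<nu> (psum_rho \<mu>) * schur \<nu> (psum_rho \<alpha>))"
      by (simp only: W2_def mult_ac)
  qed simp
  also have "\<dots> = (W1 \<mu> * W1 \<alpha>) * fps_nth (complete_fps (\<lambda>n. psum_rho \<mu> n * psum_rho \<alpha> n)) n"
    unfolding sum_distrib_left[symmetric] cauchy_rho[OF assms(2)] ..
  finally show "fps_nth (Kser \<mu> \<alpha>) n = fps_nth (fps_const (W1 \<mu> * W1 \<alpha>) * complete_fps (\<lambda>n. psum_rho \<mu> n * psum_rho \<alpha> n)) n"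
    by simp
qed

definition subst_QF :: "qfun fps \<Rightarrow> cfun" where
  "subst_QF F = fps_to_fls (fps_compose F (fps_X ^ 2))"

lemma subst_QF_mult: "subst_QF (F * G) = subst_QF F * subst_QF G"
  unfolding subst_QF_def by (subst fps_compose_mult_distrib) (simp_all add: fls_times_fps_to_fls)

lemma subst_QF_1: "subst_QF 1 = 1"
  by (simp add: subst_QF_def)

lemma subst_QF_const: "subst_QF (fps_const c) = fls_const c"
  by (simp add: subst_QF_def)

lemma subst_QF_prod: "subst_QF (\<Prod>x\<in>A. F x) = (\<Prod>x\<in>A. subst_QF (F x))"
  by (induction A rule: infinite_finite_induct) (auto simp: subst_QF_1 subst_QF_mult)

lemma subst_QF_linear: "subst_QF (1 - fps_const x * fps_X) = 1 - fls_const x * QF"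
  unfolding subst_QF_def fps_compose_sub_distrib
  by (subst fps_compose_mult_distrib) (simp_all add: fls_times_fps_to_fls fps_to_fls_power QF_def QFh_def)

text \<open>
  A homomorphism from sequences of power sums under addition to the units of a field, so that
  variables may occur with negative multiplicity.
\<close>

definition complete_QF :: "(nat \<Rightarrow> qfun) \<Rightarrow> cfun" where
  "complete_QF p = subst_QF (complete_fps p)"

lemma complete_QF_add: "complete_QF (\<lambda>n. p n + p' n) = complete_QF p * complete_QF p'"
  by (simp add: complete_QF_def complete_fps_add subst_QF_mult)

lemma complete_QF_zero: "complete_QF (\<lambda>n. 0) = 1"
  by (simp add: complete_QF_def complete_fps_zero subst_QF_1)

lemma complete_QF_nonzero: "complete_QF p \<noteq> 0"
  using complete_QF_add[of p "\<lambda>n. - p n"] by (auto simp: complete_QF_zero)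

lemma complete_QF_geometric: "(1 - fls_const x * QF) * complete_QF (\<lambda>n. x ^ n) = 1"
  unfolding complete_QF_def subst_QF_linear[symmetric] subst_QF_mult[symmetric] complete_fps_geometric subst_QF_1 ..

lemma one_minus_QF_nonzero: "1 - fls_const x * QF \<noteq> 0"
  using complete_QF_geometric[of x] by auto

lemma complete_QF_multiple:
  "complete_QF (\<lambda>n. of_int k * x ^ n) = (1 - fls_const x * QF) powi (- k)"
proof -
  let ?u = "1 - fls_const x * QF"
  have inv: "complete_QF (\<lambda>n. x ^ n) = inverse ?u"
    using complete_QF_geometric[of x] by (metis inverse_unique)
  have nat: "complete_QF (\<lambda>n. of_nat j * x ^ n) = inverse ?u ^ j" for j
  proof (induction j)
    case (Suc j)
    have "complete_QF (\<lambda>n. of_nat (Suc j) * x ^ n) = complete_QF (\<lambda>n. x ^ n + of_nat j * x ^ n)"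
      by (simp add: algebra_simps)
    then show ?case by (simp add: complete_QF_add inv Suc)
  qed (simp add: complete_QF_zero)
  show ?thesis
  proof (cases "k \<ge> 0")
    case True
    then show ?thesis using nat[of "nat k"] by (simp add: power_int_def)
  next
    case False
    define j where "j = nat (- k)"
    have k: "k = - int j" using False by (simp add: j_def)
    have "complete_QF (\<lambda>n. of_int k * x ^ n) * complete_QF (\<lambda>n. of_nat j * x ^ n) = 1"
      unfolding complete_QF_add[symmetric] k by (simp add: complete_QF_zero)
    then have "complete_QF (\<lambda>n. of_int k * x ^ n) * inverse ?u ^ j = 1" by (simp only: nat)
    then have "complete_QF (\<lambda>n. of_int k * x ^ n) = ?u ^ j"
      using one_minus_QF_nonzero[of x] by (simp add: field_simps)
    then show ?thesis by (simp add: k)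
  qed
qed

lemma complete_QF_sum: "finite A \<Longrightarrow> complete_QF (\<lambda>n. \<Sum>i\<in>A. p i n) = (\<Prod>i\<in>A. complete_QF (p i))"
  by (simp add: complete_QF_def complete_fps_sum subst_QF_prod)

lemma KQF_eq:
  assumes "\<mu> \<in> partitions" "\<alpha> \<in> partitions"
  shows "KQF \<mu> \<alpha> = fls_const (W1 \<mu> * W1 \<alpha>) * complete_QF (\<lambda>n. psum_rho \<mu> n * psum_rho \<alpha> n)"
  unfolding complete_QF_def subst_QF_const[symmetric] subst_QF_mult[symmetric] Kser_eq[OF assms, symmetric]
  by (simp add: KQF_def subst_QF_def)

lemma W1_empty: "W1 empty_part = 1"
  by (simp add: W1_eq_schur schur_def)

lemma KQF_empty: "KQF empty_part empty_part = complete_QF (\<lambda>n. psum_rho empty_part n * psum_rho empty_part n)"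
  by (simp add: KQF_eq W1_empty)

text \<open>
  By \<open>psum_rho_product\<close> the power sums of \<open>K\<^bsub>0,0\<^esub>\<close> are those of \<open>K\<^bsub>\<mu>,\<alpha>\<^sup>t\<^esub>\<close> together with the variables \<open>q\<^sup>m\<close>, each
  with multiplicity \<open>e\<^sub>m\<close>.
\<close>

lemma KQF_ratio:
  assumes mu: "\<mu> \<in> partitions" and la: "\<alpha> \<in> partitions"
  shows "KQF \<mu> (ptrans \<alpha>) = fls_const (W1 \<mu> * W1 (ptrans \<alpha>)) * KQF empty_part empty_part *
     (\<Prod>m | ecoef \<mu> \<alpha> m \<noteq> 0. (1 - fls_const (qh powi (2 * m)) * QF) powi ecoef \<mu> \<alpha> m)"
proof -
  let ?E = "{m. ecoef \<mu> \<alpha> m \<noteq> 0}"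
  let ?u = "\<lambda>m. 1 - fls_const (qh powi (2 * m)) * QF"
  let ?p = "\<lambda>n. psum_rho \<mu> n * psum_rho (ptrans \<alpha>) n"
  have "complete_fps (\<lambda>n. psum_rho empty_part n * psum_rho empty_part n) = 
     complete_fps (\<lambda>n. ?p n + (\<Sum>m\<in>?E. of_int (ecoef \<mu> \<alpha> m) * (qh powi (2 * m)) ^ n))"
    by (rule complete_fps_cong) (rule psum_rho_product[OF mu la, symmetric])
  then have "KQF empty_part empty_part = complete_QF ?p * complete_QF (\<lambda>n. \<Sum>m\<in>?E. of_int (ecoef \<mu> \<alpha> m) * (qh powi (2 * m)) ^ n)"
    unfolding KQF_empty complete_QF_def by (simp only: complete_fps_add subst_QF_mult)
  also have "complete_QF (\<lambda>n. \<Sum>m\<in>?E. of_int (ecoef \<mu> \<alpha> m) * (qh powi (2 * m)) ^ n) = 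
      (\<Prod>m\<in>?E. ?u m powi (- ecoef \<mu> \<alpha> m))"
    by (simp only: complete_QF_sum[OF ecoef_sum(1)[OF mu la]] complete_QF_multiple)
  finally have "KQF empty_part empty_part * (\<Prod>m\<in>?E. ?u m powi ecoef \<mu> \<alpha> m) = 
     complete_QF ?p * (\<Prod>m\<in>?E. ?u m powi (- ecoef \<mu> \<alpha> m) * ?u m powi ecoef \<mu> \<alpha> m)"
    by (simp only: prod.distrib mult.assoc)
  also have "(\<Prod>m\<in>?E. ?u m powi (- ecoef \<mu> \<alpha> m) * ?u m powi ecoef \<mu> \<alpha> m) = 1"
    using one_minus_QF_nonzero by (intro prod.neutral) (simp flip: power_int_add)
  finally show ?thesis
    by (simp only: KQF_eq[OF mu ptrans_in_partitions[OF la]] mult.assoc mult_1_right)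
qed

lemma cq_add: "cq (k + l) = cq k * cq l"
  by (simp add: cq_def qh_powi_add)

lemma cq_nonzero [simp]: "cq k \<noteq> 0"
  by (simp add: cq_def)

lemma QFh_nonzero [simp]: "QFh \<noteq> 0"
  by (simp add: QFh_def)

lemma cq_powi: "cq k powi l = cq (k * l)"
  by (simp add: cq_def power_int_mult flip: fls_const_power_int)

lemma sinh_half_0: "sinh_half 0 m = fls_const (- (qbr m / 2))"
proof -
  have "sinh_half 0 m = fls_const (qh powi (- m) - qh powi m) / fls_const 2"
    by (simp add: sinh_half_def cq_def fls_minus_const)
  also have "\<dots> = fls_const ((qh powi (- m) - qh powi m) / 2)"
    by (rule fls_const_divide_const)
  also have "(qh powi (- m) - qh powi m) / 2 = - (qbr m / 2)"
    by (simp add: qbr_def field_simps)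
  finally show ?thesis .
qed

lemma sinh_half_1: "sinh_half 1 m = (inverse (2 * QFh) * cq (- m)) * (1 - fls_const (qh powi (2 * m)) * QF)"
proof -
  have "cq (- m) * cq (2 * m) = cq m" by (simp flip: cq_add)
  then have "cq (- m) * fls_const (qh powi (2 * m)) = cq m" by (simp add: cq_def)
  then have "cq (- m) * (1 - fls_const (qh powi (2 * m)) * QF) = cq (- m) - cq m * QFh * QFh"
    by (simp add: right_diff_distrib QF_def power2_eq_square mult.assoc[symmetric])
  moreover have "sinh_half 1 m = inverse (2 * QFh) * (cq (- m) - cq m * QFh * QFh)"
    by (simp add: sinh_half_def field_simps power_int_minus)
  ultimately show ?thesis by (simp only: mult.assoc)
qed

text \<open>
  The factors \<open>- 1/2\<close> of the hyperbolic sines cancel between numerators and denominators of the pairs and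
  leave one factor \<open>- 2\<close> for each box.
\<close>

lemma sinh_prod_self_eq:
  assumes mu: "\<mu> \<in> partitions"
  shows "sinh_prod_self \<mu> = fls_const (4 ^ part_size \<mu> * qh powi (- kappa \<mu>) * (W1 \<mu>) ^ 2)"
proof -
  let ?f = "\<lambda>m. - (qbr m / 2)"
  let ?P = "{(i, j). 1 \<le> i \<and> i < j \<and> j \<le> plen \<mu>}"
  define R where "R = (\<Prod>(i, j)\<in>?P. qbr (int (\<mu> i) - int (\<mu> j) + int j - int i) / qbr (int j - int i))"
  define S where "S = (\<Prod>i=1..plen \<mu>. \<Prod>v=1..\<mu> i. 1 / qbr (int v - int i + int (plen \<mu>)))"
  have "(\<Prod>m | m \<ge> 1 \<and> ecoef' \<mu> m \<noteq> 0. ?f m powi ecoef' \<mu> m) = 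
    (\<Prod>(i, j)\<in>?P. ?f (int (\<mu> i) - int (\<mu> j) + int j - int i) / ?f (int j - int i))
    * (\<Prod>i=1..plen \<mu>. \<Prod>v=1..\<mu> i. 1 / ?f (int v - int i + int (plen \<mu>)))"
    by (rule prod_powi_ecoef'[OF mu]) simp
  also have "(\<Prod>(i, j)\<in>?P. ?f (int (\<mu> i) - int (\<mu> j) + int j - int i) / ?f (int j - int i)) = R"
    unfolding R_def by (rule prod.cong) auto
  also have "(\<Prod>i=1..plen \<mu>. \<Prod>v=1..\<mu> i. 1 / ?f (int v - int i + int (plen \<mu>))) = 
     (\<Prod>i=1..plen \<mu>. \<Prod>v=1..\<mu> i. (- 2) * (1 / qbr (int v - int i + int (plen \<mu>))))"
    by simp
  also have "\<dots> = (- 2) ^ part_size \<mu> * S"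
    unfolding S_def prod.distrib by (simp add: part_size_def power_sum)
  finally have "(\<Prod>m | m \<ge> 1 \<and> ecoef' \<mu> m \<noteq> 0. ?f m powi ecoef' \<mu> m) = (- 2) ^ part_size \<mu> * (R * S)"
    by (simp only: mult_ac)
  moreover have "W1 \<mu> = qh powi (kappa \<mu> div 2) * (R * S)"
    by (simp only: W1_def R_def S_def mult.assoc)
  then have "R * S = qh powi (- (kappa \<mu> div 2)) * W1 \<mu>"
    by (simp add: mult.assoc[symmetric] flip: qh_powi_add)
  ultimately have "(\<Prod>m | m \<ge> 1 \<and> ecoef' \<mu> m \<noteq> 0. ?f m powi ecoef' \<mu> m) ^ 2 = 
     ((- 2) ^ 2) ^ part_size \<mu> * qh powi (- (kappa \<mu> div 2) * int 2) * (W1 \<mu>) ^ 2"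
    by (simp only: power_mult_distrib power_mult[symmetric] mult.commute[of 2] power_int_power' mult.assoc)
  also have "- (kappa \<mu> div 2) * int 2 = - kappa \<mu>"
    using even_kappa[of \<mu>] by simp
  finally have main: "(\<Prod>m | m \<ge> 1 \<and> ecoef' \<mu> m \<noteq> 0. ?f m powi ecoef' \<mu> m) ^ 2 = 4 ^ part_size \<mu> * qh powi (- kappa \<mu>) * (W1 \<mu>) ^ 2"
    by simp
  have hom: "fls_const (\<Prod>x\<in>A. g x) = (\<Prod>x\<in>A. fls_const (g x))" for A :: "int set" and g :: "int \<Rightarrow> qfun"
    by (induction A rule: infinite_finite_induct) (auto simp flip: fls_const_mult_const)
  show ?thesis
    unfolding sinh_prod_self_def sinh_half_0 fls_const_power_int[symmetric] hom[symmetric] fls_const_power[symmetric] main ..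
qed

text \<open>
  Each sine is \<open>1 - q\<^sup>m Q\<^sub>F\<close> up to \<open>q\<^bsup>-m/2\<^esup> / (2 Q\<^sub>F\<^bsup>1/2\<^esup>)\<close>, so the prefactors involve the exponents only through
  \<open>\<Sum> e\<^sub>m = - |\<mu>| - |\<alpha>|\<close> and \<open>\<Sum> m e\<^sub>m = - (\<kappa>\<^sub>\<mu> - \<kappa>\<^sub>\<alpha>) / 2\<close>.
\<close>

lemma sinh_prod_cross_eq:
  assumes mu: "\<mu> \<in> partitions" and la: "\<alpha> \<in> partitions"
  shows "sinh_prod_cross \<mu> \<alpha> ^ 2 = (4 * QF) ^ (part_size \<mu> + part_size \<alpha>) * cq (kappa \<mu> - kappa \<alpha>) *
    (\<Prod>m | ecoef \<mu> \<alpha> m \<noteq> 0. (1 - fls_const (qh powi (2 * m)) * QF) powi ecoef \<mu> \<alpha> m) ^ 2"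
proof -
  let ?E = "{m. ecoef \<mu> \<alpha> m \<noteq> 0}"
  let ?u = "\<lambda>m. 1 - fls_const (qh powi (2 * m)) * QF"
  let ?e = "ecoef \<mu> \<alpha>"
  \<comment> \<open>The prefactors are collected into single powers of \<open>1 / (2 Q\<^sub>F\<^bsup>1/2\<^esup>)\<close> and \<open>q\<^bsup>1/2\<^esup>\<close>.\<close>
  have powi_sum: "(\<Prod>m\<in>A. x powi g m) = x powi (\<Sum>m\<in>A. g m)" if "finite A" "x \<noteq> 0" for A and g :: "int \<Rightarrow> int" and x :: cfun
    using that by (induction A rule: finite_induct) (auto simp: power_int_add)
  have inv: "inverse x powi (- int k) = x ^ k" for x :: cfun and k
    by (simp add: power_int_minus power_inverse)
  have fin: "finite ?E" by (rule ecoef_sum(1)[OF mu la])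
  have s1: "(\<Sum>m\<in>?E. ?e m) = - int (part_size \<mu> + part_size \<alpha>)"
    using ecoef_sum(2)[OF mu la, of "\<lambda>m. 1 :: int"]
    by (simp add: pair_functional_def content_sum_zero content_sum_def part_size_def)
  have s2: "2 * (\<Sum>m\<in>?E. ?e m * m) = - (kappa \<mu> - kappa \<alpha>)"
    using ecoef_sum(2)[OF mu la, of "\<lambda>m. m :: int"] content_sum_mult[of \<alpha> "-1" "\<lambda>c. c :: int"]
    by (simp add: pair_functional_def content_sum_zero kappa_content_sum)
  have "sinh_prod_cross \<mu> \<alpha> = (\<Prod>m\<in>?E. inverse (2 * QFh) powi ?e m * cq 1 powi (- (?e m * m)) * ?u m powi ?e m)"
    unfolding sinh_prod_cross_def sinh_half_1 power_int_mult_distrib cq_powi by (simp add: mult.commute)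
  also have "\<dots> = inverse (2 * QFh) powi (\<Sum>m\<in>?E. ?e m) * cq 1 powi (\<Sum>m\<in>?E. - (?e m * m)) * (\<Prod>m\<in>?E. ?u m powi ?e m)"
    by (simp add: prod.distrib powi_sum[OF fin])
  also have "inverse (2 * QFh) powi (\<Sum>m\<in>?E. ?e m) = (2 * QFh) ^ (part_size \<mu> + part_size \<alpha>)"
    unfolding s1 by (rule inv)
  finally have "sinh_prod_cross \<mu> \<alpha> ^ 2 = ((2 * QFh) ^ 2) ^ (part_size \<mu> + part_size \<alpha>) *
      cq (- (2 * (\<Sum>m\<in>?E. ?e m * m))) * (\<Prod>m\<in>?E. ?u m powi ?e m) ^ 2"
    by (simp only: power_mult_distrib power_mult[symmetric] mult.commute[of 2] cq_powi power_int_power'[of "cq 1"] sum_negf mult_1)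
      (simp add: cq_def power_int_power' flip: fls_const_power)
  then show ?thesis unfolding s2 by (simp add: power_mult_distrib QF_def)
qed

text \<open>
  The powers of \<open>q\<^bsup>1/2\<^esup>\<close> are \<open>- \<kappa>\<^sub>\<mu>\<close> and \<open>\<kappa>\<^sub>\<alpha>\<close> from the two self products, the latter evaluated at \<open>\<alpha>\<^sup>t\<close>, and
  \<open>\<kappa>\<^sub>\<mu> - \<kappa>\<^sub>\<alpha>\<close> from the square of the cross product; they cancel.
\<close>

lemma KQF_square:
  assumes mu: "\<mu> \<in> partitions" and la: "\<alpha> \<in> partitions"
  shows "KQF \<mu> (ptrans \<alpha>) ^ 2 = KQF empty_part empty_part ^ 2 *
    ((inverse (2 ^ 4) * inverse QF) ^ (part_size \<mu> + part_size \<alpha>) *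
      (\<Prod>l = 1..2. \<Prod>n = 1..2. sinh_prod l n \<mu> \<alpha>))"
proof -
  let ?U = "\<Prod>m | ecoef \<mu> \<alpha> m \<noteq> 0. (1 - fls_const (qh powi (2 * m)) * QF) powi ecoef \<mu> \<alpha> m"
  let ?s = "part_size \<mu> + part_size \<alpha>"
  let ?w = "fls_const (W1 \<mu> ^ 2) * fls_const (W1 (ptrans \<alpha>) ^ 2)"
  have nz: "QF \<noteq> 0" by (simp add: QF_def)
  have c4: "fls_const (4 ^ a * qh powi k * w) = 4 ^ a * cq k * fls_const w" for a k w
    by (simp only: fls_const_mult_const[symmetric] fls_const_power fls_const_numeral cq_def)
  have "(\<Prod>l = 1..2. \<Prod>n = 1..2. sinh_prod l n \<mu> \<alpha>) = sinh_prod_self \<mu> * sinh_prod_self (ptrans \<alpha>) * sinh_prod_cross \<mu> \<alpha> ^ 2"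
    by (simp add: sinh_prod_def sinh_prod_self_ptrans[OF la] numeral_2_eq_2 mult_ac)
  also have "\<dots> = (4 ^ part_size \<mu> * cq (- kappa \<mu>) * fls_const (W1 \<mu> ^ 2)) * (4 ^ part_size \<alpha> * cq (kappa \<alpha>) * fls_const (W1 (ptrans \<alpha>) ^ 2)) *
     ((4 * QF) ^ ?s * cq (kappa \<mu> - kappa \<alpha>) * ?U ^ 2)"
    unfolding sinh_prod_self_eq[OF mu] sinh_prod_self_eq[OF ptrans_in_partitions[OF la]] sinh_prod_cross_eq[OF mu la]
      kappa_ptrans[OF la] part_size_ptrans[OF la] c4 minus_minus ..
  also have "\<dots> = (cq (- kappa \<mu>) * cq (kappa \<alpha>) * cq (kappa \<mu> - kappa \<alpha>)) *
      ((4 ^ part_size \<mu> * 4 ^ part_size \<alpha> * (4 * QF) ^ ?s) * (?w * ?U ^ 2))"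
    by (simp only: mult_ac)
  also have "(4 :: cfun) ^ part_size \<mu> * 4 ^ part_size \<alpha> * (4 * QF) ^ ?s = (2 ^ 4 * QF) ^ ?s"
  proof -
    have "(2 :: cfun) ^ 4 = 4 * 4" by simp
    then show ?thesis by (simp only: power_mult_distrib power_add mult_ac)
  qed
  also have "cq (- kappa \<mu>) * cq (kappa \<alpha>) * cq (kappa \<mu> - kappa \<alpha>) = 1"
  proof -
    have "- kappa \<mu> + kappa \<alpha> + (kappa \<mu> - kappa \<alpha>) = 0" by simp
    then show ?thesis unfolding cq_add[symmetric] by (simp add: cq_def)
  qed
  finally have "(inverse (2 ^ 4) * inverse QF) ^ ?s * (\<Prod>l = 1..2. \<Prod>n = 1..2. sinh_prod l n \<mu> \<alpha>) =
     ((inverse (2 ^ 4) * inverse QF) * (2 ^ 4 * QF)) ^ ?s * (?w * ?U ^ 2)"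
    by (simp only: power_mult_distrib mult_1 mult.assoc)
  also have "(inverse (2 ^ 4) * inverse QF) * (2 ^ 4 * QF) = 1" using nz by simp
  finally have eq: "(inverse (2 ^ 4) * inverse QF) ^ ?s * (\<Prod>l = 1..2. \<Prod>n = 1..2. sinh_prod l n \<mu> \<alpha>) = ?w * ?U ^ 2"
    by (simp only: power_one mult_1)
  show ?thesis
    unfolding KQF_ratio[OF mu la] eq
    by (simp only: power_mult_distrib fls_const_mult_const[symmetric] fls_const_power mult_ac)
qed

lemma fps_family_sum_cong:
  "(\<And>i. i \<in> A \<Longrightarrow> f i = g i) \<Longrightarrow> fps_family_sum f A = fps_family_sum g A"
  unfolding fps_family_sum_def by (auto intro!: arg_cong[where f = Abs_fps] ext sum.cong)

lemma fps_family_sum_mult_const: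
  fixes f :: "'i \<Rightarrow> 'a::idom fps"
  assumes "c \<noteq> 0"
  shows "fps_family_sum f A * fps_const c = fps_family_sum (\<lambda>i. f i * fps_const c) A"
  using assms by (auto simp: fps_family_sum_def fps_eq_iff sum_distrib_right)

lemma Z_ratio:
  "Z m / fps_const (KQF empty_part empty_part ^ 2) =
      fps_family_sum (\<lambda>(\<mu>1, \<mu>2).
        (fps_const ((- 1) ^ m * inverse (2 ^ 4) * inverse QF) * QB) ^ (part_size \<mu>1 + part_size \<mu>2)
        * fps_const (QF ^ (m * part_size \<mu>2) * cq (- (int m * (kappa \<mu>1 + kappa \<mu>2)))
                     * (\<Prod>l = 1..2. \<Prod>n = 1..2. sinh_prod l n \<mu>1 \<mu>2)))
        (partitions \<times> partitions)"
proof -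
  let ?K = "KQF empty_part empty_part"
  have K: "?K \<noteq> 0" unfolding KQF_empty by (rule complete_QF_nonzero)
  have "Z m / fps_const (?K ^ 2) = Z m * fps_const (inverse (?K ^ 2))"
    using K by (simp add: fps_divide_unit fps_const_inverse)
  also have "\<dots> = fps_family_sum (\<lambda>i. (case i of (\<mu>1, \<mu>2) \<Rightarrow>
     QB ^ (part_size \<mu>1 + part_size \<mu>2)
     * fps_const (((- 1) ^ (part_size \<mu>1 + part_size \<mu>2) * QF ^ part_size \<mu>2 * cq (- (kappa \<mu>1 + kappa \<mu>2))) ^ m
                  * KQF \<mu>1 (ptrans \<mu>2) ^ 2)) * fps_const (inverse (?K ^ 2))) (partitions \<times> partitions)"
    unfolding Z_def using K by (intro fps_family_sum_mult_const) simp
  also have "\<dots> = fps_family_sum (\<lambda>(\<mu>1, \<mu>2).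
        (fps_const ((- 1) ^ m * inverse (2 ^ 4) * inverse QF) * QB) ^ (part_size \<mu>1 + part_size \<mu>2)
        * fps_const (QF ^ (m * part_size \<mu>2) * cq (- (int m * (kappa \<mu>1 + kappa \<mu>2)))
                     * (\<Prod>l = 1..2. \<Prod>n = 1..2. sinh_prod l n \<mu>1 \<mu>2)))
        (partitions \<times> partitions)"
  proof (rule fps_family_sum_cong, clarify)
    fix \<mu>1 \<mu>2 assume mu: "\<mu>1 \<in> partitions" "\<mu>2 \<in> partitions"
    let ?s = "part_size \<mu>1 + part_size \<mu>2"
    let ?P = "\<Prod>l = 1..2. \<Prod>n = 1..2. sinh_prod l n \<mu>1 \<mu>2"
    have "cq (- (kappa \<mu>1 + kappa \<mu>2)) ^ m = cq (- (int m * (kappa \<mu>1 + kappa \<mu>2)))"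
      unfolding minus_mult_right cq_def fls_const_power[symmetric] power_int_power' by (simp only: mult.commute)
    then have sign: "((- 1) ^ ?s * QF ^ part_size \<mu>2 * cq (- (kappa \<mu>1 + kappa \<mu>2))) ^ m =
       ((- 1) ^ m) ^ ?s * (QF ^ (m * part_size \<mu>2) * cq (- (int m * (kappa \<mu>1 + kappa \<mu>2))))"
      by (simp only: power_mult_distrib power_mult[symmetric] mult.commute[of m] mult.assoc)
    have ratio: "KQF \<mu>1 (ptrans \<mu>2) ^ 2 * inverse (?K ^ 2) = (inverse (2 ^ 4) * inverse QF) ^ ?s * ?P"
      unfolding KQF_square[OF mu] using K by simp
    have *: "((- 1) ^ ?s * QF ^ part_size \<mu>2 * cq (- (kappa \<mu>1 + kappa \<mu>2))) ^ m
                  * KQF \<mu>1 (ptrans \<mu>2) ^ 2 * inverse (?K ^ 2) = 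
       ((- 1) ^ m * inverse (2 ^ 4) * inverse QF) ^ ?s * (QF ^ (m * part_size \<mu>2) * cq (- (int m * (kappa \<mu>1 + kappa \<mu>2))) * ?P)"
      unfolding mult.assoc[of _ "KQF \<mu>1 (ptrans \<mu>2) ^ 2"] sign ratio by (simp only: power_mult_distrib mult_ac)
    show "QB ^ ?s * fps_const (((- 1) ^ ?s * QF ^ part_size \<mu>2 * cq (- (kappa \<mu>1 + kappa \<mu>2))) ^ m
                  * KQF \<mu>1 (ptrans \<mu>2) ^ 2) * fps_const (inverse (?K ^ 2)) =
       (fps_const ((- 1) ^ m * inverse (2 ^ 4) * inverse QF) * QB) ^ ?s
        * fps_const (QF ^ (m * part_size \<mu>2) * cq (- (int m * (kappa \<mu>1 + kappa \<mu>2))) * ?P)"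
      unfolding mult.assoc[of "QB ^ ?s"] fps_const_mult * unfolding power_mult_distrib fps_const_power
      by (simp only: fps_const_mult[symmetric] mult_ac)
  qed
  finally show ?thesis .
qed

theorem theorem9p1:
  shows "(\<forall>m \<in> {0, 1, 2 :: nat}.
      Z m / fps_const (KQF empty_part empty_part ^ 2) =
      fps_family_sum (\<lambda>(\<mu>1, \<mu>2).
        (fps_const ((- 1) ^ m * inverse (2 ^ 4) * inverse QF) * QB) ^ (part_size \<mu>1 + part_size \<mu>2)
        * fps_const (QF ^ (m * part_size \<mu>2) * cq (- (int m * (kappa \<mu>1 + kappa \<mu>2)))
                     * (\<Prod>l = 1..2. \<Prod>n = 1..2. sinh_prod l n \<mu>1 \<mu>2)))
        (partitions \<times> partitions))
    \<and>
      Z 0 / fps_const (KQF empty_part empty_part ^ 2) =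
      fps_family_sum (\<lambda>(\<mu>1, \<mu>2).
        (fps_const (inverse (2 ^ 4 * QF)) * QB) ^ (part_size \<mu>1 + part_size \<mu>2)
        * fps_const (\<Prod>l = 1..2. \<Prod>n = 1..2. sinh_prod l n \<mu>1 \<mu>2))
        (partitions \<times> partitions)"
proof (intro conjI ballI)
  fix m :: nat
  show "Z m / fps_const (KQF empty_part empty_part ^ 2) =
      fps_family_sum (\<lambda>(\<mu>1, \<mu>2).
        (fps_const ((- 1) ^ m * inverse (2 ^ 4) * inverse QF) * QB) ^ (part_size \<mu>1 + part_size \<mu>2)
        * fps_const (QF ^ (m * part_size \<mu>2) * cq (- (int m * (kappa \<mu>1 + kappa \<mu>2)))
                     * (\<Prod>l = 1..2. \<Prod>n = 1..2. sinh_prod l n \<mu>1 \<mu>2)))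
        (partitions \<times> partitions)"
    by (rule Z_ratio)
next
  have "cq 0 = 1" by (simp add: cq_def)
  then show "Z 0 / fps_const (KQF empty_part empty_part ^ 2) =
      fps_family_sum (\<lambda>(\<mu>1, \<mu>2).
        (fps_const (inverse (2 ^ 4 * QF)) * QB) ^ (part_size \<mu>1 + part_size \<mu>2)
        * fps_const (\<Prod>l = 1..2. \<Prod>n = 1..2. sinh_prod l n \<mu>1 \<mu>2))
        (partitions \<times> partitions)"
    using Z_ratio[of 0]
    by (simp only: power_0 mult_0 of_nat_0 minus_zero mult_1 inverse_mult_distrib mult_zero_left)
qed

end
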